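(* Let $L\subseteq\mathbb{R}^n$ be a positive definite even integral lattice with respect to a positive definite inner product $B$ on $\mathbb{R}^n$ (extended bilinearly to $\mathbb{C}^n$), $Q(x)=\frac12B(x,x)$, $N$ the level, $D=|L^\sharp/L|$. For $t\in L^\sharp$, $\tau$ in the upper half-plane and $z\in\mathbb{C}^n$ let $\vartheta_{L,t}(\tau,z)=\sum_{v\in t+L}e(\tau Q(v)+B(v,z))$. Let $\begin{pmatrix}a&b\\c&d\end{pmatrix}\in\mathrm{SL}_2(\mathbb{Z})$ with $c>0$, $\gcd(c,N)=1$ and $a\neq0$. Then $$(c\tau+d)^{-n/2}e\!\left(-\frac{c}{c\tau+d}Q(z)\right)\vartheta_{L,t}\!\left(\frac{a\tau+b}{c\tau+d},\frac{z}{c\tau+d}\right)=\gamma\sum_{v\in L^\sharp}c(v,t)\,e(\tau Q(v))\,e(B(v,z)),$$ where $$\gamma=\frac{1}{\sqrt D}(-i)^{n/2}\left(\frac{|a|}{c}\right)_K^n\left(\frac Dc\right)_K e\!\left(\frac{n\,\mathrm{sgn}(a)(1-c_0)}{8}\right),\qquad c(v,t)=e\!\left(\frac{b+c'}{a}Q(v)-c'B(t,v)+ac'Q(t)\right),$$ $c_0$ is the odd part of $c$, and $c'$ is any integer with $cc'\equiv1\pmod{aN}$.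
   Context: $e(z)=\exp(2\pi i z)$; fractional powers are principal branches. $L^\sharp=\{x\in\mathbb{R}^n:B(x,y)\in\mathbb{Z}\ \forall y\in L\}$; $L$ even integral means $Q(L)\subseteq\mathbb{Z}$; the level $N$ is the least positive integer with $NQ(x)\in\mathbb{Z}$ for all $x\in L^\sharp$. $(\frac{\cdot}{\cdot})_K$ is the Kronecker–Jacobi symbol; $c=2^ec_0$ with $c_0$ odd. *)

theory Defs
  imports "HOL-Analysis.Analysis" "HOL-Number_Theory.Number_Theory"
begin

definition ee :: "complex \<Rightarrow> complex" where
  "ee z = exp (2 * of_real pi * \<i> * z)"

definition pos_def_inner_product :: "(real ^ 'n \<Rightarrow> real ^ 'n \<Rightarrow> real) \<Rightarrow> bool" where
  "pos_def_inner_product B \<longleftrightarrow>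
     bilinear B \<and> (\<forall>x y. B x y = B y x) \<and> (\<forall>x. x \<noteq> 0 \<longrightarrow> B x x > 0)"

definition quad :: "(real ^ 'n \<Rightarrow> real ^ 'n \<Rightarrow> real) \<Rightarrow> real ^ 'n \<Rightarrow> real" where
  "quad B x = B x x / 2"

definition cvec :: "real ^ 'n \<Rightarrow> complex ^ 'n" where
  "cvec x = (\<chi> i. of_real (x $ i))"

text \<open>The extension to complex vectors is bilinear, not sesquilinear.\<close>

definition cbilin ::
  "(real ^ 'n \<Rightarrow> real ^ 'n \<Rightarrow> real) \<Rightarrow> complex ^ 'n \<Rightarrow> complex ^ 'n \<Rightarrow> complex" where
  "cbilin B z w =
     (\<Sum>i\<in>UNIV. \<Sum>j\<in>UNIV. z $ i * w $ j * of_real (B (axis i 1) (axis j 1)))"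

definition cquad :: "(real ^ 'n \<Rightarrow> real ^ 'n \<Rightarrow> real) \<Rightarrow> complex ^ 'n \<Rightarrow> complex" where
  "cquad B z = cbilin B z z / 2"

lemma cbilin_cvec:
  assumes "bilinear B"
  shows "cbilin B (cvec x) (cvec y) = of_real (B x y)"
proof -
  have lin: "linear (\<lambda>x. B x y)" "linear (B x)" for x y
    using assms by (auto simp: bilinear_def)
  have ex: "x = (\<Sum>i\<in>UNIV. x $ i *\<^sub>R axis i 1)" for x :: "real ^ 'n"
    by (simp add: vec_eq_iff axis_def if_distrib[of "\<lambda>z. _ * z"] cong: if_cong)
  have "B x y = B (\<Sum>i\<in>UNIV. x $ i *\<^sub>R axis i 1) (\<Sum>j\<in>UNIV. y $ j *\<^sub>R axis j 1)"
    by (simp only: ex[symmetric])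
  also have "\<dots> = (\<Sum>i\<in>UNIV. \<Sum>j\<in>UNIV. x $ i * y $ j * B (axis i 1) (axis j 1))"
    by (subst sum.swap) (simp add: linear_sum[OF lin(1)] linear_sum[OF lin(2)]
        linear_cmul[OF lin(1)] linear_cmul[OF lin(2)] sum_distrib_left mult_ac)
  finally show ?thesis
    by (simp add: cbilin_def cvec_def)
qed

lemma cquad_cvec: "bilinear B \<Longrightarrow> cquad B (cvec x) = of_real (quad B x)"
  by (simp add: cquad_def quad_def cbilin_cvec)

text \<open>Lattices are of full rank.\<close>

definition is_lattice :: "(real ^ 'n) set \<Rightarrow> bool" where
  "is_lattice L \<longleftrightarrow>
     (\<exists>bs. independent bs \<and> span bs = UNIV \<and>
           L = {\<Sum>b\<in>bs. of_int (k b) *\<^sub>R b | k :: real ^ 'n \<Rightarrow> int. True})"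

definition even_integral :: "(real ^ 'n \<Rightarrow> real ^ 'n \<Rightarrow> real) \<Rightarrow> (real ^ 'n) set \<Rightarrow> bool" where
  "even_integral B L \<longleftrightarrow> quad B ` L \<subseteq> \<int>"

definition dual_lattice ::
  "(real ^ 'n \<Rightarrow> real ^ 'n \<Rightarrow> real) \<Rightarrow> (real ^ 'n) set \<Rightarrow> (real ^ 'n) set" where
  "dual_lattice B L = {x. \<forall>y\<in>L. B x y \<in> \<int>}"

definition level :: "(real ^ 'n \<Rightarrow> real ^ 'n \<Rightarrow> real) \<Rightarrow> (real ^ 'n) set \<Rightarrow> nat" where
  "level B L = (LEAST N. N > 0 \<and> (\<forall>x\<in>dual_lattice B L. real N * quad B x \<in> \<int>))"

definition disc :: "(real ^ 'n \<Rightarrow> real ^ 'n \<Rightarrow> real) \<Rightarrow> (real ^ 'n) set \<Rightarrow> nat" where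
  "disc B L = card (dual_lattice B L // {(x, y). x - y \<in> L})"

definition theta ::
  "(real ^ 'n \<Rightarrow> real ^ 'n \<Rightarrow> real) \<Rightarrow> (real ^ 'n) set \<Rightarrow> real ^ 'n \<Rightarrow> complex \<Rightarrow> complex ^ 'n \<Rightarrow> complex"
where
  "theta B L t \<tau> z =
     (\<Sum>\<^sub>\<infinity>v\<in>(\<lambda>x. t + x) ` L. ee (\<tau> * of_real (quad B v) + cbilin B (cvec v) z))"

definition kronecker_prime :: "int \<Rightarrow> int \<Rightarrow> int" where
  "kronecker_prime a p =
     (if p = 2 then (if even a then 0 else if a mod 8 \<in> {1, 7} then 1 else -1)
      else Legendre a p)"

text \<open>
  The prime factors of an integer are the positive ones, so that the sign of \<open>m\<close> enters
  through the symbol at the unit only.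
\<close>

definition kronecker :: "int \<Rightarrow> int \<Rightarrow> int" where
  "kronecker a m =
     (if m = 0 then (if \<bar>a\<bar> = 1 then 1 else 0)
      else (if m < 0 \<and> a < 0 then -1 else 1) * (\<Prod>p\<in>#prime_factorization m. kronecker_prime a p))"

end

theory Submission
  imports Defs "HOL-Probability.Characteristic_Functions" "HOL-Complex_Analysis.Conformal_Mappings"
    "HOL-Real_Asymp.Real_Asymp" "HOL-Library.Nat_Bijection"
begin

text \<open>
  Splitting \<open>t + L\<close> into cosets of \<open>c L\<close> and applying Poisson summation to each of them expresses
  the theta function at the transformed point as a theta series over the dual lattice with Gauss
  sums as coefficients; completing the square reduces these to
  \<open>G(a, c) = \<Sum> e(a Q(l) / c)\<close>, where \<open>l\<close> runs over \<open>L / c L\<close>.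

  Poisson summation is reduced to one dimension: \<open>L\<close> contains a sublattice with an orthogonal basis,
  where the sum is a product, and summing over the cosets of the sublattice gives the formula for
  \<open>L\<close>.  Applying it twice identifies the covolume with the square root of the discriminant.

  For odd \<open>c\<close> the Gauss sum is evaluated by multiplicativity and by the reduction of prime powers to
  primes; modulo an odd prime \<open>p\<close> one takes an orthogonal sublattice of index prime to \<open>p\<close>.  The
  signs come from reciprocity, which is the constant term of the theta transformation for
  \<open>a = d = 1\<close>, \<open>b = 0\<close>.  Reciprocity also shows that the Gauss sum for \<open>a = 1\<close> depends, up to the factor
  \<open>c\<^sup>n\<^sup>/\<^sup>2\<close>, on \<open>c\<close> modulo the level only, and this reduces the modulus \<open>2\<close> to an odd one.
\<close>

text \<open>No covolume and no integral over R^n is introduced: the constant that the orthogonal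
  sublattice produces, index over the square root of the product of norms, is evaluated afterwards
  by self-consistency. In dimension one, real parameters are settled by Fourier coefficients and
  analytic continuation does the rest, which also fixes the branch of the root.

  Coprimality of c and N acts twice: N kills \<open>Ld / L\<close>, so c' completes the square, and
  the form is nondegenerate modulo each prime dividing c. Modulo an odd prime the numerator is 2a,
  not a, because the diagonal values of B are twice those of Q, and D is their product up to a
  square; the classical sum with numerator 2 is the source of e((1 - \<open>c\<^sub>0\<close>)/8).
  The obstacle is 2, where B(v, v) is always even, so that no orthogonal basis with odd norms
  exists. But an even c forces N to be odd and then the rank to be even, after which n-th powers of
  symbols and the sign of a cease to matter.

  The classical Gauss sums are those of lattices of rank one, so multiplicativity, reduction of
  prime powers and reciprocity are proved only once.\<close>

no_notation Infinite_Set_Sum.abs_summable_on (infix "abs'_summable'_on" 50)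

section \<open>One-dimensional theta series\<close>

lemma int_encode_le: "int_encode i \<le> 2 * nat \<bar>i\<bar>"
  by (auto simp: int_encode_def sum_encode_def)

text \<open>Completing the square bounds each term by a constant times exp(-|x|), and
  \<open>int_decode\<close> reaches x at an index of at most 2 |x|; in this order the terms are
  dominated by a geometric series.\<close>

lemma abs_summable_gauss_int:
  fixes \<epsilon> M :: real
  assumes "\<epsilon> > 0"
  shows "(\<lambda>x::int. exp (- \<epsilon> * (of_int x)\<^sup>2 + M * \<bar>of_int x\<bar>)) summable_on UNIV"
proof -
  define C where "C = exp ((M + 1)\<^sup>2 / (4 * \<epsilon>))"
  define q where "q = exp (-1/2::real)"
  have q: "0 < q" "q < 1" by (auto simp: q_def)
  have bnd: "norm (exp (- \<epsilon> * (of_int (int_decode n))\<^sup>2 + M * \<bar>of_int (int_decode n)\<bar>)) \<le> C * q ^ n" for n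
  proof -
    define y where "y = \<bar>real_of_int (int_decode n)\<bar>"
    have "int_encode (int_decode n) \<le> 2 * nat \<bar>int_decode n\<bar>" by (rule int_encode_le)
    then have "int n \<le> 2 * \<bar>int_decode n\<bar>" by simp
    then have "real_of_int (int n) \<le> real_of_int (2 * \<bar>int_decode n\<bar>)" by (simp only: of_int_le_iff)
    then have n: "real n \<le> 2 * y" by (simp add: y_def)
    \<comment> \<open>Taking \<open>M + 1\<close> instead of \<open>M\<close> keeps a spare factor
      exp(-y) for the comparison with \<open>q ^ n\<close>.\<close>
    have "0 \<le> (2 * \<epsilon> * y - (M + 1))\<^sup>2" by simp
    then have "(M + 1) * y - \<epsilon> * y\<^sup>2 \<le> (M + 1)\<^sup>2 / (4 * \<epsilon>)"
      using assms by (simp add: field_simps power2_eq_square)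
    then have "- \<epsilon> * y\<^sup>2 + M * y \<le> (M + 1)\<^sup>2 / (4 * \<epsilon>) + - y" by (simp add: algebra_simps)
    also have "\<dots> \<le> (M + 1)\<^sup>2 / (4 * \<epsilon>) + real n * (-1/2)" using n by simp
    finally have "exp (- \<epsilon> * y\<^sup>2 + M * y) \<le> exp ((M + 1)\<^sup>2 / (4 * \<epsilon>) + real n * (-1/2))" by simp
    also have "\<dots> = C * q ^ n" unfolding C_def q_def exp_add by (subst exp_of_nat_mult) simp
    finally show ?thesis by (simp add: y_def)
  qed
  have "summable (\<lambda>n. C * q ^ n)" using q by (intro summable_mult summable_geometric) auto
  then have "summable (\<lambda>n. norm (exp (- \<epsilon> * (of_int (int_decode n))\<^sup>2 + M * \<bar>of_int (int_decode n)\<bar>)))"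
    by (rule summable_comparison_test'[where N=0]) (use bnd in auto)
  then have "(\<lambda>n. exp (- \<epsilon> * (of_int (int_decode n))\<^sup>2 + M * \<bar>of_int (int_decode n)\<bar>)) summable_on UNIV"
    by (rule norm_summable_imp_summable_on)
  then show ?thesis
    using summable_on_reindex_bij_betw[OF bij_int_decode, of "\<lambda>x. exp (- \<epsilon> * (of_int x)\<^sup>2 + M * \<bar>of_int x\<bar>)"] by simp
qed

text \<open>Unordered sums are convenient for reindexing, but the Weierstrass test and the theorem
  on limits of holomorphic functions speak of sequences; the enumeration \<open>int_decode\<close>
  passes between the two.\<close>

lemma infsum_int_eq_suminf:
  fixes f :: "int \<Rightarrow> complex"
  assumes "f abs_summable_on UNIV"
  shows "(\<lambda>n. f (int_decode n)) sums infsum f UNIV" "summable (\<lambda>n. norm (f (int_decode n)))"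
proof -
  have "(\<lambda>n. f (int_decode n)) abs_summable_on UNIV"
    using assms summable_on_reindex_bij_betw[OF bij_int_decode, of "\<lambda>x. norm (f x)"] by simp
  then show "summable (\<lambda>n. norm (f (int_decode n)))"
    by (metis summable_on_imp_summable)
  have "f summable_on UNIV" using assms abs_summable_summable by blast
  then have "(f has_sum infsum f UNIV) UNIV" by simp
  then have "((\<lambda>n. f (int_decode n)) has_sum infsum f UNIV) UNIV"
    using has_sum_reindex_bij_betw[OF bij_int_decode, of f] by simp
  then show "(\<lambda>n. f (int_decode n)) sums infsum f UNIV" by (rule has_sum_imp_sums)
qed

text \<open>Jacobi's theta series with both exponents left free, so that the two sides of its
  transformation formula are values of one function.\<close>

definition gauss_series :: "complex \<Rightarrow> complex \<Rightarrow> complex" where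
  "gauss_series \<alpha> \<beta> = (\<Sum>\<^sub>\<infinity>x::int. exp (\<alpha> * of_int x ^ 2 + \<beta> * of_int x))"

lemma norm_gauss_term_le:
  fixes x :: int
  assumes "Re \<alpha> \<le> - \<epsilon>" "\<bar>Re \<beta>\<bar> \<le> M"
  shows "norm (exp (\<alpha> * of_int x ^ 2 + \<beta> * of_int x)) \<le> exp (- \<epsilon> * (of_int x)\<^sup>2 + M * \<bar>of_int x\<bar>)"
proof -
  have "Re (\<alpha> * of_int x ^ 2) = Re \<alpha> * (of_int x)\<^sup>2"
    using complex_scaleR[of "(of_int x)\<^sup>2" "Re \<alpha>" "Im \<alpha>"]
    by (metis mult.commute of_real_of_int_eq of_real_power scaleR_conv_of_real scaleR_complex.sel(1))
  moreover have "Re (\<beta> * of_int x) = Re \<beta> * of_int x" by simp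
  moreover have "Re \<alpha> * (of_int x)\<^sup>2 \<le> - \<epsilon> * (of_int x)\<^sup>2"
    by (rule mult_right_mono) (use assms in auto)
  moreover have "Re \<beta> * of_int x \<le> \<bar>Re \<beta>\<bar> * \<bar>of_int x\<bar>" by (metis abs_ge_self abs_mult)
  moreover have "\<bar>Re \<beta>\<bar> * \<bar>of_int x\<bar> \<le> M * \<bar>of_int x\<bar>" using assms by (intro mult_right_mono) auto
  ultimately show ?thesis by simp
qed

lemma abs_summable_gauss_term:
  assumes "Re \<alpha> < 0"
  shows "(\<lambda>x::int. exp (\<alpha> * of_int x ^ 2 + \<beta> * of_int x)) abs_summable_on UNIV"
proof -
  have "(\<lambda>x::int. exp (- (- Re \<alpha>) * (of_int x)\<^sup>2 + \<bar>Re \<beta>\<bar> * \<bar>of_int x\<bar>)) summable_on UNIV"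
    by (rule abs_summable_gauss_int) (use assms in auto)
  then show ?thesis
    by (rule summable_on_comparison_test) (use norm_gauss_term_le[of \<alpha> "- Re \<alpha>" \<beta> "\<bar>Re \<beta>\<bar>"] in auto)
qed

lemma summable_gauss_decode:
  assumes "\<epsilon> > 0"
  shows "summable (\<lambda>n. exp (- \<epsilon> * (of_int (int_decode n))\<^sup>2 + M * \<bar>of_int (int_decode n)\<bar>) :: real)"
proof -
  define g where "g = (\<lambda>x::int. complex_of_real (exp (- \<epsilon> * (of_int x)\<^sup>2 + M * \<bar>of_int x\<bar>)))"
  have "g abs_summable_on UNIV"
    unfolding g_def using abs_summable_gauss_int[OF \<open>\<epsilon> > 0\<close>, of M] by (simp add: norm_of_real)
  from infsum_int_eq_suminf(2)[OF this] show ?thesis by (simp add: g_def norm_of_real)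
qed

lemma gauss_series_sums:
  assumes "Re \<alpha> < 0"
  shows "(\<lambda>i. exp (\<alpha> * of_int (int_decode i) ^ 2 + \<beta> * of_int (int_decode i))) sums gauss_series \<alpha> \<beta>"
  unfolding gauss_series_def using infsum_int_eq_suminf(1)[OF abs_summable_gauss_term[OF assms]] .

lemma uniform_limit_gauss_series:
  fixes \<alpha> \<beta> :: "'a \<Rightarrow> complex"
  assumes "\<epsilon> > 0" "\<And>s. s \<in> A \<Longrightarrow> Re (\<alpha> s) \<le> - \<epsilon>" "\<And>s. s \<in> A \<Longrightarrow> \<bar>Re (\<beta> s)\<bar> \<le> M"
  shows "uniform_limit A
      (\<lambda>n s. \<Sum>i<n. exp (\<alpha> s * of_int (int_decode i) ^ 2 + \<beta> s * of_int (int_decode i)))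
      (\<lambda>s. gauss_series (\<alpha> s) (\<beta> s)) sequentially"
proof -
  note sm = summable_gauss_decode[OF \<open>\<epsilon> > 0\<close>, of M]
  have "uniform_limit A
      (\<lambda>n s. \<Sum>i<n. exp (\<alpha> s * of_int (int_decode i) ^ 2 + \<beta> s * of_int (int_decode i)))
      (\<lambda>s. \<Sum>i. exp (\<alpha> s * of_int (int_decode i) ^ 2 + \<beta> s * of_int (int_decode i))) sequentially"
    by (rule Weierstrass_m_test[OF _ sm]) (use norm_gauss_term_le assms in auto)
  moreover have "(\<Sum>i. exp (\<alpha> s * of_int (int_decode i) ^ 2 + \<beta> s * of_int (int_decode i))) = gauss_series (\<alpha> s) (\<beta> s)"
    if "s \<in> A" for s
  proof -
    have "Re (\<alpha> s) < 0" using assms that by fastforce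
    from gauss_series_sums[OF this] show ?thesis by (rule sums_unique[symmetric])
  qed
  ultimately show ?thesis
    by (simp cong: uniform_limit_cong')
qed

text \<open>On a closed disc inside \<open>S\<close>, compactness yields one negative bound for the
  real part of \<open>\<alpha>\<close> and one bound for that of \<open>\<beta>\<close>, hence a
  majorant independent of the point; locally uniform limits of holomorphic functions are
  holomorphic.\<close>

lemma holomorphic_gauss_series:
  fixes \<alpha> \<beta> :: "complex \<Rightarrow> complex"
  assumes S: "open S" and hol: "\<alpha> holomorphic_on S" "\<beta> holomorphic_on S" and neg: "\<And>s. s \<in> S \<Longrightarrow> Re (\<alpha> s) < 0"
  shows "(\<lambda>s. gauss_series (\<alpha> s) (\<beta> s)) holomorphic_on S"
proof (rule holomorphic_uniform_sequence[OF S])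
  show "(\<lambda>s. \<Sum>i<n. exp (\<alpha> s * of_int (int_decode i) ^ 2 + \<beta> s * of_int (int_decode i))) holomorphic_on S" for n
    by (intro holomorphic_intros hol)
next
  fix x assume x: "x \<in> S"
  obtain d where d: "d > 0" "cball x d \<subseteq> S" using S x open_contains_cball by blast
  have ca: "continuous_on (cball x d) \<alpha>" "continuous_on (cball x d) \<beta>"
    using hol d by (meson holomorphic_on_imp_continuous_on holomorphic_on_subset)+
  have ne: "cball x d \<noteq> {}" using d by auto
  obtain s0 where s0: "s0 \<in> cball x d" "\<And>s. s \<in> cball x d \<Longrightarrow> Re (\<alpha> s) \<le> Re (\<alpha> s0)"
    using continuous_attains_sup[OF compact_cball ne continuous_on_Re[OF ca(1)]] by blast
  obtain s1 where s1: "s1 \<in> cball x d" "\<And>s. s \<in> cball x d \<Longrightarrow> \<bar>Re (\<beta> s)\<bar> \<le> \<bar>Re (\<beta> s1)\<bar>"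
    using continuous_attains_sup[OF compact_cball ne continuous_on_rabs[OF continuous_on_Re[OF ca(2)]]] by blast
  have "Re (\<alpha> s0) < 0" using s0 d neg by auto
  then have "uniform_limit (cball x d)
     (\<lambda>n s. \<Sum>i<n. exp (\<alpha> s * of_int (int_decode i) ^ 2 + \<beta> s * of_int (int_decode i)))
     (\<lambda>s. gauss_series (\<alpha> s) (\<beta> s)) sequentially"
    by (intro uniform_limit_gauss_series[where \<epsilon> = "- Re (\<alpha> s0)" and M = "\<bar>Re (\<beta> s1)\<bar>"]) (use s0 s1 in auto)
  then show "\<exists>d>0. cball x d \<subseteq> S \<and> uniform_limit (cball x d)
     (\<lambda>n s. \<Sum>i<n. exp (\<alpha> s * of_int (int_decode i) ^ 2 + \<beta> s * of_int (int_decode i)))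
     (\<lambda>s. gauss_series (\<alpha> s) (\<beta> s)) sequentially" using d by blast
qed

section \<open>Uniqueness of Fourier coefficients\<close>

text \<open>Multiplication by the coordinates of the circle preserves vanishing of all Fourier coefficients, so
  a function with this property is orthogonal to all polynomials in them.\<close>

lemma fourier_unique:
  fixes h :: "real \<Rightarrow> real"
  assumes cont: "continuous_on {0..1} h" and per: "h 0 = h 1"
    and coeff: "\<And>m::int. integral {0..1} (\<lambda>s. of_real (h s) * ee (of_int m * of_real s)) = 0"
    and s: "s \<in> {0..1}"
  shows "h s = 0"
proof -
  define E where "E = (\<lambda>s::real. ee (of_real s))"
  have E: "E s = cis (2 * pi * s)" for s by (simp add: E_def ee_def cis_conv_exp mult_ac)
  have contE: "continuous_on X E" for X unfolding E by (intro continuous_intros)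
  \<comment> \<open>The function \<open>h\<close> transported to the circle, where Stone-Weierstrass
    applies; equality of \<open>h\<close> at both ends makes this consistent at the point 1.\<close>
  define H where "H z = h (if z = 1 then 0 else Arg2pi z / (2 * pi))" for z
  have HE: "H (E s) = h s" if "s \<in> {0..1}" for s
  proof (cases "E s = 1")
    case True
    then have "s = 0 \<or> s = 1"
    proof -
      have "cos (2 * pi * s) = 1" using True E by (metis cis.sel(1) one_complex.sel(1))
      then obtain n :: int where "2 * pi * s = of_int n * 2 * pi" using cos_one_2pi_int by auto
      then have "s = of_int n" by (simp add: field_simps)
      then show ?thesis using that by auto
    qed
    then show ?thesis using True per by (auto simp: H_def)
  next
    case False
    then have "s \<noteq> 1" by (auto simp: E)
    then have "Arg2pi (E s) = 2 * pi * s"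
      using that by (intro Arg2pi_unique[of 1]) (auto simp: E cis_conv_exp mult_ac mult_le_cancel_left)
    then show ?thesis using False by (simp add: H_def)
  qed
  have surj: "E ` {0..1} = sphere 0 1"
  proof
    show "E ` {0..1} \<subseteq> sphere 0 1" by (auto simp: E)
    show "sphere 0 1 \<subseteq> E ` {0..1}"
    proof
      fix z :: complex assume "z \<in> sphere 0 1"
      then have "z = cis (Arg2pi z)" using Arg2pi_eq[of z] by (simp add: cis_conv_exp mult_ac)
      then have "z = E (Arg2pi z / (2 * pi))" by (simp add: E)
      moreover have "Arg2pi z / (2 * pi) \<in> {0..1}" using Arg2pi[of z] by (auto simp: field_simps)
      ultimately show "z \<in> E ` {0..1}" by blast
    qed
  qed
  \<comment> \<open>The preimage of a closed set under \<open>H\<close> is the image under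
    \<open>E\<close> of a compact set. Arguing with closed sets avoids a separate discussion of the
    jump of the argument at 1.\<close>
  have contH: "continuous_on (sphere 0 1) H"
  proof (subst continuous_on_closed_vimage)
    show "closed (sphere 0 1 :: complex set)" by simp
    show "\<forall>C. closed C \<longrightarrow> closed (H -` C \<inter> sphere 0 1)"
    proof (intro allI impI)
      fix C :: "real set" assume C: "closed C"
      have "H -` C \<inter> sphere 0 1 = E ` (h -` C \<inter> {0..1})"
        using HE unfolding surj[symmetric] by force
      moreover have "closed (h -` C \<inter> {0..1})"
        using cont C continuous_on_closed_vimage[of "{0..1}" h] by auto
      then have "compact (h -` C \<inter> {0..1})" 
        by (metis Int_commute compact_Icc compact_Int_closed inf_left_idem)
      then have "compact (E ` (h -` C \<inter> {0..1}))" using contE compact_continuous_image by blast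
      ultimately show "closed (H -` C \<inter> sphere 0 1)" using compact_imp_closed by simp
    qed
  qed
  define K where "K = {g :: real \<Rightarrow> complex. continuous_on {0..1} g \<and> 
     (\<forall>m::int. integral {0..1} (\<lambda>s. g s * ee (of_int m * of_real s)) = 0)}"
  have ee_cont[continuous_intros]: "continuous_on X (\<lambda>s::real. ee (of_int m * of_real s))" for X m
    unfolding ee_def by (intro continuous_intros)
  have K0: "(\<lambda>s. of_real (h s)) \<in> K" unfolding K_def using cont coeff by (auto intro!: continuous_intros)
  have Kadd: "(\<lambda>s. f s + g s) \<in> K" if "f \<in> K" "g \<in> K" for f g
  proof -
    have c: "continuous_on {0..1} f" "continuous_on {0..1} g" using that by (auto simp: K_def)
    have "integral {0..1} (\<lambda>s. (f s + g s) * ee (of_int m * of_real s)) = 0" for m :: int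
      unfolding distrib_right
      by (subst integral_add) (use that c in \<open>auto simp: K_def intro!: integrable_continuous_interval continuous_intros\<close>)
    with c show ?thesis by (auto simp: K_def intro!: continuous_intros)
  qed
  have Kscale: "(\<lambda>s. f s * c) \<in> K" if "f \<in> K" for f c
  proof -
    have c: "continuous_on {0..1} f" using that by (auto simp: K_def)
    have "integral {0..1} (\<lambda>s. f s * c * ee (of_int m * of_real s)) = 
       c * integral {0..1} (\<lambda>s. f s * ee (of_int m * of_real s))" for m :: int
      by (subst integral_mult_right[symmetric]) (simp add: mult_ac)
    with c that show ?thesis by (auto simp: K_def intro!: continuous_intros)
  qed
  have KE: "(\<lambda>s. f s * ee (of_int k * of_real s)) \<in> K" if "f \<in> K" for f and k :: int
  proof -
    have c: "continuous_on {0..1} f" using that by (auto simp: K_def)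
    have e: "f s * ee (of_int k * of_real s) * ee (of_int m * of_real s) = f s * ee (of_int (k + m) * of_real s)" for m s
      by (simp add: ee_def exp_add[symmetric] algebra_simps)
    have "continuous_on {0..1} (\<lambda>s. f s * ee (of_int k * of_real s))" by (intro continuous_intros c)
    moreover have "integral {0..1} (\<lambda>s. f s * ee (of_int (k + m) * of_real s)) = 0" for m :: int
      using that unfolding K_def by blast
    ultimately show ?thesis unfolding K_def mem_Collect_eq e by blast
  qed
  have Re_E: "of_real (Re (E s)) = (ee (of_int 1 * of_real s) + ee (of_int (-1) * of_real s)) * (1/2)" for s
  proof -
    have "ee (of_int (-1) * of_real s) = cnj (E s)" by (simp add: E_def ee_def exp_cnj)
    then show ?thesis using complex_add_cnj[of "E s"] by (simp add: E_def)
  qed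
  have Im_E: "of_real (Im (E s)) = (ee (of_int 1 * of_real s) * (-\<i>/2) + ee (of_int (-1) * of_real s) * (\<i>/2))" for s
  proof -
    have "ee (of_int (-1) * of_real s) = cnj (E s)" by (simp add: E_def ee_def exp_cnj)
    then show ?thesis using complex_diff_cnj[of "E s"] by (simp add: E_def field_simps) (simp add: complex_eq_iff)
  qed
  have Kpoly: "(\<lambda>s. f s * of_real (p (E s))) \<in> K" if "real_polynomial_function p" "f \<in> K" for p f
    using that
  proof (induction arbitrary: f rule: real_polynomial_function.induct)
    case (linear p)
    have p: "p z = Re z * p 1 + Im z * p \<i>" for z
    proof -
      have "z = Re z *\<^sub>R 1 + Im z *\<^sub>R \<i>" by (simp add: complex_eq_iff)
      then have "p z = p (Re z *\<^sub>R 1 + Im z *\<^sub>R \<i>)" by simp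
      also have "\<dots> = Re z * p 1 + Im z * p \<i>"
        using linear.hyps by (simp add: bounded_linear_def linear_add linear_cmul)
      finally show ?thesis .
    qed
    have "(\<lambda>s. (f s * ee (of_int 1 * of_real s) + f s * ee (of_int (-1) * of_real s)) * (1/2 * of_real (p 1))
           + (f s * ee (of_int 1 * of_real s) * (-\<i>/2 * of_real (p \<i>)) + f s * ee (of_int (-1) * of_real s) * (\<i>/2 * of_real (p \<i>)))) \<in> K"
      by (intro Kadd Kscale KE linear.prems)
    also have "(\<lambda>s. (f s * ee (of_int 1 * of_real s) + f s * ee (of_int (-1) * of_real s)) * (1/2 * of_real (p 1))
           + (f s * ee (of_int 1 * of_real s) * (-\<i>/2 * of_real (p \<i>)) + f s * ee (of_int (-1) * of_real s) * (\<i>/2 * of_real (p \<i>))))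
         = (\<lambda>s. f s * of_real (p (E s)))"
      unfolding p[of "E _"] of_real_add of_real_mult Re_E Im_E by (auto simp: algebra_simps)
    finally show ?case .
  next
    case (const c) then show ?case by (intro Kscale)
  next
    case (add p q)
    then show ?case using Kadd[OF add.IH] by (simp add: algebra_simps)
  next
    case (mult p q)
    have "(\<lambda>s. f s * of_real (p (E s)) * of_real (q (E s))) \<in> K" using mult by blast
    then show ?case by (simp add: mult_ac)
  qed
  have int0: "integral {0..1} (\<lambda>s. h s * p (E s)) = 0" and intble: "continuous_on {0..1} (\<lambda>s. h s * p (E s))" 
    if "real_polynomial_function p" for p
  proof -
    have k: "(\<lambda>s. of_real (h s) * of_real (p (E s))) \<in> K" by (rule Kpoly[OF that K0])
    then have "integral {0..1} (\<lambda>s. of_real (h s) * of_real (p (E s)) * ee (of_int 0 * of_real s)) = (0::complex)"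
      unfolding K_def by blast
    then have 0: "integral {0..1} (\<lambda>s. complex_of_real (h s * p (E s))) = 0" by (simp add: ee_def)
    from k have "continuous_on {0..1} (\<lambda>s. complex_of_real (h s * p (E s)))" by (simp add: K_def)
    then show c: "continuous_on {0..1} (\<lambda>s. h s * p (E s))"
      using continuous_on_Re by fastforce
    then have "integral {0..1} (\<lambda>s. complex_of_real (h s * p (E s))) = of_real (integral {0..1} (\<lambda>s. h s * p (E s)))"
      by (intro integral_unique has_integral_of_real) (simp add: integrable_continuous_interval integrable_integral)
    with 0 show "integral {0..1} (\<lambda>s. h s * p (E s)) = 0" by simp
  qed
  obtain B where B: "\<And>s. s \<in> {0..1} \<Longrightarrow> \<bar>h s\<bar> \<le> B"
  proof -
    have "bounded (h ` {0..1})" using cont compact_continuous_image compact_imp_bounded compact_Icc by blast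
    then obtain a where "\<forall>y\<in>h ` {0..1}. norm y \<le> a" unfolding bounded_iff by blast
    then show ?thesis by (intro that[of a]) auto
  qed
  have B0: "B \<ge> 0" using B[of 0] by auto
  \<comment> \<open>Subtracting the vanishing integral of \<open>h\<close> times the polynomial
    replaces one factor \<open>h\<close> by the approximation error. Dividing by
    \<open>B + 1\<close> rather than \<open>B\<close> admits \<open>B = 0\<close>.\<close>
  have hh: "integral {0..1} (\<lambda>s. h s * h s) \<le> e" if e: "e > 0" for e
  proof -
    obtain p where p: "real_polynomial_function p" "\<And>z. z \<in> sphere 0 1 \<Longrightarrow> \<bar>H z - p z\<bar> < e / (B + 1)"
      using Stone_Weierstrass_real_polynomial_function[OF compact_sphere contH, of "e / (B + 1)"] e B0 by auto
    have "integral {0..1} (\<lambda>s. h s * h s) = integral {0..1} (\<lambda>s. h s * h s) - integral {0..1} (\<lambda>s. h s * p (E s))"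
      using int0 p by simp
    also have "\<dots> = integral {0..1} (\<lambda>s. h s * h s - h s * p (E s))"
      by (rule Henstock_Kurzweil_Integration.integral_diff[symmetric]) (use intble[OF p(1)] cont in \<open>auto intro!: integrable_continuous_interval continuous_intros\<close>)
    also have "\<dots> \<le> integral {0..1::real} (\<lambda>s. e)"
    proof (rule Henstock_Kurzweil_Integration.integral_le)
      show "(\<lambda>s. h s * h s - h s * p (E s)) integrable_on {0..1}"
        by (use intble[OF p(1)] cont in \<open>auto intro!: integrable_continuous_interval continuous_intros\<close>)
      fix s :: real assume s: "s \<in> {0..1}"
      have "h s * h s - h s * p (E s) = h s * (H (E s) - p (E s))" by (simp add: HE[OF s] algebra_simps)
      also have "\<dots> \<le> \<bar>h s\<bar> * \<bar>H (E s) - p (E s)\<bar>" by (metis abs_ge_self abs_mult)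
      also have "\<dots> \<le> B * (e / (B + 1))"
        using B[OF s] p(2)[of "E s"] by (intro mult_mono) (auto simp: E B0)
      also have "\<dots> \<le> e" using B0 e by (simp add: field_simps)
      finally show "h s * h s - h s * p (E s) \<le> e" .
    qed auto
    finally show ?thesis by simp
  qed
  then have "integral {0..1} (\<lambda>s. h s * h s) \<le> 0" by (rule field_le_epsilon) simp
  moreover have ibl: "(\<lambda>s. h s * h s) integrable_on {0..1}" using cont by (auto intro!: integrable_continuous_interval continuous_intros)
  ultimately have "integral {0..1} (\<lambda>s. h s * h s) = 0" by (intro antisym integral_nonneg) auto
  then have "\<forall>s\<in>{0..1}. h s * h s = 0"
    using integral_eq_0_iff[of 0 1 "\<lambda>s. h s * h s", OF continuous_on_mult[OF cont cont]] by simp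
  then show ?thesis using s by auto
qed

section \<open>Poisson summation for real Gaussians\<close>

lemma sums_integral_M_test:
  fixes u :: "nat \<Rightarrow> real \<Rightarrow> complex"
  assumes "\<And>i. continuous_on {0..1} (u i)" "\<And>i s. s \<in> {0..1} \<Longrightarrow> norm (u i s) \<le> M i"
    "summable M" "\<And>s. s \<in> {0..1} \<Longrightarrow> (\<lambda>i. u i s) sums U s"
  shows "continuous_on {0..1} U" "(\<lambda>i. integral {0..1} (u i)) sums integral {0..1} U"
proof -
  have "uniform_limit {0..1} (\<lambda>n s. \<Sum>i<n. u i s) (\<lambda>s. \<Sum>i. u i s) sequentially"
    by (rule Weierstrass_m_test[OF assms(2,3)])
  then have ul: "uniform_limit {0..1} (\<lambda>n s. \<Sum>i<n. u i s) U sequentially"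
    by (rule uniform_limit_cong'[THEN iffD1, rotated 2]) (use assms(4) in \<open>auto simp: sums_iff\<close>)
  have c: "continuous_on {0..1} (\<lambda>s. \<Sum>i<n. u i s)" for n
    by (intro continuous_intros assms)
  show "continuous_on {0..1} U"
    by (rule uniform_limit_theorem[OF _ ul]) (use c in auto)
  obtain I J where IJ: "\<And>n. ((\<lambda>s. \<Sum>i<n. u i s) has_integral I n) (cbox 0 1)"
    "(U has_integral J) (cbox 0 1)" "(I \<longlongrightarrow> J) sequentially"
    by (rule uniform_limit_integral_cbox[where a = 0 and b = "1::real" and f = "\<lambda>n s. \<Sum>i<n. u i s" and g = U and F = sequentially]) (use ul c in auto)
  have "I n = (\<Sum>i<n. integral {0..1} (u i))" for n
  proof -
    have "I n = integral {0..1} (\<lambda>s. \<Sum>i<n. u i s)" using IJ(1)[of n] by (simp add: integral_unique)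
    also have "\<dots> = (\<Sum>i<n. integral {0..1} (u i))"
      by (rule Henstock_Kurzweil_Integration.integral_sum) (use assms(1) in \<open>auto intro: integrable_continuous_interval\<close>)
    finally show ?thesis .
  qed
  moreover have "J = integral {0..1} U" using IJ(2) by (simp add: integral_unique)
  ultimately show "(\<lambda>i. integral {0..1} (u i)) sums integral {0..1} U"
    using IJ(3) unfolding sums_def by presburger
qed

text \<open>A rescaling of the characteristic function of the standard normal distribution.\<close>

lemma gaussian_fourier_transform:
  fixes A m :: real
  assumes A: "A > 0"
  shows "integrable lborel (\<lambda>y. of_real (exp (- pi * y\<^sup>2 / A)) * ee (of_real (m * y)))" (is "integrable _ ?f")
    and "(LBINT y. of_real (exp (- pi * y\<^sup>2 / A)) * ee (of_real (m * y))) = of_real (sqrt A * exp (- pi * A * m\<^sup>2))"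
proof -
  \<comment> \<open>Chosen so that (c y)^2 / 2 = pi y^2 / A; the frequency \<open>t\<close> is then
    fixed by t c y = 2 pi m y.\<close>
  define c where "c = sqrt (2 * pi / A)"
  define t where "t = 2 * pi * m / c"
  have c: "c > 0" "c\<^sup>2 = 2 * pi / A" using A by (auto simp: c_def)
  let ?g = "\<lambda>x. std_normal_density x *\<^sub>R iexp (t * x)"
  have gf: "?g (0 + c * y) = (1 / sqrt (2 * pi)) *\<^sub>R ?f y" for y
  proof -
    have "(c * y)\<^sup>2 / 2 = pi * y\<^sup>2 / A" using c A by (simp add: power_mult_distrib)
    then have 1: "std_normal_density (0 + c * y) = 1 / sqrt (2 * pi) * exp (- pi * y\<^sup>2 / A)"
      by (simp add: std_normal_density_def)
    have "t * (0 + c * y) = 2 * pi * (m * y)" using c by (simp add: t_def)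
    then have 2: "iexp (t * (0 + c * y)) = ee (of_real (m * y))" 
      by (simp only: ee_def) (simp add: mult_ac)
    show ?thesis unfolding 1 2 by (simp add: scaleR_conv_of_real)
  qed
  have int: "integrable lborel ?g"
  proof (rule Bochner_Integration.integrable_bound)
    show "integrable lborel std_normal_density" using integrable_std_normal_moment[of 0] by simp
    show "?g \<in> borel_measurable lborel" by measurable
    show "AE x in lborel. norm (?g x) \<le> norm (std_normal_density x)"
      by (simp add: normal_density_nonneg)
  qed
  have "integrable lborel (\<lambda>y. ?g (0 + c * y))" 
    using lborel_integrable_real_affine[OF int, of c 0] c by simp
  then have "integrable lborel (\<lambda>y. (1 / sqrt (2 * pi)) *\<^sub>R ?f y)" unfolding gf .
  then have "integrable lborel (\<lambda>y. sqrt (2 * pi) *\<^sub>R ((1 / sqrt (2 * pi)) *\<^sub>R ?f y))"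
    by (rule integrable_scaleR_right)
  then show "integrable lborel ?f" by simp
  have "of_real (exp (- t\<^sup>2 / 2)) = (LINT x|density lborel std_normal_density. iexp (t * x))"
    using char_std_normal_distribution unfolding char_def by metis
  also have "\<dots> = (LBINT x. ?g x)"
    by (rule integral_density) (auto simp: normal_density_nonneg)
  also have "\<dots> = c *\<^sub>R (LBINT y. ?g (0 + c * y))"
    using lborel_integral_real_affine[of c ?g 0] c by simp
  also have "\<dots> = c *\<^sub>R ((1 / sqrt (2 * pi)) *\<^sub>R (LBINT y. ?f y))"
    unfolding gf integral_scaleR_right ..
  finally have 1: "of_real (exp (- t\<^sup>2 / 2)) = (c / sqrt (2 * pi)) *\<^sub>R (LBINT y. ?f y)" by simp
  have "c / sqrt (2 * pi) = 1 / sqrt A" using A by (simp add: c_def real_sqrt_divide)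
  with 1 have "(LBINT y. ?f y) = of_real (sqrt A) * of_real (exp (- t\<^sup>2 / 2))" using A c(1)
    by (simp add: scaleR_conv_of_real field_simps)
  moreover have "t\<^sup>2 / 2 = pi * A * m\<^sup>2" using A c
    by (simp add: t_def power_divide power_mult_distrib) (simp add: field_simps power2_eq_square)
  ultimately show "(LBINT y. ?f y) = of_real (sqrt A * exp (- pi * A * m\<^sup>2))" by simp
qed

text \<open>The coefficient of the conjugate at m is the conjugate of the coefficient at -m, so the
  real and imaginary parts inherit the hypothesis and the real case applies to each.\<close>

lemma fourier_unique_complex:
  fixes f :: "real \<Rightarrow> complex"
  assumes cont: "continuous_on {0..1} f" and per: "f 0 = f 1"
    and coeff: "\<And>m::int. integral {0..1} (\<lambda>s. f s * ee (of_int m * of_real s)) = 0"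
    and s: "s \<in> {0..1}"
  shows "f s = 0"
proof -
  have ee_cont[continuous_intros]: "continuous_on X (\<lambda>s::real. ee (of_int m * of_real s))" for X m
    unfolding ee_def by (intro continuous_intros)
  have c2: "integral {0..1} (\<lambda>s. cnj (f s) * ee (of_int m * of_real s)) = 0" for m
  proof -
    have "cnj (f s) * ee (of_int m * of_real s) = cnj (f s * ee (of_int (- m) * of_real s))" for s
      by (simp add: ee_def exp_cnj)
    note 1 = this
    have "integral {0..1} (\<lambda>s. cnj (f s * ee (of_int (- m) * of_real s))) =
       cnj (integral {0..1} (\<lambda>s. f s * ee (of_int (- m) * of_real s)))"
      by (intro integral_unique has_integral_cnj[THEN iffD2, unfolded o_def] integrable_integral integrable_continuous_interval continuous_intros cont)
    then show ?thesis unfolding 1 using coeff[of "- m"] by simp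
  qed
  have ibl: "(\<lambda>s. f s * ee (of_int m * of_real s)) integrable_on {0..1}"
     "(\<lambda>s. cnj (f s) * ee (of_int m * of_real s)) integrable_on {0..1}" for m :: int
    by (intro integrable_continuous_interval continuous_intros cont)+
  have re: "integral {0..1} (\<lambda>s. of_real (Re (f s)) * ee (of_int m * of_real s)) = 0" for m
  proof -
    have "of_real (Re (f s)) * ee (of_int m * of_real s) =
      (f s * ee (of_int m * of_real s) + cnj (f s) * ee (of_int m * of_real s)) * (1/2)" for s
      using complex_add_cnj[of "f s"] by (simp add: distrib_right[symmetric])
    note 1 = this
    show ?thesis unfolding 1 Henstock_Kurzweil_Integration.integral_mult_left 
      using ibl by (simp add: Henstock_Kurzweil_Integration.integral_add coeff c2)
  qed
  have im: "integral {0..1} (\<lambda>s. of_real (Im (f s)) * ee (of_int m * of_real s)) = 0" for m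
  proof -
    have a: "of_real (Im (f s)) = (f s - cnj (f s)) * (-\<i>/2)" for s
      using complex_diff_cnj[of "f s"] by simp
    have "of_real (Im (f s)) * ee (of_int m * of_real s) =
      (f s * ee (of_int m * of_real s) - cnj (f s) * ee (of_int m * of_real s)) * (-\<i>/2)" for s
      unfolding a by (simp only: algebra_simps)
    note 1 = this
    show ?thesis unfolding 1 Henstock_Kurzweil_Integration.integral_mult_left 
      using ibl by (simp add: Henstock_Kurzweil_Integration.integral_diff coeff c2)
  qed
  have "Re (f s) = 0" 
    by (rule fourier_unique[of "\<lambda>s. Re (f s)"]) (use re per s cont in \<open>auto intro: continuous_intros\<close>)
  moreover have "Im (f s) = 0" 
    by (rule fourier_unique[of "\<lambda>s. Im (f s)"]) (use im per s cont in \<open>auto intro: continuous_intros\<close>)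
  ultimately show ?thesis by (simp add: complex_eq_iff)
qed

lemma integral_ee_int:
  "integral {0..1} (\<lambda>s. ee (of_int m * of_real s)) = (if m = 0 then 1 else 0)"
proof (cases "m = 0")
  case True then show ?thesis by (simp add: ee_def)
next
  case False
  define F where "F = (\<lambda>s::real. ee (of_int m * of_real s) / (2 * pi * \<i> * of_int m))"
  have "((\<lambda>s. ee (of_int m * of_real s)) has_integral (F 1 - F 0)) {0..1}"
  proof (rule fundamental_theorem_of_calculus)
    fix x :: real
    have "((\<lambda>z. exp (2 * of_real pi * \<i> * (of_int m * z)) / (2 * pi * \<i> * of_int m)) has_field_derivative 
       exp (2 * of_real pi * \<i> * (of_int m * of_real x))) (at (of_real x))"
      using False by (auto intro!: derivative_eq_intros)
    then show "(F has_vector_derivative ee (of_int m * of_real x)) (at x within {0..1})"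
      unfolding F_def ee_def by (rule has_vector_derivative_at_within[OF has_vector_derivative_real_field])
  qed auto
  moreover have "F 1 = F 0"
  proof -
    have "exp (2 * of_real pi * \<i> * of_int m) = 1"
      using exp_integer_2pi[of "of_int m"] by (simp add: mult_ac)
    then show ?thesis by (simp add: F_def ee_def)
  qed
  ultimately show ?thesis using False by (simp add: integral_unique)
qed

text \<open>As functions of \<open>s\<close>, both sides are continuous, take the same value at 0
  and 1, and have the same Fourier coefficients. The left one is the Gaussian summed over s + Z,
  whose coefficients unfold to a Fourier transform on the line; the right one is a Fourier series
  already.\<close>

lemma poisson_real:
  fixes A s :: real
  assumes A: "A > 0" and s: "s \<in> {0..1}"
  shows "exp (of_real (- pi * s\<^sup>2 / A)) * gauss_series (of_real (- pi / A)) (of_real (- 2 * pi * s / A))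
       = of_real (sqrt A) * gauss_series (of_real (- pi * A)) (2 * of_real pi * \<i> * of_real s)"
proof -
  let ?x = "\<lambda>i. int_decode i"
  define \<phi> where "\<phi> y = complex_of_real (exp (- pi * y\<^sup>2 / A))" for y :: real
  define G where "G s = exp (of_real (- pi * s\<^sup>2 / A)) * gauss_series (of_real (- pi / A)) (of_real (- 2 * pi * s / A))" for s
  define F where "F s = of_real (sqrt A) * gauss_series (of_real (- pi * A)) (2 * of_real pi * \<i> * of_real s)" for s
  have ee_cont[continuous_intros]: "continuous_on X (\<lambda>s::real. ee (of_int m * of_real s))" for X m
    unfolding ee_def by (intro continuous_intros)
  have \<phi>_cont: "continuous_on X \<phi>" for X unfolding \<phi>_def by (intro continuous_intros) (use A in auto)
  have norm_ee: "norm (ee (of_int m * of_real s)) = 1" for m and s :: real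
    by (simp add: ee_def)
  have \<phi>split: "\<phi> (s + of_int x) = exp (of_real (- pi * s\<^sup>2 / A)) * 
      exp (of_real (- pi / A) * of_int x ^ 2 + of_real (- 2 * pi * s / A) * of_int x)" for s and x :: int
  proof -
    have "- pi * (s + of_int x)\<^sup>2 / A = - pi * s\<^sup>2 / A + (- pi / A * (of_int x)\<^sup>2 + - 2 * pi * s / A * of_int x)"
      using A by (simp add: power2_eq_square field_simps)
    then have "\<phi> (s + of_int x) = of_real (exp (- pi * s\<^sup>2 / A) * exp (- pi / A * (of_int x)\<^sup>2 + - 2 * pi * s / A * of_int x))"
      unfolding \<phi>_def by (simp only: exp_add)
    then show ?thesis by (simp add: exp_of_real[symmetric])
  qed
  have sumsG: "(\<lambda>i. \<phi> (s + of_int (?x i))) sums G s" for s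
    unfolding \<phi>split G_def by (intro sums_mult gauss_series_sums) (use A in simp)
  have sumsF: "(\<lambda>i. of_real (sqrt A) * exp (of_real (- pi * A) * of_int (?x i) ^ 2 + 2 * of_real pi * \<i> * of_real s * of_int (?x i))) sums F s" for s
    unfolding F_def by (intro sums_mult gauss_series_sums) (use A in simp)
  have \<phi>bnd: "norm (\<phi> (s + of_int x)) \<le> exp (- (pi / A) * (of_int x)\<^sup>2 + (2 * pi / A) * \<bar>of_int x\<bar>)" if "s \<in> {0..1}" for s x
  proof -
    have "norm (\<phi> (s + of_int x)) = exp (- pi * s\<^sup>2 / A) * norm (exp (of_real (- pi / A) * of_int x ^ 2 + complex_of_real (- 2 * pi * s / A) * of_int x))"
      unfolding \<phi>split norm_mult by (simp add: norm_exp_eq_Re)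
    also have "\<dots> \<le> 1 * exp (- (pi / A) * (of_int x)\<^sup>2 + (2 * pi / A) * \<bar>of_int x\<bar>)"
    proof (intro mult_mono norm_gauss_term_le)
      have "2 * pi * s / A \<le> 2 * pi / A" using A that by (intro divide_right_mono) auto
      moreover have "2 * pi * s / A \<ge> 0" using A that by simp
      ultimately show "\<bar>Re (complex_of_real (- 2 * pi * s / A))\<bar> \<le> 2 * pi / A" by simp
    qed (use A in auto)
    finally show ?thesis by simp
  qed
  have Fbnd: "norm (of_real (sqrt A) * exp (of_real (- pi * A) * of_int x ^ 2 + 2 * of_real pi * \<i> * of_real s * of_int x))
       \<le> sqrt A * exp (- (pi * A) * (of_int x)\<^sup>2 + 0 * \<bar>of_int x\<bar>)" for s :: real and x :: int
    unfolding norm_mult by (intro mult_mono norm_gauss_term_le) (use A in auto)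
  have Gcoef: "(\<lambda>i. integral {0..1} (\<lambda>s. \<phi> (s + of_int (?x i)) * ee (of_int m * of_real s))) sums
       integral {0..1} (\<lambda>s. G s * ee (of_int m * of_real s))"
    and Gcont': "continuous_on {0..1} (\<lambda>s. G s * ee (of_int m * of_real s))" for m :: int
  proof -
    have 1: "continuous_on {0..1} (\<lambda>s. \<phi> (s + of_int (?x i)) * ee (of_int m * of_real s))" for i
      by (intro continuous_intros continuous_on_compose2[OF \<phi>_cont[of UNIV]]) auto
    have 2: "norm (\<phi> (s + of_int (?x i)) * ee (of_int m * of_real s)) \<le> exp (- (pi / A) * (of_int (?x i))\<^sup>2 + (2 * pi / A) * \<bar>of_int (?x i)\<bar>)"
      if "s \<in> {0..1}" for s i using \<phi>bnd[OF that] by (simp add: norm_mult norm_ee)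
    have 3: "summable (\<lambda>i. exp (- (pi / A) * (of_int (?x i))\<^sup>2 + (2 * pi / A) * \<bar>of_int (?x i)\<bar>))"
      by (rule summable_gauss_decode) (use A in auto)
    show "(\<lambda>i. integral {0..1} (\<lambda>s. \<phi> (s + of_int (?x i)) * ee (of_int m * of_real s))) sums
       integral {0..1} (\<lambda>s. G s * ee (of_int m * of_real s))"
      "continuous_on {0..1} (\<lambda>s. G s * ee (of_int m * of_real s))"
      by (rule sums_integral_M_test[OF 1 2 3 sums_mult2[OF sumsG]]; assumption)+
  qed
  have Fcoef: "(\<lambda>i. integral {0..1} (\<lambda>s. of_real (sqrt A) * exp (of_real (- pi * A) * of_int (?x i) ^ 2 + 2 * of_real pi * \<i> * of_real s * of_int (?x i)) * ee (of_int m * of_real s))) sums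
       integral {0..1} (\<lambda>s. F s * ee (of_int m * of_real s))"
    and Fcont': "continuous_on {0..1} (\<lambda>s. F s * ee (of_int m * of_real s))" for m :: int
  proof -
    let ?u = "\<lambda>i s. of_real (sqrt A) * exp (of_real (- pi * A) * of_int (?x i) ^ 2 + 2 * of_real pi * \<i> * complex_of_real s * of_int (?x i)) * ee (of_int m * of_real s)"
    have 1: "continuous_on {0..1} (?u i)" for i
      by (intro continuous_intros)
    have 2: "norm (?u i s) \<le> sqrt A * exp (- (pi * A) * (of_int (?x i))\<^sup>2 + 0 * \<bar>of_int (?x i)\<bar>)"
      if "s \<in> {0..1}" for s i using Fbnd[of "?x i" s] by (simp add: norm_mult norm_ee)
    have 3: "summable (\<lambda>i. sqrt A * exp (- (pi * A) * (of_int (?x i))\<^sup>2 + 0 * \<bar>of_int (?x i)\<bar>))"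
      by (intro summable_mult summable_gauss_decode) (use A in auto)
    show "(\<lambda>i. integral {0..1} (?u i)) sums integral {0..1} (\<lambda>s. F s * ee (of_int m * of_real s))"
      "continuous_on {0..1} (\<lambda>s. F s * ee (of_int m * of_real s))"
      by (rule sums_integral_M_test[OF 1 2 3 sums_mult2[OF sumsF]]; assumption)+
  qed
  \<comment> \<open>Unfolding: the half-open intervals \<open>X i\<close> tile the line and the
    character has period 1, so the termwise integrals over [0, 1] add up to the Fourier transform of
    the Gaussian.\<close>
  have Gval: "integral {0..1} (\<lambda>s. G s * ee (of_int m * of_real s)) = of_real (sqrt A * exp (- pi * A * (of_int m)\<^sup>2))" for m :: int
  proof -
    define \<psi> where "\<psi> y = \<phi> y * ee (of_real (of_int m * y))" for y
    have \<psi>int: "integrable lborel \<psi>" "(LBINT y. \<psi> y) = of_real (sqrt A * exp (- pi * A * (of_int m)\<^sup>2))"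
      unfolding \<psi>_def \<phi>_def using gaussian_fourier_transform[OF A, of "of_int m"] by auto
    define X where "X i = {of_int (?x i) ..< of_int (?x i) + (1::real)}" for i
    have disj: "X i \<inter> X j = {}" if "i \<noteq> j" for i j
    proof -
      have ne: "?x i \<noteq> ?x j" using that by (metis int_decode_inverse)
      show ?thesis
      proof (rule ccontr)
        assume "X i \<inter> X j \<noteq> {}"
        then obtain y where "y \<in> X i" "y \<in> X j" by blast
        then have "\<lfloor>y\<rfloor> = ?x i" "\<lfloor>y\<rfloor> = ?x j" unfolding X_def by (auto intro: floor_unique)
        with ne show False by simp
      qed
    qed
    have un: "(\<Union>i. X i) = UNIV"
    proof -
      have "y \<in> X (int_encode \<lfloor>y\<rfloor>)" for y unfolding X_def by auto
      then show ?thesis by blast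
    qed
    have si: "set_integrable lborel (X i) \<psi>" for i
      using integrable_mult_indicator[OF _ \<psi>int(1), of "X i"] by (simp add: set_integrable_def X_def)
    have "(LBINT y. \<psi> y) = (LBINT y : (\<Union>i. X i). \<psi> y)" by (simp add: un set_lebesgue_integral_def)
    also have "\<dots> = (\<Sum>i. (LBINT y : X i. \<psi> y))"
      by (rule lebesgue_integral_countable_add) (use disj \<psi>int(1) in \<open>auto simp: X_def un[unfolded X_def] set_integrable_def\<close>)
    finally have t: "(LBINT y. \<psi> y) = (\<Sum>i. (LBINT y : X i. \<psi> y))" .
    have "(LBINT y : X i. \<psi> y) = integral {0..1} (\<lambda>s. \<phi> (s + of_int (?x i)) * ee (of_int m * of_real s))" for i
    proof -
      have "(LBINT y : X i. \<psi> y) = integral (X i) \<psi>" by (rule set_borel_integral_eq_integral(2)[OF si])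
      also have "\<dots> = integral {0 + of_int (?x i) .. 1 + of_int (?x i)} \<psi>"
        by (rule integral_spike_set; rule negligible_subset[of "{of_int (?x i) + 1}"]) (auto simp: X_def)
      also have "\<dots> = integral {0..1} (\<psi> \<circ> (+) (of_int (?x i)))" by (rule integral_shift_Icc_real[symmetric])
      also have "\<psi> \<circ> (+) (of_int (?x i)) = (\<lambda>s. \<phi> (s + of_int (?x i)) * ee (of_int m * of_real s))"
      proof
        fix s
        have "ee (of_real (of_int m * (of_int (?x i) + s))) = ee (of_int m * of_real s) * exp (2 * of_int (m * ?x i) * of_real pi * \<i>)"
          by (simp add: ee_def exp_add[symmetric] algebra_simps)
        also have "exp (2 * of_int (m * ?x i) * of_real pi * \<i>) = 1"
          using exp_integer_2pi[of "of_int (m * ?x i)"] by (simp add: mult_ac)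
        finally show "(\<psi> \<circ> (+) (of_int (?x i))) s = \<phi> (s + of_int (?x i)) * ee (of_int m * of_real s)"
          by (simp add: \<psi>_def add.commute)
      qed
      finally show ?thesis .
    qed
    with t have "(LBINT y. \<psi> y) = (\<Sum>i. integral {0..1} (\<lambda>s. \<phi> (s + of_int (?x i)) * ee (of_int m * of_real s)))" by simp
    also have "(\<Sum>i. integral {0..1} (\<lambda>s. \<phi> (s + of_int (?x i)) * ee (of_int m * of_real s))) = 
      integral {0..1} (\<lambda>s. G s * ee (of_int m * of_real s))" using Gcoef by (rule sums_unique[symmetric])
    finally show ?thesis using \<psi>int(2) by simp
  qed
  \<comment> \<open>Orthogonality of the characters leaves the single term x = -m; its index in the
    enumeration is \<open>int_encode (- m)\<close>.\<close>
  have Fval: "integral {0..1} (\<lambda>s. F s * ee (of_int m * of_real s)) = of_real (sqrt A * exp (- pi * A * (of_int m)\<^sup>2))" for m :: int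
  proof -
    have eq: "integral {0..1} (\<lambda>s. of_real (sqrt A) * exp (of_real (- pi * A) * of_int (?x i) ^ 2 + 2 * of_real pi * \<i> * of_real s * of_int (?x i)) * ee (of_int m * of_real s))
      = (if i = int_encode (- m) then of_real (sqrt A * exp (- pi * A * (of_int m)\<^sup>2)) else 0)" for i
    proof -
      have "of_real (sqrt A) * exp (of_real (- pi * A) * of_int (?x i) ^ 2 + 2 * of_real pi * \<i> * of_real s * of_int (?x i)) * ee (of_int m * of_real s)
        = ee (of_int (?x i + m) * of_real s) * (of_real (sqrt A) * exp (of_real (- pi * A) * of_int (?x i) ^ 2))" for s
        by (simp add: ee_def exp_add exp_diff exp_minus divide_inverse algebra_simps)
      note 1 = this
      have "integral {0..1} (\<lambda>s. of_real (sqrt A) * exp (of_real (- pi * A) * of_int (?x i) ^ 2 + 2 * of_real pi * \<i> * of_real s * of_int (?x i)) * ee (of_int m * of_real s))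
        = (if ?x i + m = 0 then 1 else 0) * (of_real (sqrt A) * exp (of_real (- pi * A) * of_int (?x i) ^ 2))"
        unfolding 1 Henstock_Kurzweil_Integration.integral_mult_left integral_ee_int ..
      also have "\<dots> = (if i = int_encode (- m) then of_real (sqrt A * exp (- pi * A * (of_int m)\<^sup>2)) else 0)"
      proof (cases "i = int_encode (- m)")
        case True then show ?thesis by (simp add: exp_of_real[symmetric])
      next
        case False
        then have "?x i + m \<noteq> 0" by (metis add_eq_0_iff2 int_decode_inverse)
        then show ?thesis using False by simp
      qed
      finally show ?thesis .
    qed
    have "(\<lambda>i. if i = int_encode (- m) then of_real (sqrt A * exp (- pi * A * (of_int m)\<^sup>2)) else 0) sums of_real (sqrt A * exp (- pi * A * (of_int m)\<^sup>2))"
      by (rule sums_single)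
    with Fcoef[of m] show ?thesis unfolding eq using sums_unique2 by blast
  qed
  have cG: "continuous_on {0..1} G" and cF: "continuous_on {0..1} F"
    using Gcont'[of 0] Fcont'[of 0] by (simp_all add: ee_def)
  have pG: "G 0 = G 1"
  proof -
    have "bij_betw (\<lambda>x::int. x + 1) UNIV UNIV" by (rule bij_betw_byWitness[of _ "\<lambda>x. x - 1"]) auto
    moreover have g: "G s = (\<Sum>\<^sub>\<infinity>x::int. \<phi> (s + of_int x))" for s
      unfolding G_def gauss_series_def \<phi>split by (rule infsum_cmult_right'[symmetric])
    ultimately have "G 0 = (\<Sum>\<^sub>\<infinity>x::int. \<phi> (0 + of_int (x + 1)))"
      using infsum_reindex_bij_betw[of "\<lambda>x::int. x + 1" UNIV UNIV "\<lambda>x. \<phi> (0 + of_int x)"] by simp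
    then show ?thesis unfolding g by (simp add: add.commute)
  qed
  have pF: "F 0 = F 1"
  proof -
    have "exp (2 * of_real pi * \<i> * of_int x) = 1" for x :: int
      using exp_integer_2pi[of "of_int x"] by (simp add: mult_ac)
    then show ?thesis by (simp add: F_def gauss_series_def exp_add exp_diff exp_minus divide_inverse)
  qed
  have "G s - F s = 0"
  proof (rule fourier_unique_complex[OF _ _ _ s])
    show "continuous_on {0..1} (\<lambda>s. G s - F s)" by (intro continuous_intros cG cF)
    show "G 0 - F 0 = G 1 - F 1" using pF pG by simp
    fix m :: int
    have "integral {0..1} (\<lambda>s. G s * ee (of_int m * of_real s) - F s * ee (of_int m * of_real s)) = 0"
      by (subst Henstock_Kurzweil_Integration.integral_diff) (use Gcont'[of m] Fcont'[of m] Gval Fval in \<open>auto intro: integrable_continuous_interval\<close>)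
    then show "integral {0..1} (\<lambda>s. (G s - F s) * ee (of_int m * of_real s)) = 0" by (simp add: algebra_simps)
  qed
  then show ?thesis by (simp add: G_def F_def)
qed


section \<open>Transformation formula of the one-dimensional theta series\<close>

lemma gauss_series_minus: "gauss_series \<alpha> (- \<beta>) = gauss_series \<alpha> \<beta>"
proof -
  have "bij_betw (\<lambda>x::int. - x) UNIV UNIV" by (rule bij_betw_byWitness[of _ "\<lambda>x. - x"]) auto
  from infsum_reindex_bij_betw[OF this, of "\<lambda>x. exp (\<alpha> * of_int x ^ 2 + \<beta> * of_int x)"]
  show ?thesis by (simp add: gauss_series_def)
qed

lemma not_nonpos_Reals_upper: "Im \<sigma> > 0 \<Longrightarrow> - \<i> * \<sigma> \<notin> \<real>\<^sub>\<le>\<^sub>0"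
  by (auto simp: complex_nonpos_Reals_iff)

lemma Im_neg_inverse: "Im \<sigma> > 0 \<Longrightarrow> Im (- 1 / \<sigma>) > 0"
proof -
  assume a: "Im \<sigma> > 0"
  then have "(Re \<sigma>)\<^sup>2 + (Im \<sigma>)\<^sup>2 > 0" by (simp add: sum_power2_gt_zero_iff)
  then show ?thesis using a by (simp add: Im_divide)
qed

lemma gauss_series_exponents:
  assumes "Im \<sigma> > 0"
  shows "Re (of_real pi * \<i> * \<sigma>) < 0" "Re (- of_real pi * \<i> / \<sigma>) < 0"
proof -
  have e: "- of_real pi * \<i> / \<sigma> = of_real pi * \<i> * (- 1 / \<sigma>)" by simp
  have n: "Re (of_real pi * \<i> * z) < 0" if "Im z > 0" for z using that by simp
  show "Re (of_real pi * \<i> * \<sigma>) < 0" by (rule n[OF assms])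
  show "Re (- of_real pi * \<i> / \<sigma>) < 0" unfolding e by (rule n[OF Im_neg_inverse[OF assms]])
qed

text \<open>The identity theorem is used twice: in \<open>\<zeta>\<close>, from the segment [0, 1]
  to the plane for purely imaginary \<open>\<sigma>\<close>, then in \<open>\<sigma>\<close>, from
  the imaginary half-line to the upper half-plane. As -i \<open>\<sigma>\<close> stays off the
  negative axis, the principal power is holomorphic there and no sign is lost.\<close>

lemma gauss_series_transformation:
  assumes "Im \<sigma> > 0"
  shows "gauss_series (of_real pi * \<i> * \<sigma>) (2 * of_real pi * \<i> * \<zeta>)
    = (- \<i> * \<sigma>) powr (- 1 / 2) * (exp (- of_real pi * \<i> * \<zeta>\<^sup>2 / \<sigma>) * gauss_series (- of_real pi * \<i> / \<sigma>) (2 * of_real pi * \<i> * \<zeta> / \<sigma>))"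
proof -
  define F where "F \<sigma> \<zeta> = gauss_series (of_real pi * \<i> * \<sigma>) (2 * of_real pi * \<i> * \<zeta>)
    - (- \<i> * \<sigma>) powr (- 1 / 2) * (exp (- of_real pi * \<i> * \<zeta>\<^sup>2 / \<sigma>) * gauss_series (- of_real pi * \<i> / \<sigma>) (2 * of_real pi * \<i> * \<zeta> / \<sigma>))" for \<sigma> \<zeta>
  note neg = gauss_series_exponents
  have 1: "F (\<i> * of_real A) (of_real s) = 0" if "A > 0" "s \<in> {0..1}" for A s
  proof -
    have "(of_real A) powr (- 1 / 2 :: complex) = of_real (A powr (- 1/2))"
      using powr_of_real[of A "-1/2"] that by simp
    also have "A powr (- 1/2) = 1 / sqrt A"
      using powr_minus[of A "1/2"] powr_half_sqrt[of A] that by (simp add: inverse_eq_divide)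
    finally have pw: "(of_real A) powr (- 1 / 2 :: complex) = of_real (1 / sqrt A)" .
    have e: "of_real pi * \<i> * (\<i> * of_real A) = of_real (- pi * A)" 
      "- \<i> * (\<i> * of_real A) = of_real A"
      "- of_real pi * \<i> * (of_real s)\<^sup>2 / (\<i> * of_real A) = of_real (- pi * s\<^sup>2 / A)"
      "- of_real pi * \<i> / (\<i> * of_real A) = of_real (- pi / A)"
      "2 * of_real pi * \<i> * of_real s / (\<i> * of_real A) = - complex_of_real (- 2 * pi * s / A)"
      using that by (simp_all add: field_simps)
    \<comment> \<open>The linear exponent has the opposite sign in \<open>poisson_real\<close>;
      \<open>gauss_series_minus\<close> removes the difference.\<close>
    show ?thesis
      unfolding F_def e gauss_series_minus pw poisson_real[OF that] using that by simp
  qed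
  have 2: "F (\<i> * of_real A) \<zeta> = 0" if "A > 0" for A \<zeta>
  proof (rule analytic_continuation[of "F (\<i> * of_real A)" UNIV "of_real ` {0..1}" 0])
    have n: "Re (of_real pi * \<i> * (\<i> * of_real A)) < 0" "Re (- of_real pi * \<i> / (\<i> * of_real A)) < 0"
      using neg[of "\<i> * of_real A"] that by auto
    show "F (\<i> * of_real A) holomorphic_on UNIV"
      unfolding F_def by (intro holomorphic_intros holomorphic_gauss_series open_UNIV n) (use that in auto)
    show "(0::complex) islimpt of_real ` {0..1}"
    proof (subst islimpt_approachable, intro allI impI)
      fix e :: real assume e: "e > 0"
      show "\<exists>x'\<in>complex_of_real ` {0..1}. x' \<noteq> 0 \<and> dist x' 0 < e"
        by (rule bexI[of _ "of_real (min 1 (e / 2))"]) (use e in auto)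
    qed
  qed (use 1 that in auto)
  have "F \<sigma> \<zeta> = 0"
  proof (rule analytic_continuation[of "\<lambda>\<sigma>. F \<sigma> \<zeta>" "{s. Im s > 0}" "(\<lambda>A. \<i> * of_real A) ` {0<..}" \<i>])
    show "(\<lambda>\<sigma>. F \<sigma> \<zeta>) holomorphic_on {s. 0 < Im s}"
      unfolding F_def using not_nonpos_Reals_upper
      by (intro holomorphic_intros holomorphic_gauss_series open_halfspace_Im_gt) (use neg in auto)
    show "open {s. 0 < Im s}" by (rule open_halfspace_Im_gt)
    show "connected {s. 0 < Im s}" by (intro convex_connected convex_halfspace_Im_gt)
    show "\<i> islimpt (\<lambda>A. \<i> * complex_of_real A) ` {0<..}"
    proof (subst islimpt_approachable, intro allI impI)
      fix e :: real assume e: "e > 0"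
      have "dist (\<i> * complex_of_real (1 + e / 2)) \<i> = e / 2"
      proof -
        have "\<i> * complex_of_real (1 + e / 2) - \<i> = \<i> * of_real (e / 2)" by (simp add: algebra_simps)
        then show ?thesis using e by (simp only: dist_norm norm_mult norm_of_real norm_ii)
      qed
      moreover have "\<i> * complex_of_real (1 + e / 2) \<noteq> \<i>" using e by (simp add: complex_eq_iff)
      moreover have "\<i> * complex_of_real (1 + e / 2) \<in> (\<lambda>A. \<i> * complex_of_real A) ` {0<..}"
        by (rule imageI) (use e in auto)
      ultimately show "\<exists>x'\<in>(\<lambda>A. \<i> * complex_of_real A) ` {0<..}. x' \<noteq> \<i> \<and> dist x' \<i> < e"
        using e by (metis (no_types, lifting) field_sum_of_halves less_add_same_cancel1 half_gt_zero)
    qed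
  qed (use 2 assms in auto)
  then show ?thesis by (simp add: F_def)
qed

text \<open>The square on the right is completed because this is the summand that
  \<open>cquad_parseval\<close> yields along each vector of an orthogonal basis; absolute
  summability on both sides allows such series to be multiplied out.\<close>

lemma theta_transformation_1:
  assumes "Im \<sigma> > 0"
  shows "(\<Sum>\<^sub>\<infinity>x::int. ee (\<sigma> * of_int x ^ 2 / 2 + of_int x * \<zeta>))
    = (- \<i> * \<sigma>) powr (- 1 / 2) * (\<Sum>\<^sub>\<infinity>m::int. ee (- (\<zeta> - of_int m)\<^sup>2 / (2 * \<sigma>)))"
    and "(\<lambda>x::int. ee (\<sigma> * of_int x ^ 2 / 2 + of_int x * \<zeta>)) abs_summable_on UNIV"
    and "(\<lambda>m::int. ee (- (\<zeta> - of_int m)\<^sup>2 / (2 * \<sigma>))) abs_summable_on UNIV"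
proof -
  have s0: "\<sigma> \<noteq> 0" using assms by auto
  have l: "ee (\<sigma> * of_int x ^ 2 / 2 + of_int x * \<zeta>) = exp (of_real pi * \<i> * \<sigma> * of_int x ^ 2 + 2 * of_real pi * \<i> * \<zeta> * of_int x)" for x :: int
    by (simp add: ee_def algebra_simps)
  have r: "ee (- (\<zeta> - of_int m)\<^sup>2 / (2 * \<sigma>)) = exp (- of_real pi * \<i> * \<zeta>\<^sup>2 / \<sigma>) * 
     exp (- of_real pi * \<i> / \<sigma> * of_int m ^ 2 + 2 * of_real pi * \<i> * \<zeta> / \<sigma> * of_int m)" for m :: int
    unfolding ee_def exp_add[symmetric] using s0 by (intro arg_cong[where f = exp]) (simp add: field_simps power2_eq_square)
  show "(\<Sum>\<^sub>\<infinity>x::int. ee (\<sigma> * of_int x ^ 2 / 2 + of_int x * \<zeta>))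
    = (- \<i> * \<sigma>) powr (- 1 / 2) * (\<Sum>\<^sub>\<infinity>m::int. ee (- (\<zeta> - of_int m)\<^sup>2 / (2 * \<sigma>)))"
    using gauss_series_transformation[OF assms, of \<zeta>] unfolding l r infsum_cmult_right' gauss_series_def .
  note neg = gauss_series_exponents[OF assms]
  show "(\<lambda>x::int. ee (\<sigma> * of_int x ^ 2 / 2 + of_int x * \<zeta>)) abs_summable_on UNIV"
    unfolding l by (rule abs_summable_gauss_term[OF neg(1)])
  show "(\<lambda>m::int. ee (- (\<zeta> - of_int m)\<^sup>2 / (2 * \<sigma>))) abs_summable_on UNIV"
    unfolding r norm_mult by (intro summable_on_cmult_right abs_summable_gauss_term[OF neg(2)])
qed

section \<open>Transversals of subgroups\<close>

definition subgrp :: "'a::ab_group_add set \<Rightarrow> bool" where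
  "subgrp H \<longleftrightarrow> 0 \<in> H \<and> (\<forall>x\<in>H. \<forall>y\<in>H. x - y \<in> H)"

text \<open>Quotients are handled through representatives inside the ambient group, so that sums
  over \<open>L / c L\<close> or \<open>Ld / L\<close> range over ordinary sets of vectors.\<close>

definition transversal :: "'a::ab_group_add set \<Rightarrow> 'a set \<Rightarrow> 'a set \<Rightarrow> bool" where
  "transversal R X H \<longleftrightarrow> R \<subseteq> X \<and> (\<forall>x\<in>X. \<exists>!r. r \<in> R \<and> x - r \<in> H)"

lemma subgrpD:
  assumes "subgrp H"
  shows "0 \<in> H" "x \<in> H \<Longrightarrow> y \<in> H \<Longrightarrow> x - y \<in> H" "x \<in> H \<Longrightarrow> - x \<in> H" "x \<in> H \<Longrightarrow> y \<in> H \<Longrightarrow> x + y \<in> H"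
proof -
  show 1: "0 \<in> H" "\<And>x y. x \<in> H \<Longrightarrow> y \<in> H \<Longrightarrow> x - y \<in> H" using assms by (auto simp: subgrp_def)
  show 2: "- x \<in> H" if "x \<in> H" for x using 1(2)[OF 1(1) that] by simp
  show "x + y \<in> H" if "x \<in> H" "y \<in> H" using 1(2)[OF that(1) 2[OF that(2)]] by simp
qed

lemma subgrp_sum: "subgrp H \<Longrightarrow> (\<And>i. i \<in> I \<Longrightarrow> f i \<in> H) \<Longrightarrow> sum f I \<in> H"
  by (induction I rule: infinite_finite_induct) (auto intro: subgrpD)

lemma subgrp_of_int_scale:
  fixes x :: "'a::real_vector"
  assumes "subgrp H" "x \<in> H"
  shows "of_int k *\<^sub>R x \<in> H"
proof (induction k rule: int_induct[of _ 0])
  case base then show ?case using subgrpD(1)[OF assms(1)] by simp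
next
  case (step1 i) then show ?case using subgrpD(4)[OF assms(1) step1.IH assms(2)] by (simp add: scaleR_left_distrib)
next
  case (step2 i) then show ?case using subgrpD(2)[OF assms(1) step2.IH assms(2)] by (simp add: scaleR_left_diff_distrib)
qed

lemma subgrp_scaled: 
  fixes H :: "'a::real_vector set"
  assumes "subgrp H"
  shows "subgrp ((*\<^sub>R) c ` H)"
  unfolding subgrp_def
proof (intro conjI ballI)
  show "0 \<in> (*\<^sub>R) c ` H" using subgrpD(1)[OF assms] by (metis image_eqI scaleR_zero_right)
  fix x y assume "x \<in> (*\<^sub>R) c ` H" "y \<in> (*\<^sub>R) c ` H"
  then obtain x' y' where "x' \<in> H" "y' \<in> H" "x = c *\<^sub>R x'" "y = c *\<^sub>R y'" by blast
  then have "x - y = c *\<^sub>R (x' - y')" "x' - y' \<in> H" 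
    using subgrpD(2)[OF assms] by (simp_all add: scaleR_right_diff_distrib)
  then show "x - y \<in> (*\<^sub>R) c ` H" by blast
qed

lemma transversalD:
  assumes "transversal R X H"
  shows "r \<in> R \<Longrightarrow> r \<in> X" "x \<in> X \<Longrightarrow> \<exists>r\<in>R. x - r \<in> H"
    "subgrp H \<Longrightarrow> r \<in> R \<Longrightarrow> r' \<in> R \<Longrightarrow> r - r' \<in> H \<Longrightarrow> r = r'"
proof -
  show "r \<in> R \<Longrightarrow> r \<in> X" "x \<in> X \<Longrightarrow> \<exists>r\<in>R. x - r \<in> H" using assms unfolding transversal_def by blast+
  show "r = r'" if "subgrp H" "r \<in> R" "r' \<in> R" "r - r' \<in> H"
  proof -
    have "r \<in> X" "r - r \<in> H" using assms that subgrpD(1)[OF that(1)] by (auto simp: transversal_def)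
    then show ?thesis using assms that unfolding transversal_def by blast
  qed
qed

lemma transversalI:
  assumes "subgrp H" "R \<subseteq> X" "\<And>x. x \<in> X \<Longrightarrow> \<exists>r\<in>R. x - r \<in> H"
    "\<And>r r'. r \<in> R \<Longrightarrow> r' \<in> R \<Longrightarrow> r - r' \<in> H \<Longrightarrow> r = r'"
  shows "transversal R X H"
  unfolding transversal_def
proof (intro conjI ballI assms(2))
  fix x assume "x \<in> X"
  then obtain r where r: "r \<in> R" "x - r \<in> H" using assms(3) by blast
  show "\<exists>!r. r \<in> R \<and> x - r \<in> H"
  proof (rule ex1I[of _ r])
    fix r' assume r': "r' \<in> R \<and> x - r' \<in> H"
    have "r' - r = (x - r) - (x - r')" by simp
    then have "r' - r \<in> H" using r r' subgrpD(2)[OF assms(1)] by metis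
    then show "r' = r" using assms(4) r r' by blast
  qed (use r in auto)
qed

text \<open>Congruent elements have the same set of candidates, so \<open>SOME\<close> selects the
  same representative for them.\<close>

lemma transversal_exists:
  assumes H: "subgrp H"
  obtains R where "transversal R X H"
proof -
  define s where "s x = (SOME y. y \<in> X \<and> x - y \<in> H)" for x
  have s: "s x \<in> X" "x - s x \<in> H" if "x \<in> X" for x
  proof -
    have "\<exists>y. y \<in> X \<and> x - y \<in> H" using that subgrpD(1)[OF H] by (intro exI[of _ x]) auto
    from someI_ex[OF this] show "s x \<in> X" "x - s x \<in> H" by (auto simp: s_def)
  qed
  have eq: "s x = s x'" if "x - x' \<in> H" for x x'
  proof -
    have "x - y \<in> H \<longleftrightarrow> x' - y \<in> H" for y
    proof -
      have "x' - y = (x - y) - (x - x')" "x - y = (x' - y) + (x - x')" by simp_all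
      then show ?thesis using that subgrpD[OF H] by metis
    qed
    then show ?thesis by (simp add: s_def)
  qed
  have "transversal (s ` X) X H"
  proof (rule transversalI[OF H])
    fix r r' assume "r \<in> s ` X" "r' \<in> s ` X" and h: "r - r' \<in> H"
    then obtain x x' where x: "x \<in> X" "x' \<in> X" "r = s x" "r' = s x'" by auto
    have "x - x' = (x - s x) + (s x - s x') - (x' - s x')" by simp
    then have "x - x' \<in> H" using s x h subgrpD[OF H] by metis
    then show "r = r'" using eq x by simp
  qed (use s in auto)
  then show ?thesis by (rule that)
qed

lemma transversal_inj:
  assumes H: "subgrp H" and R': "transversal R' X H" and R: "R \<subseteq> X"
    and inj: "\<And>r s. r \<in> R \<Longrightarrow> s \<in> R \<Longrightarrow> r - s \<in> H \<Longrightarrow> r = s"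
  shows "\<exists>g. inj_on g R \<and> g ` R \<subseteq> R' \<and> (\<forall>r\<in>R. r - g r \<in> H)"
proof -
  have "\<exists>r'. r' \<in> R' \<and> r - r' \<in> H" if "r \<in> R" for r
    using R that transversalD(2)[OF R'] by blast
  then obtain g where g: "\<And>r. r \<in> R \<Longrightarrow> g r \<in> R' \<and> r - g r \<in> H" by metis
  have "inj_on g R"
  proof (rule inj_onI)
    fix r s assume a: "r \<in> R" "s \<in> R" "g r = g s"
    have "r - s = (r - g r) - (s - g s)" using a by simp
    then have "r - s \<in> H" using g a subgrpD(2)[OF H] by metis
    then show "r = s" using inj a by blast
  qed
  then show ?thesis using g by (intro exI[of _ g]) auto
qed

lemma transversal_bij:
  assumes H: "subgrp H" and R: "transversal R X H" and R': "transversal R' X H"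
  obtains g where "bij_betw g R R'" "\<And>r. r \<in> R \<Longrightarrow> r - g r \<in> H"
proof -
  have RX: "R \<subseteq> X" using transversalD(1)[OF R] by blast
  obtain g where g: "inj_on g R" "g ` R \<subseteq> R'" "\<And>r. r \<in> R \<Longrightarrow> r - g r \<in> H"
    using transversal_inj[OF H R' RX transversalD(3)[OF R H]] by blast
  have "g ` R = R'"
  proof (intro equalityI subsetI)
    fix y assume y: "y \<in> R'"
    then obtain r where r: "r \<in> R" "y - r \<in> H" using transversalD(1)[OF R'] transversalD(2)[OF R] by blast
    have "y - g r = (y - r) + (r - g r)" by simp
    then have "y - g r \<in> H" using g r subgrpD(4)[OF H] by metis
    then have "y = g r" using transversalD(3)[OF R' H] y g r by blast
    then show "y \<in> g ` R" using r by blast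
  qed (use g in auto)
  then show ?thesis using g by (intro that[of g]) (auto simp: bij_betw_def)
qed

lemma transversal_sum_eq:
  assumes "subgrp H" "transversal R X H" "transversal R' X H"
    and "\<And>x y. x \<in> X \<Longrightarrow> y \<in> X \<Longrightarrow> x - y \<in> H \<Longrightarrow> F x = F y"
  shows "sum F R = sum F R'"
proof -
  obtain g where g: "bij_betw g R R'" "\<And>r. r \<in> R \<Longrightarrow> r - g r \<in> H" using transversal_bij[OF assms(1-3)] by blast
  have "sum F R = sum (F \<circ> g) R"
  proof (rule sum.cong)
    fix r assume r: "r \<in> R"
    then have "g r \<in> R'" using g bij_betwE by blast
    then show "F r = (F \<circ> g) r" using assms(4)[of r "g r"] g r transversalD(1)[OF assms(2)] transversalD(1)[OF assms(3)] by auto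
  qed simp
  then show ?thesis using sum.reindex_bij_betw[OF g(1), of F] by simp
qed

lemma transversal_card_eq:
  assumes "subgrp H" "transversal R X H" "transversal R' X H"
  shows "card R = card R'" "finite R \<longleftrightarrow> finite R'"
  using transversal_bij[OF assms] bij_betw_same_card bij_betw_finite by metis+

text \<open>The tower law for H in Y in X. It serves for multiplicativity of indices in
  \<open>transversal_dual\<close> and for splitting Gauss sums along an intermediate lattice in
  \<open>gauss_mult\<close> and \<open>gauss_prime_power\<close>.\<close>

lemma transversal_prod:
  assumes H: "subgrp H" and Y: "subgrp Y" and X: "subgrp X" and sub: "H \<subseteq> Y" "Y \<subseteq> X"
    and R1: "transversal R1 Y H" and R2: "transversal R2 X Y"
  shows "transversal ((\<lambda>(r, s). r + s) ` (R1 \<times> R2)) X H" "inj_on (\<lambda>(r, s). r + s) (R1 \<times> R2)"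
proof -
  have key: "r = r' \<and> s = s'" if "r \<in> R1" "r' \<in> R1" "s \<in> R2" "s' \<in> R2" "(r + s) - (r' + s') \<in> H" for r r' s s'
  proof -
    have y: "r \<in> Y" "r' \<in> Y" using that transversalD(1)[OF R1] by auto
    have "s - s' = ((r + s) - (r' + s')) - (r - r')" by simp
    then have "s - s' \<in> Y" using that(5) sub(1) y subgrpD(2)[OF Y] by (metis subsetD)
    then have s: "s = s'" using transversalD(3)[OF R2 Y] that by blast
    then have "r - r' \<in> H" using that(5) by simp
    then show ?thesis using s transversalD(3)[OF R1 H] that by blast
  qed
  show "transversal ((\<lambda>(r, s). r + s) ` (R1 \<times> R2)) X H"
  proof (rule transversalI[OF H])
    show "(\<lambda>(r, s). r + s) ` (R1 \<times> R2) \<subseteq> X"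
      using transversalD(1)[OF R1] transversalD(1)[OF R2] sub subgrpD(4)[OF X] by (auto simp: subset_iff)
    fix x assume "x \<in> X"
    then obtain s where s: "s \<in> R2" "x - s \<in> Y" using transversalD(2)[OF R2] by blast
    then obtain r where r: "r \<in> R1" "x - s - r \<in> H" using transversalD(2)[OF R1] by blast
    show "\<exists>r\<in>(\<lambda>(r, s). r + s) ` (R1 \<times> R2). x - r \<in> H"
      by (rule bexI[of _ "r + s"]) (use r s in \<open>auto simp: algebra_simps\<close>)
  qed (use key in auto)
  show "inj_on (\<lambda>(r, s). r + s) (R1 \<times> R2)"
    using key subgrpD(1)[OF H] by (fastforce intro!: inj_onI)
qed

text \<open>The bridge from \<open>disc\<close>, which counts equivalence classes, to
  representatives.\<close>

lemma transversal_quotient_card: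
  assumes H: "subgrp H" and R: "transversal R X H"
  shows "card (X // {(x, y). x - y \<in> H}) = card R"
proof -
  let ?E = "{(x, y). x - y \<in> H}"
  have im: "?E `` {x} = {y. x - y \<in> H}" for x by auto
  have eqc: "?E `` {x} = ?E `` {r} \<longleftrightarrow> x - r \<in> H" for x r
  proof
    assume "?E `` {x} = ?E `` {r}"
    moreover have "r \<in> ?E `` {r}" using subgrpD(1)[OF H] by simp
    ultimately show "x - r \<in> H" unfolding im by blast
  next
    assume a: "x - r \<in> H"
    have "x - y \<in> H \<longleftrightarrow> r - y \<in> H" for y
    proof -
      have "x - y = (r - y) + (x - r)" "r - y = (x - y) - (x - r)" by simp_all
      then show ?thesis using a subgrpD[OF H] by metis
    qed
    then show "?E `` {x} = ?E `` {r}" unfolding im by auto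
  qed
  have "bij_betw (\<lambda>r. ?E `` {r}) R (X // ?E)"
    unfolding bij_betw_def
  proof
    show "inj_on (\<lambda>r. ?E `` {r}) R" using transversalD(3)[OF R H] by (auto intro!: inj_onI simp only: eqc)
    show "(\<lambda>r. ?E `` {r}) ` R = X // ?E"
    proof (intro equalityI subsetI)
      fix c assume "c \<in> X // ?E"
      then obtain x where x: "x \<in> X" "c = ?E `` {x}" by (auto simp: quotient_def)
      then obtain r where "r \<in> R" "x - r \<in> H" using transversalD(2)[OF R] by blast
      then show "c \<in> (\<lambda>r. ?E `` {r}) ` R" using x eqc by blast
    qed (use transversalD(1)[OF R] in \<open>auto simp: quotient_def\<close>)
  qed
  then show ?thesis by (rule bij_betw_same_card[symmetric])
qed

lemma transversal_scaled:
  assumes "transversal R X H" "c \<noteq> 0"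
  shows "transversal ((*\<^sub>R) c ` R) ((*\<^sub>R) c ` X) ((*\<^sub>R) c ` (H :: 'a::real_vector set))"
proof -
  have "c *\<^sub>R x - c *\<^sub>R r \<in> (*\<^sub>R) c ` H \<longleftrightarrow> x - r \<in> H" for x r
  proof -
    have "inj ((*\<^sub>R) c :: 'a \<Rightarrow> 'a)" using assms(2) by (auto intro: injI)
    then show ?thesis by (simp only: scaleR_right_diff_distrib[symmetric] inj_image_mem_iff)
  qed
  note key = this
  have "\<exists>!r. r \<in> (*\<^sub>R) c ` R \<and> c *\<^sub>R x - r \<in> (*\<^sub>R) c ` H" if x: "x \<in> X" for x
  proof -
    obtain r where r: "r \<in> R" "x - r \<in> H" "\<And>r'. r' \<in> R \<Longrightarrow> x - r' \<in> H \<Longrightarrow> r' = r"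
      using assms(1) x unfolding transversal_def by metis
    show ?thesis
    proof (rule ex1I[of _ "c *\<^sub>R r"])
      show "c *\<^sub>R r \<in> (*\<^sub>R) c ` R \<and> c *\<^sub>R x - c *\<^sub>R r \<in> (*\<^sub>R) c ` H" using r(1,2) key by blast
      fix s assume s: "s \<in> (*\<^sub>R) c ` R \<and> c *\<^sub>R x - s \<in> (*\<^sub>R) c ` H"
      then obtain r' where r': "r' \<in> R" "s = c *\<^sub>R r'" by blast
      then have "x - r' \<in> H" using s key by blast
      then show "s = c *\<^sub>R r" using r(3) r' by blast
    qed
  qed
  note ex = this
  show ?thesis unfolding transversal_def
  proof (intro conjI ballI)
    show "(*\<^sub>R) c ` R \<subseteq> (*\<^sub>R) c ` X" using transversalD(1)[OF assms(1)] by (intro image_mono subsetI)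
    fix y assume "y \<in> (*\<^sub>R) c ` X"
    then obtain x where "x \<in> X" "y = c *\<^sub>R x" by (rule imageE)
    then show "\<exists>!r. r \<in> (*\<^sub>R) c ` R \<and> y - r \<in> (*\<^sub>R) c ` H" using ex[of x] by simp
  qed
qed

text \<open>Together with \<open>transversal_sum_eq\<close> this is the substitution x -> x0 + x in
  a sum over X / H.\<close>

lemma transversal_shift:
  assumes X: "subgrp X" and R: "transversal R X H" and x0: "x0 \<in> X"
  shows "transversal ((+) x0 ` R) X H"
  unfolding transversal_def
proof (intro conjI ballI)
  show "(+) x0 ` R \<subseteq> X" using transversalD(1)[OF R] subgrpD(4)[OF X x0] by auto
  fix x assume "x \<in> X"
  then have "x - x0 \<in> X" using x0 subgrpD(2)[OF X] by blast
  then obtain r where r: "r \<in> R" "x - x0 - r \<in> H" "\<And>r'. r' \<in> R \<Longrightarrow> x - x0 - r' \<in> H \<Longrightarrow> r' = r"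
    using R unfolding transversal_def by metis
  show "\<exists>!r. r \<in> (+) x0 ` R \<and> x - r \<in> H"
  proof (rule ex1I[of _ "x0 + r"])
    show "x0 + r \<in> (+) x0 ` R \<and> x - (x0 + r) \<in> H" using r(1,2) by (simp add: diff_diff_eq)
    fix s assume s: "s \<in> (+) x0 ` R \<and> x - s \<in> H"
    then obtain r' where r': "r' \<in> R" "s = x0 + r'" by blast
    then have "x - x0 - r' \<in> H" using s by (simp add: diff_diff_eq)
    then show "s = x0 + r" using r(3) r' by blast
  qed
qed

lemma transversal_finite_subset:
  assumes H: "subgrp H" and R: "transversal R X H" and R': "transversal R' Y H" and "X \<subseteq> Y" and fin: "finite R'"
  shows "finite R"
proof -
  have RY: "R \<subseteq> Y" using transversalD(1)[OF R] assms(4) by blast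
  obtain g where "inj_on g R" "g ` R \<subseteq> R'"
    using transversal_inj[OF H R' RY transversalD(3)[OF R H]] by blast
  then show ?thesis using fin by (metis finite_imageD finite_subset)
qed

text \<open>Pigeonhole. For an orthogonal sublattice modulo p, incongruence of the small coefficient
  vectors is easy to check, whereas it is not evident that they represent all of \<open>L\<close>;
  counting settles it.\<close>

lemma transversal_of_card:
  assumes H: "subgrp H" and R0: "transversal R0 X H" "finite R0" and R: "R \<subseteq> X"
    and inj: "\<And>r s. r \<in> R \<Longrightarrow> s \<in> R \<Longrightarrow> r - s \<in> H \<Longrightarrow> r = s" and card: "card R = card R0"
  shows "transversal R X H"
proof (rule transversalI[OF H R _ inj])
  obtain g where g: "inj_on g R" "g ` R \<subseteq> R0" "\<And>r. r \<in> R \<Longrightarrow> r - g r \<in> H"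
    using transversal_inj[OF H R0(1) R inj] by blast
  then have "card (g ` R) = card R0" using card by (simp add: card_image)
  then have im: "g ` R = R0" using card_subset_eq[OF R0(2) g(2)] by blast
  fix x assume "x \<in> X"
  then obtain r0 where r0: "r0 \<in> R0" "x - r0 \<in> H" using transversalD(2)[OF R0(1)] by blast
  then obtain r where r: "r \<in> R" "r0 = g r" using im by blast
  have "x - r = (x - r0) - (r - g r)" using r by simp
  then have "x - r \<in> H" using g r r0 subgrpD(2)[OF H] by metis
  then show "\<exists>r\<in>R. x - r \<in> H" using r by blast
qed

lemma transversal_infsum:
  fixes f :: "'a::ab_group_add \<Rightarrow> complex"
  assumes H: "subgrp H" and X: "subgrp X" and sub: "H \<subseteq> X" and R: "transversal R X H" and fin: "finite R" and sm: "f summable_on ((+) t ` X)"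
  shows "infsum f ((+) t ` X) = (\<Sum>r\<in>R. \<Sum>\<^sub>\<infinity>h\<in>H. f (t + r + h))"
proof -
  have un: "(+) t ` X = (\<Union>r\<in>R. (+) (t + r) ` H)"
  proof (intro equalityI subsetI)
    fix y assume "y \<in> (+) t ` X"
    then obtain x where x: "x \<in> X" "y = t + x" by auto
    then obtain r where r: "r \<in> R" "x - r \<in> H" using transversalD(2)[OF R] by blast
    then have "y = t + r + (x - r)" using x by simp
    then show "y \<in> (\<Union>r\<in>R. (+) (t + r) ` H)" using r by blast
  next
    fix y assume "y \<in> (\<Union>r\<in>R. (+) (t + r) ` H)"
    then obtain r h where "r \<in> R" "h \<in> H" "y = t + (r + h)" by (auto simp: add.assoc)
    then show "y \<in> (+) t ` X" using transversalD(1)[OF R] sub subgrpD(4)[OF X] by blast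
  qed
  have disj: "(+) (t + r) ` H \<inter> (+) (t + s) ` H = {}" if "r \<in> R" "s \<in> R" "r \<noteq> s" for r s
  proof (rule ccontr)
    assume "(+) (t + r) ` H \<inter> (+) (t + s) ` H \<noteq> {}"
    then obtain h k where hk: "h \<in> H" "k \<in> H" "t + r + h = t + s + k" by auto
    then have "r - s = k - h" by (simp add: algebra_simps)
    then have "r - s \<in> H" using hk subgrpD(2)[OF H] by metis
    then show False using that transversalD(3)[OF R H] by blast
  qed
  have "infsum f (\<Union>r\<in>R'. (+) (t + r) ` H) = (\<Sum>r\<in>R'. infsum f ((+) (t + r) ` H))" if "R' \<subseteq> R" for R'
    using finite_subset[OF that fin] that
  proof (induction R' rule: finite_induct)
    case (insert r R')
    have s: "f summable_on (\<Union>r\<in>R'. (+) (t + r) ` H)" "f summable_on ((+) (t + r) ` H)"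
      by (rule summable_on_subset_banach[OF sm]; use insert un in auto)+
    have "(+) (t + r) ` H \<inter> (\<Union>r\<in>R'. (+) (t + r) ` H) = {}" 
      using disj insert.hyps insert.prems by (auto 4 4)
    then show ?case using infsum_Un_disjoint[OF s(2,1)] insert by simp
  qed simp
  from this[of R] have "infsum f ((+) t ` X) = (\<Sum>r\<in>R. infsum f ((+) (t + r) ` H))" by (simp add: un)
  also have "\<dots> = (\<Sum>r\<in>R. \<Sum>\<^sub>\<infinity>h\<in>H. f (t + r + h))"
    by (intro sum.cong refl) (subst infsum_reindex, auto simp: o_def)
  finally show ?thesis .
qed

section \<open>Additive characters and their sums\<close>

lemma ee_add: "ee (x + y) = ee x * ee y"
  by (simp add: ee_def distrib_left exp_add)

lemma ee_int [simp]: "ee (of_int k) = 1"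
  using exp_integer_2pi[of "of_int k"] by (simp add: ee_def mult_ac)

lemma ee_Ints: "x \<in> \<int> \<Longrightarrow> ee (of_real x) = 1"
  by (auto elim!: Ints_cases)

lemma ee_real_eq_1: "ee (of_real x) = 1 \<Longrightarrow> x \<in> \<int>"
proof -
  assume "ee (of_real x) = 1"
  then have "exp (\<i> * of_real (2 * pi * x)) = 1" by (simp add: ee_def mult_ac)
  then obtain n :: int where "2 * pi * x = of_int (2 * n) * pi" using exp_eq_1[of "\<i> * of_real (2 * pi * x)"] by auto
  then show "x \<in> \<int>" by simp
qed

lemma ee_cong: "x - y \<in> \<int> \<Longrightarrow> ee (of_real x) = ee (of_real y)"
  using ee_add[of "of_real y" "of_real (x - y)"] ee_Ints[of "x - y"] by simp

lemma norm_ee_real [simp]: "norm (ee (of_real x)) = 1"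
  by (simp add: ee_def)

text \<open>If \<open>\<phi> x0\<close> is not integral, translation by \<open>x0\<close> multiplies
  the sum by a number other than 1 without changing it, so the sum vanishes. The character is
  written additively, as a real map taken modulo 1.\<close>

lemma transversal_character_sum:
  fixes \<phi> :: "'a::ab_group_add \<Rightarrow> real"
  assumes H: "subgrp H" and X: "subgrp X" and R: "transversal R X H" and fin: "finite R"
    and add: "\<And>x y. x \<in> X \<Longrightarrow> y \<in> X \<Longrightarrow> \<phi> (x + y) = \<phi> x + \<phi> y" and H0: "\<And>h. h \<in> H \<Longrightarrow> \<phi> h \<in> \<int>" and HX: "H \<subseteq> X"
  shows "(\<Sum>r\<in>R. ee (of_real (\<phi> r))) = (if \<forall>x\<in>X. \<phi> x \<in> \<int> then of_nat (card R) else 0)"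
proof (cases "\<forall>x\<in>X. \<phi> x \<in> \<int>")
  case True
  then show ?thesis using transversalD(1)[OF R] by (simp add: ee_Ints)
next
  case False
  then obtain x0 where x0: "x0 \<in> X" "\<phi> x0 \<notin> \<int>" by blast
  have inv: "ee (of_real (\<phi> x)) = ee (of_real (\<phi> y))" if "x \<in> X" "y \<in> X" "x - y \<in> H" for x y
  proof -
    have "\<phi> x = \<phi> y + \<phi> (x - y)" using add[of y "x - y"] that HX by auto
    then show ?thesis using H0[OF that(3)] by (intro ee_cong) simp
  qed
  have "(\<Sum>r\<in>R. ee (of_real (\<phi> r))) = (\<Sum>r\<in>(+) x0 ` R. ee (of_real (\<phi> r)))"
    by (rule transversal_sum_eq[OF H R transversal_shift[OF X R x0(1)] inv])
  also have "\<dots> = (\<Sum>r\<in>R. ee (of_real (\<phi> (x0 + r))))" by (subst sum.reindex) (auto simp: o_def)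
  also have "\<dots> = (\<Sum>r\<in>R. ee (of_real (\<phi> x0)) * ee (of_real (\<phi> r)))"
    using add x0 transversalD(1)[OF R] by (intro sum.cong) (auto simp: ee_add)
  also have "\<dots> = ee (of_real (\<phi> x0)) * (\<Sum>r\<in>R. ee (of_real (\<phi> r)))" by (simp add: sum_distrib_left)
  finally have "(1 - ee (of_real (\<phi> x0))) * (\<Sum>r\<in>R. ee (of_real (\<phi> r))) = 0" by (simp add: algebra_simps)
  moreover have "ee (of_real (\<phi> x0)) \<noteq> 1" using x0 ee_real_eq_1 by blast
  ultimately show ?thesis unfolding if_not_P[OF False] by simp
qed

section \<open>Lattices and orthogonal bases\<close>

text \<open>The integral span in exactly the shape used by \<open>is_lattice\<close>, available for
  arbitrary generating sets as well as bases.\<close>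

definition zspan :: "'a::real_vector set \<Rightarrow> 'a set" where
  "zspan S = {\<Sum>v\<in>S. of_int (k v) *\<^sub>R v | k :: 'a \<Rightarrow> int. True}"

lemma subgrp_zspan: "subgrp (zspan S)"
  unfolding subgrp_def
proof (intro conjI ballI)
  show "0 \<in> zspan S" unfolding zspan_def by (auto intro!: exI[of _ "\<lambda>_. 0"])
  fix x y assume "x \<in> zspan S" "y \<in> zspan S"
  then obtain k l :: "'a \<Rightarrow> int" where "x = (\<Sum>v\<in>S. of_int (k v) *\<^sub>R v)" "y = (\<Sum>v\<in>S. of_int (l v) *\<^sub>R v)"
    unfolding zspan_def by auto
  then have "x - y = (\<Sum>v\<in>S. of_int ((\<lambda>v. k v - l v) v) *\<^sub>R v)" by (simp add: sum_subtractf scaleR_left_diff_distrib)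
  then show "x - y \<in> zspan S" unfolding zspan_def mem_Collect_eq by (intro exI[of _ "\<lambda>v. k v - l v"]) simp
qed

lemma zspan_superset: "finite S \<Longrightarrow> v \<in> S \<Longrightarrow> v \<in> zspan S"
  unfolding zspan_def mem_Collect_eq
  by (rule exI[of _ "\<lambda>w. if w = v then 1 else 0"]) (simp add: if_distrib[where f = "\<lambda>k. of_int k *\<^sub>R _"] sum.delta' cong: if_cong)

lemma zspan_subset: "subgrp L \<Longrightarrow> S \<subseteq> L \<Longrightarrow> zspan S \<subseteq> L"
  unfolding zspan_def by (auto intro!: subgrp_sum subgrp_of_int_scale)

lemma representation_basis_sum:
  assumes "independent bs" "finite bs" "b \<in> bs"
  shows "representation bs (\<Sum>v\<in>bs. f v *\<^sub>R v) b = f b"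
proof -
  have "representation bs (\<Sum>v\<in>bs. f v *\<^sub>R v) b = (\<Sum>v\<in>bs. f v * representation bs v b)"
    using assms by (simp add: representation_sum representation_scale span_base span_scale)
  also have "\<dots> = (\<Sum>v\<in>bs. if v = b then f v else 0)"
    by (intro sum.cong) (use assms in \<open>auto simp: representation_basis\<close>)
  finally show ?thesis using assms by simp
qed

lemma zspan_basis_iff:
  assumes "independent bs" "span bs = UNIV" "finite bs"
  shows "x \<in> zspan bs \<longleftrightarrow> (\<forall>b\<in>bs. representation bs x b \<in> \<int>)"
proof
  assume "x \<in> zspan bs"
  then obtain k :: "_ \<Rightarrow> int" where k: "x = (\<Sum>v\<in>bs. of_int (k v) *\<^sub>R v)" unfolding zspan_def by blast
  show "\<forall>b\<in>bs. representation bs x b \<in> \<int>"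
    unfolding k using representation_basis_sum[OF assms(1,3), of _ "\<lambda>v. of_int (k v)"] by simp
next
  assume r: "\<forall>b\<in>bs. representation bs x b \<in> \<int>"
  have "x = (\<Sum>b\<in>bs. representation bs x b *\<^sub>R b)"
    using sum_representation_eq[OF assms(1), of x bs] assms by simp
  also have "\<dots> = (\<Sum>b\<in>bs. of_int \<lfloor>representation bs x b\<rfloor> *\<^sub>R b)"
    by (intro sum.cong) (use r in \<open>auto elim!: Ints_cases\<close>)
  finally show "x \<in> zspan bs" unfolding zspan_def mem_Collect_eq by (intro exI[of _ "\<lambda>b. \<lfloor>representation bs x b\<rfloor>"]) simp
qed

lemma is_lattice_zspan: "is_lattice L \<longleftrightarrow> (\<exists>bs. independent bs \<and> span bs = UNIV \<and> L = zspan bs)"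
  unfolding is_lattice_def zspan_def ..

lemma is_lattice_basis:
  fixes L :: "(real ^ 'n) set"
  assumes "is_lattice L"
  obtains bs where "independent bs" "span bs = UNIV" "finite bs" "card bs = CARD('n)" "L = zspan bs"
proof -
  obtain bs where bs: "independent bs" "span bs = UNIV" "L = zspan bs" using assms unfolding is_lattice_zspan by blast
  have "finite bs" using bs(1) by (rule independent_imp_finite)
  moreover have "card bs = CARD('n)" using dim_eq_card[of bs "UNIV :: (real ^ 'n) set"] bs by simp
  ultimately show ?thesis using bs that by blast
qed

lemma lattice_subgrp: "is_lattice L \<Longrightarrow> subgrp L"
  unfolding is_lattice_zspan using subgrp_zspan by blast

text \<open>A basis identifies \<open>L / c L\<close> with (Z / c)^n; the representatives are the
  vectors whose coordinates lie in \<open>{0..<c}\<close>.\<close>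

lemma lattice_transversal_scaled:
  fixes L :: "(real ^ 'n) set" and c :: int
  assumes "is_lattice L" "c > 0"
  obtains R where "transversal R L ((*\<^sub>R) (of_int c) ` L)" "card R = nat c ^ CARD('n)" "finite R"
proof -
  obtain bs where bs: "independent bs" "span bs = UNIV" "finite bs" "card bs = CARD('n)" "L = zspan bs"
    using is_lattice_basis[OF assms(1)] .
  define g where "g k = (\<Sum>b\<in>bs. of_int (k b) *\<^sub>R b)" for k :: "real ^ 'n \<Rightarrow> int"
  define K where "K = PiE bs (\<lambda>_. {0..<c})"
  have rg: "representation bs (g k) b = of_int (k b)" if "b \<in> bs" for k b
    unfolding g_def by (rule representation_basis_sum[OF bs(1,3) that])
  have gL: "g k \<in> L" for k unfolding bs(5) zspan_def g_def by blast
  have gdiff: "g k - g l = g (\<lambda>b. k b - l b)" for k l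
    by (simp add: g_def sum_subtractf scaleR_left_diff_distrib)
  have gscale: "of_int c *\<^sub>R g k = g (\<lambda>b. c * k b)" for k
    by (simp add: g_def scaleR_sum_right)
  have gcong: "g k = g l \<longleftrightarrow> (\<forall>b\<in>bs. k b = l b)" for k l
  proof
    assume "g k = g l" then show "\<forall>b\<in>bs. k b = l b" using rg by (metis of_int_eq_iff)
  qed (simp add: g_def)
  have mem: "g k \<in> (*\<^sub>R) (of_int c) ` L \<longleftrightarrow> (\<forall>b\<in>bs. c dvd k b)" for k
  proof
    assume "g k \<in> (*\<^sub>R) (of_int c) ` L"
    then obtain l where "g k = of_int c *\<^sub>R g l" unfolding bs(5) zspan_def g_def by blast
    then show "\<forall>b\<in>bs. c dvd k b" unfolding gscale gcong by simp
  next
    assume d: "\<forall>b\<in>bs. c dvd k b"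
    then have "g k = g (\<lambda>b. c * (k b div c))" unfolding gcong by simp
    then have "g k = of_int c *\<^sub>R g (\<lambda>b. k b div c)" by (simp only: gscale)
    then show "g k \<in> (*\<^sub>R) (of_int c) ` L" using gL by blast
  qed
  have inj: "inj_on g K"
  proof (rule inj_onI)
    fix k l assume kl: "k \<in> K" "l \<in> K" "g k = g l"
    then have "\<forall>b\<in>bs. k b = l b" using gcong by blast
    with kl show "k = l" unfolding K_def by (metis PiE_ext)
  qed
  have "transversal (g ` K) L ((*\<^sub>R) (of_int c) ` L)"
  proof (rule transversalI)
    show "subgrp ((*\<^sub>R) (of_int c) ` L)" using subgrp_scaled lattice_subgrp[OF assms(1)] by blast
    show "g ` K \<subseteq> L" using gL by blast
    fix x assume "x \<in> L"
    then obtain k :: "real ^ 'n \<Rightarrow> int" where x: "x = g k" unfolding bs(5) zspan_def g_def by blast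
    let ?l = "restrict (\<lambda>b. k b mod c) bs"
    have "?l \<in> K" using assms(2) by (auto simp: K_def)
    moreover have "x - g ?l \<in> (*\<^sub>R) (of_int c) ` L" unfolding x gdiff mem by (auto simp: dvd_minus_mod)
    ultimately show "\<exists>r\<in>g ` K. x - r \<in> (*\<^sub>R) (of_int c) ` L" by blast
  next
    fix r s assume "r \<in> g ` K" "s \<in> g ` K" and d: "r - s \<in> (*\<^sub>R) (of_int c) ` L"
    then obtain k l where kl: "k \<in> K" "l \<in> K" "r = g k" "s = g l" by blast
    have "k b = l b" if "b \<in> bs" for b
    proof -
      have "c dvd k b - l b" using d that unfolding kl gdiff mem by blast
      moreover have "k b \<in> {0..<c}" "l b \<in> {0..<c}" using kl that by (auto simp: K_def)
      ultimately show ?thesis by (metis atLeastLessThan_iff mod_eq_dvd_iff mod_pos_pos_trivial)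
    qed
    then show "r = s" using kl gcong by blast
  qed
  moreover have "card (g ` K) = nat c ^ CARD('n)"
    using bs by (simp add: card_image[OF inj]) (simp add: K_def card_PiE)
  moreover have "finite (g ` K)" unfolding K_def using bs by (intro finite_imageI finite_PiE) auto
  ultimately show ?thesis by (rule that)
qed

section \<open>Positive definite forms: orthogonal systems and duality\<close>

locale pd_form =
  fixes B :: "real ^ 'n \<Rightarrow> real ^ 'n \<Rightarrow> real"
  assumes pd: "pos_def_inner_product B"
begin

lemma bil: "bilinear B" and B_sym: "B x y = B y x" and B_pos: "x \<noteq> 0 \<Longrightarrow> B x x > 0"
  using pd unfolding pos_def_inner_product_def by blast+

lemma lin_left: "linear (\<lambda>x. B x y)" and lin_right: "linear (B x)"
  using bil by (auto simp: bilinear_def)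

lemmas B_simps [simp] =
  linear_add[OF lin_left] linear_add[OF lin_right] linear_diff[OF lin_left] linear_diff[OF lin_right]
  linear_cmul[OF lin_left] linear_cmul[OF lin_right] linear_0[OF lin_left] linear_0[OF lin_right]
  linear_neg[OF lin_left] linear_neg[OF lin_right] linear_sum[OF lin_left] linear_sum[OF lin_right]

lemma quad_0 [simp]: "quad B 0 = 0" by (simp add: quad_def)
lemma quad_add: "quad B (x + y) = quad B x + B x y + quad B y"
  using B_sym[of x y] by (simp add: quad_def field_simps)
lemma quad_scale: "quad B (c *\<^sub>R x) = c\<^sup>2 * quad B x" by (simp add: quad_def power2_eq_square)
lemma quad_minus [simp]: "quad B (- x) = quad B x" by (simp add: quad_def)
lemma quad_pos: "x \<noteq> 0 \<Longrightarrow> quad B x > 0" using B_pos[of x] by (auto simp: quad_def)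

text \<open>The map \<open>T\<close> sending y to its products with the standard basis is injective
  by definiteness, hence surjective by dimension. The lemma produces the dual basis in
  \<open>dual_dual\<close>.\<close>

lemma riesz:
  assumes "linear f"
  shows "\<exists>y. \<forall>x. f x = B x y"
proof -
  define T where "T y = (\<chi> i. B (axis i 1) y)" for y
  have ex: "x = (\<Sum>i\<in>UNIV. x $ i *\<^sub>R axis i 1)" for x :: "real ^ 'n"
    by (simp add: vec_eq_iff axis_def if_distrib[of "\<lambda>z. _ * z"] cong: if_cong)
  have linT: "linear T" by (rule linearI) (simp_all add: T_def vec_eq_iff)
  have BT: "B x y = (\<Sum>i\<in>UNIV. x $ i * T y $ i)" for x y
    by (subst ex[of x]) (simp add: T_def)
  have "inj T"
  proof (subst linear_injective_0[OF linT], intro allI impI)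
    fix y assume "T y = 0"
    then have "B y y = 0" unfolding BT by simp
    then show "y = 0" using B_pos[of y] by fastforce
  qed
  then have "surj T" using linT linear_injective_imp_surjective by blast
  then obtain y where y: "T y = (\<chi> i. f (axis i 1))" by (metis surjD)
  have "f x = B x y" for x
  proof -
    have "f x = f (\<Sum>i\<in>UNIV. x $ i *\<^sub>R axis i 1)" using ex[of x] by simp
    also have "\<dots> = (\<Sum>i\<in>UNIV. x $ i * f (axis i 1))" by (simp add: linear_sum[OF assms] linear_cmul[OF assms])
    finally show ?thesis unfolding BT y by simp
  qed
  then show ?thesis by blast
qed

text \<open>Orthogonal, not orthonormal: the vectors are to lie in a lattice, where they cannot be
  normalised. The cardinality condition makes the set a basis.\<close>

definition orthset :: "(real ^ 'n) set \<Rightarrow> bool" where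
  "orthset S \<longleftrightarrow> finite S \<and> card S = CARD('n) \<and> (\<forall>v\<in>S. v \<noteq> 0) \<and> (\<forall>v\<in>S. \<forall>w\<in>S. v \<noteq> w \<longrightarrow> B v w = 0)"

lemma B_orth_sum:
  assumes "finite S" "\<forall>v\<in>S. \<forall>w\<in>S. v \<noteq> w \<longrightarrow> B v w = 0" "w \<in> S"
  shows "B (\<Sum>v\<in>S. f v *\<^sub>R v) w = f w * B w w"
proof -
  have "B (\<Sum>v\<in>S. f v *\<^sub>R v) w = (\<Sum>v\<in>S. f v * B v w)" by simp
  also have "\<dots> = (\<Sum>v\<in>S. if v = w then f w * B w w else 0)" using assms by (intro sum.cong) auto
  finally show ?thesis using assms by simp
qed

lemma orth_independent:
  assumes "finite S" "\<forall>v\<in>S. v \<noteq> 0" "\<forall>v\<in>S. \<forall>w\<in>S. v \<noteq> w \<longrightarrow> B v w = 0"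
  shows "independent S"
proof (rule independent_if_scalars_zero[OF assms(1)])
  fix f w assume "(\<Sum>x\<in>S. f x *\<^sub>R x) = 0" "w \<in> S"
  then have "f w * B w w = 0" using B_orth_sum[OF assms(1,3), of w f] by simp
  then show "f w = 0" using assms(2) B_pos[of w] \<open>w \<in> S\<close> by force
qed

lemma orthset_basis:
  assumes "orthset S"
  shows "independent S" "span S = UNIV" "finite S" "card S = CARD('n)"
proof -
  show i: "independent S" using orth_independent assms by (auto simp: orthset_def)
  show f: "finite S" "card S = CARD('n)" using assms by (auto simp: orthset_def)
  show "span S = UNIV" using card_ge_dim_independent[of S UNIV] i f by auto
qed

lemma orthset_expand:
  assumes "orthset S"
  shows "x = (\<Sum>v\<in>S. (B x v / B v v) *\<^sub>R v)"
proof -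
  note S = orthset_basis[OF assms]
  have "x \<in> span S" using S by simp
  then obtain f where f: "x = (\<Sum>v\<in>S. f v *\<^sub>R v)" using span_finite[OF S(3)] by auto
  have "B x w / B w w = f w" if "w \<in> S" for w
    using B_orth_sum[of S w f] that assms B_pos[of w] unfolding f orthset_def by auto
  then have "(\<Sum>v\<in>S. (B x v / B v v) *\<^sub>R v) = (\<Sum>v\<in>S. f v *\<^sub>R v)" by (intro sum.cong) auto
  then show ?thesis using f by simp
qed

lemma orthset_parseval:
  assumes "orthset S"
  shows "B x y = (\<Sum>v\<in>S. B x v * B y v / B v v)"
proof -
  have "B x y = B (\<Sum>v\<in>S. (B x v / B v v) *\<^sub>R v) y" using orthset_expand[OF assms, of x] by simp
  also have "\<dots> = (\<Sum>v\<in>S. B x v / B v v * B v y)" by simp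
  also have "\<dots> = (\<Sum>v\<in>S. B x v * B y v / B v v)" by (intro sum.cong refl) (simp add: B_sym[of _ y])
  finally show ?thesis .
qed

lemma zspan_orthset_iff:
  assumes "orthset S"
  shows "x \<in> zspan S \<longleftrightarrow> (\<forall>v\<in>S. B x v / B v v \<in> \<int>)"
proof
  assume "x \<in> zspan S"
  then obtain k :: "_ \<Rightarrow> int" where k: "x = (\<Sum>v\<in>S. of_int (k v) *\<^sub>R v)" unfolding zspan_def by blast
  have "B x w / B w w = of_int (k w)" if "w \<in> S" for w
    using B_orth_sum[of S w "\<lambda>v. of_int (k v)"] that assms B_pos[of w] unfolding k orthset_def by auto
  then show "\<forall>v\<in>S. B x v / B v v \<in> \<int>" by simp
next
  assume r: "\<forall>v\<in>S. B x v / B v v \<in> \<int>"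
  have "x = (\<Sum>v\<in>S. (B x v / B v v) *\<^sub>R v)" by (rule orthset_expand[OF assms])
  also have "\<dots> = (\<Sum>v\<in>S. of_int \<lfloor>B x v / B v v\<rfloor> *\<^sub>R v)"
    by (intro sum.cong) (use r in \<open>auto elim!: Ints_cases\<close>)
  finally show "x \<in> zspan S" unfolding zspan_def mem_Collect_eq by (intro exI[of _ "\<lambda>v. \<lfloor>B x v / B v v\<rfloor>"]) simp
qed

lemma subgrp_dual: "subgrp (dual_lattice B M)"
  unfolding subgrp_def dual_lattice_def by auto

lemma dual_zspan: "finite S \<Longrightarrow> x \<in> dual_lattice B (zspan S) \<longleftrightarrow> (\<forall>v\<in>S. B x v \<in> \<int>)"
  using zspan_superset[of S] by (auto simp: dual_lattice_def zspan_def intro!: Ints_sum Ints_mult)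

lemma dual_antimono: "M \<subseteq> M' \<Longrightarrow> dual_lattice B M' \<subseteq> dual_lattice B M"
  by (auto simp: dual_lattice_def)

text \<open>The basis dual to an orthogonal basis is a rescaling of it. Hence the dual of an
  orthogonal lattice is again orthogonal, and summability over dual lattices reduces to the same
  product argument.\<close>

definition dual_orth :: "(real ^ 'n) set \<Rightarrow> (real ^ 'n) set" where
  "dual_orth S = (\<lambda>v. (1 / B v v) *\<^sub>R v) ` S"

lemma dual_orth_inj:
  assumes "orthset S"
  shows "inj_on (\<lambda>v. (1 / B v v) *\<^sub>R v) S"
proof (rule inj_onI, rule ccontr)
  fix v w assume vw: "v \<in> S" "w \<in> S" "(1 / B v v) *\<^sub>R v = (1 / B w w) *\<^sub>R w" "v \<noteq> w"
  have "B ((1 / B v v) *\<^sub>R v) v = B ((1 / B w w) *\<^sub>R w) v" using vw(3) by simp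
  moreover have "B w v = 0" "B v v > 0" using vw assms B_pos[of v] by (auto simp: orthset_def)
  ultimately show False by simp
qed

lemma orthset_dual_orth:
  assumes "orthset S"
  shows "orthset (dual_orth S)" "zspan (dual_orth S) = dual_lattice B (zspan S)"
proof -
  have pos: "B v v > 0" if "v \<in> S" for v using assms B_pos that by (auto simp: orthset_def)
  show o: "orthset (dual_orth S)"
    unfolding orthset_def dual_orth_def
    using assms pos card_image[OF dual_orth_inj[OF assms]] by (fastforce simp: orthset_def)
  have "x \<in> zspan (dual_orth S) \<longleftrightarrow> x \<in> dual_lattice B (zspan S)" for x
  proof -
    have "B x ((1 / B v v) *\<^sub>R v) / B ((1 / B v v) *\<^sub>R v) ((1 / B v v) *\<^sub>R v) = B x v" if "v \<in> S" for v
      using pos[OF that] by (simp add: field_simps)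
    then show ?thesis
      unfolding zspan_orthset_iff[OF o] dual_zspan[OF orthset_basis(3)[OF assms]] by (simp add: dual_orth_def)
  qed
  then show "zspan (dual_orth S) = dual_lattice B (zspan S)" by blast
qed

text \<open>Each coordinate functional of a basis is the product with some vector by
  \<open>riesz\<close>, and that vector lies in the dual lattice; an element of the bidual therefore
  has integral coordinates.\<close>

lemma dual_dual:
  assumes "is_lattice M"
  shows "dual_lattice B (dual_lattice B M) = M"
proof (intro equalityI subsetI)
  fix x assume "x \<in> M"
  then show "x \<in> dual_lattice B (dual_lattice B M)" by (auto simp: dual_lattice_def B_sym[of x])
next
  fix x assume x: "x \<in> dual_lattice B (dual_lattice B M)"
  obtain bs where bs: "independent bs" "span bs = UNIV" "finite bs" "card bs = CARD('n)" "M = zspan bs"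
    using is_lattice_basis[OF assms] .
  have "representation bs x b \<in> \<int>" if b: "b \<in> bs" for b
  proof -
    have "linear (\<lambda>x. representation bs x b)"
      by (rule linearI) (use bs in \<open>auto simp: representation_add representation_scale\<close>)
    then obtain y where y: "\<And>x. representation bs x b = B x y" using riesz by blast
    have "y \<in> dual_lattice B M"
      unfolding dual_lattice_def using zspan_basis_iff[OF bs(1-3)] bs(5) b by (auto simp: B_sym[of y] y[symmetric])
    then show ?thesis using x y by (auto simp: dual_lattice_def)
  qed
  then show "x \<in> M" unfolding bs(5) zspan_basis_iff[OF bs(1-3)] by blast
qed

end

lemma of_int_divide_in_Ints_iff:
  assumes "c \<noteq> 0"
  shows "(of_int m / of_int c :: real) \<in> \<int> \<longleftrightarrow> c dvd m"
proof
  assume "(of_int m / of_int c :: real) \<in> \<int>"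
  then obtain k where "(of_int m / of_int c :: real) = of_int k" by (rule Ints_cases)
  then have "(of_int m :: real) = of_int (c * k)" using assms by (simp add: field_simps)
  then show "c dvd m" by (simp only: of_int_eq_iff) simp
next
  assume "c dvd m"
  then show "(of_int m / of_int c :: real) \<in> \<int>" using assms by (auto elim!: dvdE)
qed

section \<open>Even lattices: dual, level and discriminant\<close>

locale int_lattice = pd_form B for B :: "real ^ 'n \<Rightarrow> real ^ 'n \<Rightarrow> real" +
  fixes L :: "(real ^ 'n) set"
  assumes lat: "is_lattice L" and evenL: "even_integral B L"
begin

abbreviation Ld :: "(real ^ 'n) set" where "Ld \<equiv> dual_lattice B L"

lemmas subL = lattice_subgrp[OF lat]
lemmas subLd = subgrp_dual[of L]

lemma quad_int: "x \<in> L \<Longrightarrow> quad B x \<in> \<int>"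
  using evenL unfolding even_integral_def by blast

lemma B_int: "x \<in> L \<Longrightarrow> y \<in> L \<Longrightarrow> B x y \<in> \<int>"
  using quad_int[of x] quad_int[of y] quad_int[of "x + y"] subgrpD(4)[OF subL, of x y] quad_add[of x y]
  by (metis Ints_diff add_diff_cancel_left' add_diff_cancel_right')

lemma L_sub_Ld: "L \<subseteq> Ld"
  using B_int by (auto simp: dual_lattice_def)

lemma B_dual_int: "x \<in> Ld \<Longrightarrow> y \<in> L \<Longrightarrow> B x y \<in> \<int>" "x \<in> Ld \<Longrightarrow> y \<in> L \<Longrightarrow> B y x \<in> \<int>"
  by (auto simp: dual_lattice_def B_sym[of y])

text \<open>An integral multiple of the projection onto the orthogonal complement of \<open>S\<close>.\<close>

definition orth_proj :: "(real ^ 'n) set \<Rightarrow> real ^ 'n \<Rightarrow> real ^ 'n" where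
  "orth_proj S y = (\<Prod>v\<in>S. B v v) *\<^sub>R y - (\<Sum>v\<in>S. ((\<Prod>w\<in>S - {v}. B w w) * B y v) *\<^sub>R v)"

lemma orth_proj_in_L:
  assumes "S \<subseteq> L" "y \<in> L"
  shows "orth_proj S y \<in> L"
proof -
  have "(\<Prod>w\<in>T. B w w) \<in> \<int>" if "T \<subseteq> S" for T using B_int assms(1) that by (intro Ints_prod) blast
  note p = this
  have sc: "a *\<^sub>R x \<in> L" if "a \<in> \<int>" "x \<in> L" for a x
    using that subgrp_of_int_scale[OF subL] by (auto elim!: Ints_cases)
  show ?thesis unfolding orth_proj_def
    by (intro subgrpD(2)[OF subL] subgrp_sum[OF subL] sc p Ints_mult B_int) (use assms in auto)
qed

lemma orth_proj_orth:
  assumes "finite S" "\<forall>v\<in>S. \<forall>w\<in>S. v \<noteq> w \<longrightarrow> B v w = 0" "v \<in> S"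
  shows "B (orth_proj S y) v = 0"
proof -
  have "B (orth_proj S y) v = (\<Prod>v\<in>S. B v v) * B y v - ((\<Prod>w\<in>S - {v}. B w w) * B y v) * B v v"
    unfolding orth_proj_def using B_orth_sum[OF assms, of "\<lambda>v. (\<Prod>w\<in>S - {v}. B w w) * B y v"] by simp
  also have "(\<Prod>v\<in>S. B v v) = B v v * (\<Prod>w\<in>S - {v}. B w w)" using assms by (simp add: prod.remove)
  finally show ?thesis by simp
qed

text \<open>Gram-Schmidt without division. The predicate \<open>good\<close> is a parameter so that
  the same induction gives an orthogonal basis of nonzero vectors and one with norms prime to
  p.\<close>

lemma orth_extend:
  assumes step: "\<And>S. S \<subseteq> L \<Longrightarrow> finite S \<Longrightarrow> card S < CARD('n) \<Longrightarrow> \<forall>v\<in>S. \<forall>w\<in>S. v \<noteq> w \<longrightarrow> B v w = 0 \<Longrightarrow>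
      \<forall>v\<in>S. good v \<Longrightarrow> \<exists>y\<in>L. good (orth_proj S y)"
    and good0: "\<And>v. good v \<Longrightarrow> v \<noteq> 0"
  obtains S where "orthset S" "S \<subseteq> L" "\<forall>v\<in>S. good v"
proof -
  have "\<exists>S. finite S \<and> card S = m \<and> S \<subseteq> L \<and> (\<forall>v\<in>S. \<forall>w\<in>S. v \<noteq> w \<longrightarrow> B v w = 0) \<and> (\<forall>v\<in>S. good v)"
    if "m \<le> CARD('n)" for m
    using that
  proof (induction m)
    case 0
    show ?case by (rule exI[of _ "{}"]) auto
  next
    case (Suc m)
    then obtain S where S: "finite S" "card S = m" "S \<subseteq> L" "\<forall>v\<in>S. \<forall>w\<in>S. v \<noteq> w \<longrightarrow> B v w = 0" "\<forall>v\<in>S. good v"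
      by auto
    then obtain y where y: "y \<in> L" "good (orth_proj S y)" using step[of S] Suc.prems by auto
    have o: "B (orth_proj S y) v = 0" if "v \<in> S" for v using orth_proj_orth[OF S(1,4) that] .
    have "orth_proj S y \<notin> S" using o[of "orth_proj S y"] good0[OF y(2)] B_pos[of "orth_proj S y"] by force
    then have 1: "card (insert (orth_proj S y) S) = Suc m" using S by simp
    have 2: "\<forall>v\<in>insert (orth_proj S y) S. \<forall>w\<in>insert (orth_proj S y) S. v \<noteq> w \<longrightarrow> B v w = 0"
      using S(4) o B_sym by (metis insert_iff)
    show ?case
      by (rule exI[of _ "insert (orth_proj S y) S"]) (intro conjI 1 2, use S y orth_proj_in_L[OF S(3) y(1)] in auto)
  qed
  from this[of "CARD('n)"] obtain S where S: "finite S" "card S = CARD('n)" "S \<subseteq> L" "\<forall>v\<in>S. \<forall>w\<in>S. v \<noteq> w \<longrightarrow> B v w = 0" "\<forall>v\<in>S. good v"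
    by auto
  then have "orthset S" unfolding orthset_def using good0 by blast
  then show ?thesis using S that by blast
qed

text \<open>Here \<open>good\<close> means nonzero: a basis vector outside the span of
  \<open>S\<close> has a nonzero projection, and such a vector exists as long as \<open>S\<close> is
  too small.\<close>

lemma orth_sublattice:
  obtains S where "orthset S" "S \<subseteq> L"
proof -
  obtain bs where bs: "independent bs" "span bs = UNIV" "finite bs" "card bs = CARD('n)" "L = zspan bs"
    using is_lattice_basis[OF lat] .
  obtain S where "orthset S" "S \<subseteq> L" "\<forall>v\<in>S. v \<noteq> 0"
  proof (rule orth_extend[of "\<lambda>v. v \<noteq> 0"])
    fix S assume S: "S \<subseteq> L" "finite S" "card S < CARD('n)" "\<forall>v\<in>S. \<forall>w\<in>S. v \<noteq> w \<longrightarrow> B v w = 0" "\<forall>v\<in>S. v \<noteq> 0"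
    have "\<not> bs \<subseteq> span S"
    proof
      assume "bs \<subseteq> span S"
      then have "card bs \<le> card S" using independent_card_le_dim[of bs "span S"] bs(1) dim_le_card'[OF S(2)] by simp
      then show False using bs S by simp
    qed
    then obtain y where y: "y \<in> bs" "y \<notin> span S" by blast
    have "y \<in> L" using y bs zspan_superset by blast
    moreover have "orth_proj S y \<noteq> 0"
    proof
      assume "orth_proj S y = 0"
      then have "(\<Prod>v\<in>S. B v v) *\<^sub>R y = (\<Sum>v\<in>S. ((\<Prod>w\<in>S - {v}. B w w) * B y v) *\<^sub>R v)" by (simp add: orth_proj_def)
      also have "\<dots> \<in> span S" by (intro span_sum span_scale span_base)
      finally have "(\<Prod>v\<in>S. B v v) *\<^sub>R y \<in> span S" .
      moreover have "(\<Prod>v\<in>S. B v v) \<noteq> 0" using S B_pos by (auto simp: prod_zero_iff) force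
      ultimately have "(1 / (\<Prod>v\<in>S. B v v)) *\<^sub>R (\<Prod>v\<in>S. B v v) *\<^sub>R y \<in> span S" "(\<Prod>v\<in>S. B v v) \<noteq> 0"
        using span_scale by blast+
      then show False using y(2) by simp
    qed
    ultimately show "\<exists>y\<in>L. orth_proj S y \<noteq> 0" by blast
  qed auto
  then show ?thesis using that by blast
qed

text \<open>A crude multiple, needed to see that the set whose least element is the level is
  nonempty. The product of the norms of an orthogonal system clears all denominators in the
  coefficients B x v / B v v.\<close>

lemma dual_multiple:
  obtains M :: int where "M > 0" "\<And>x. x \<in> Ld \<Longrightarrow> of_int M *\<^sub>R x \<in> L"
proof -
  obtain S where S: "orthset S" "S \<subseteq> L" by (rule orth_sublattice)
  define E where "E = (\<Prod>v\<in>S. B v v)"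
  have pos: "B v v > 0" if "v \<in> S" for v using S B_pos that by (auto simp: orthset_def)
  have "E \<in> \<int>" unfolding E_def using B_int S by (intro Ints_prod) blast
  moreover have "E > 0" unfolding E_def using pos by (intro prod_pos) auto
  ultimately obtain M where M: "E = of_int M" "M > 0" by (auto elim!: Ints_cases)
  have "of_int M *\<^sub>R x \<in> L" if x: "x \<in> Ld" for x
  proof -
    have "B (E *\<^sub>R x) v / B v v \<in> \<int>" if v: "v \<in> S" for v
    proof -
      have "E = B v v * (\<Prod>w\<in>S - {v}. B w w)" unfolding E_def using v orthset_basis(3)[OF S(1)] by (simp add: prod.remove)
      then have "B (E *\<^sub>R x) v / B v v = (\<Prod>w\<in>S - {v}. B w w) * B x v" using pos[OF v] by simp
      moreover have "(\<Prod>w\<in>S - {v}. B w w) \<in> \<int>" using B_int S by (intro Ints_prod) blast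
      moreover have "B x v \<in> \<int>" using B_dual_int x v S by blast
      ultimately show ?thesis by simp
    qed
    then have "E *\<^sub>R x \<in> zspan S" unfolding zspan_orthset_iff[OF S(1)] by blast
    then show ?thesis using zspan_subset[OF subL S(2)] M by auto
  qed
  then show ?thesis using M that by blast
qed

abbreviation N :: int where "N \<equiv> int (level B L)"

lemma level: "level B L > 0" "x \<in> Ld \<Longrightarrow> of_int N * quad B x \<in> \<int>"
proof -
  obtain M where M: "M > 0" "\<And>x. x \<in> Ld \<Longrightarrow> of_int M *\<^sub>R x \<in> L" by (rule dual_multiple) blast
  have "real (nat (2 * M)) * quad B x \<in> \<int>" if "x \<in> Ld" for x
  proof -
    \<comment> \<open>The factor 2 cancels the half in \<open>quad\<close>.\<close>
    have "real (nat (2 * M)) * quad B x = B x (of_int M *\<^sub>R x)" using M(1) by (simp add: quad_def)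
    then show ?thesis using B_dual_int[OF that M(2)[OF that]] by simp
  qed
  then have "nat (2 * M) > 0 \<and> (\<forall>x\<in>Ld. real (nat (2 * M)) * quad B x \<in> \<int>)" using M(1) by auto
  then have "level B L > 0 \<and> (\<forall>x\<in>Ld. real (level B L) * quad B x \<in> \<int>)"
    unfolding level_def by (rule LeastI)
  then show "level B L > 0" "x \<in> Ld \<Longrightarrow> of_int N * quad B x \<in> \<int>" by auto
qed

lemma level_B: "x \<in> Ld \<Longrightarrow> y \<in> Ld \<Longrightarrow> of_int N * B x y \<in> \<int>"
proof -
  assume a: "x \<in> Ld" "y \<in> Ld"
  have "of_int N * B x y = of_int N * quad B (x + y) - of_int N * quad B x - of_int N * quad B y"
    by (simp add: quad_add algebra_simps)
  moreover have "x + y \<in> Ld" using a subgrpD(4)[OF subLd] by blast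
  ultimately show ?thesis using level(2) a by (metis Ints_diff)
qed

text \<open>N x pairs integrally with the whole dual lattice by \<open>level_B\<close>, and the
  bidual is \<open>L\<close>.\<close>

lemma level_mult: "x \<in> Ld \<Longrightarrow> of_int N *\<^sub>R x \<in> L"
proof -
  assume x: "x \<in> Ld"
  have "of_int N *\<^sub>R x \<in> dual_lattice B Ld"
    unfolding dual_lattice_def[of B Ld] mem_Collect_eq
  proof
    fix y assume "y \<in> Ld"
    then show "B (of_int N *\<^sub>R x) y \<in> \<int>" using level_B[OF x] by simp
  qed
  then show ?thesis using dual_dual[OF lat] by simp
qed

text \<open>\<open>Ld / L\<close> is annihilated by N, so multiplication by c is injective on it;
  the Bezout coefficients spell this out.\<close>

lemma dual_coprime_scale:
  assumes "x \<in> Ld" "of_int c *\<^sub>R x \<in> L" "coprime c N"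
  shows "x \<in> L"
proof -
  obtain u v where "u * c + v * N = 1" using assms(3) by (metis cong_solve_coprime_int bezout_int coprime_iff_gcd_eq_1 coprime_imp_gcd_eq_1)
  then have "of_int u * of_int c + of_int v * of_int N = (1::real)" by (metis of_int_1 of_int_add of_int_mult)
  then have "x = of_int u *\<^sub>R (of_int c *\<^sub>R x) + of_int v *\<^sub>R (of_int N *\<^sub>R x)"
    by (simp add: scaleR_left_distrib[symmetric])
  also have "\<dots> \<in> L" by (intro subgrpD(4)[OF subL] subgrp_of_int_scale[OF subL] assms(2) level_mult assms(1))
  finally show ?thesis .
qed

abbreviation scaled :: "int \<Rightarrow> (real ^ 'n) set" where
  "scaled c \<equiv> (*\<^sub>R) (of_int c) ` L"

text \<open>The form stays nondegenerate modulo any c prime to the level: x / c lies in the dual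
  lattice and its multiple by c in \<open>L\<close>, so x / c itself is in \<open>L\<close>.\<close>

lemma nondegenerate:
  assumes "x \<in> L" "\<And>y. y \<in> L \<Longrightarrow> B x y / of_int c \<in> \<int>" "coprime c N" "c > 0"
  shows "x \<in> scaled c"
proof -
  have "(1 / of_int c) *\<^sub>R x \<in> Ld" using assms(2) by (simp add: dual_lattice_def)
  moreover have "of_int c *\<^sub>R ((1 / of_int c) *\<^sub>R x) \<in> L" using assms by simp
  ultimately have "(1 / of_int c) *\<^sub>R x \<in> L" using assms(3) dual_coprime_scale by blast
  moreover have "x = of_int c *\<^sub>R ((1 / of_int c) *\<^sub>R x)" using assms(4) by simp
  ultimately show ?thesis by blast
qed

text \<open>The dual lattice lies between \<open>L\<close> and (1/N) L, whose quotient has order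
  N^n. Hence D is finite and divides N^n, so a number prime to N is prime to D.\<close>

lemma transversal_dual:
  obtains R where "transversal R Ld L" "finite R" "card R = disc B L" "disc B L dvd level B L ^ CARD('n)"
proof -
  let ?N = "(of_int N :: real)"
  have N0: "?N \<noteq> 0" "N > 0" using level(1) by auto
  obtain R0 where R0: "transversal R0 L ((*\<^sub>R) ?N ` L)" "card R0 = nat N ^ CARD('n)" "finite R0"
    using lattice_transversal_scaled[OF lat N0(2)] .
  define X where "X = (*\<^sub>R) (1 / ?N) ` L"
  have LX: "(*\<^sub>R) (1 / ?N) ` ((*\<^sub>R) ?N ` L) = L" using N0 by (simp add: image_image)
  have T: "transversal ((*\<^sub>R) (1 / ?N) ` R0) X L"
    using transversal_scaled[OF R0(1), of "1 / ?N"] N0 unfolding LX X_def by simp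
  have sX: "subgrp X" unfolding X_def by (rule subgrp_scaled[OF subL])
  have LdX: "Ld \<subseteq> X"
  proof
    fix x assume "x \<in> Ld"
    then have "(1 / ?N) *\<^sub>R (?N *\<^sub>R x) \<in> X" unfolding X_def using level_mult by blast
    then show "x \<in> X" using N0 by simp
  qed
  obtain R where R: "transversal R Ld L" using transversal_exists[OF subL] .
  have finR: "finite R" by (rule transversal_finite_subset[OF subL R T LdX]) (use R0 in simp)
  obtain R2 where R2: "transversal R2 X Ld" using transversal_exists[OF subLd] .
  have "disc B L = card R" unfolding disc_def by (rule transversal_quotient_card[OF subL R])
  moreover have "card R dvd level B L ^ CARD('n)"
  proof -
    note P = transversal_prod[OF subL subLd sX L_sub_Ld LdX R R2]
    have "card ((*\<^sub>R) (1 / ?N) ` R0) = card ((\<lambda>(r, s). r + s) ` (R \<times> R2))"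
      by (rule transversal_card_eq(1)[OF subL T P(1)])
    moreover have "card ((*\<^sub>R) (1 / ?N) ` R0) = card R0" using N0 by (intro card_image) (auto intro!: inj_onI)
    ultimately have "card R0 = card R * card R2" by (simp add: card_image[OF P(2)] card_cartesian_product)
    then show ?thesis using R0(2) by simp
  qed
  ultimately show ?thesis using that[OF R finR] by simp
qed

lemma disc_pos: "disc B L > 0"
proof -
  obtain R where "transversal R Ld L" "finite R" "card R = disc B L" "disc B L dvd level B L ^ CARD('n)" by (rule transversal_dual)
  then show ?thesis using level(1) by (metis dvd_0_left_iff gr0I not_gr_zero power_not_zero)
qed

lemma coprime_disc: "coprime c N \<Longrightarrow> coprime c (int (disc B L))"
proof -
  assume c: "coprime c N"
  obtain R where "disc B L dvd level B L ^ CARD('n)" by (rule transversal_dual)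
  then have "int (disc B L) dvd N ^ CARD('n)" by (metis of_nat_dvd_iff of_nat_power)
  then show ?thesis using c by (meson coprime_divisors coprime_power_right_iff dvd_refl)
qed

text \<open>Suppose that no projection has norm prime to p. Polarisation, with p odd, makes all
  products of projections divisible by p, and nondegeneracy places the projections in
  \<open>p L\<close>. Then fewer than n vectors generate \<open>L\<close> modulo p, against the
  order p^n of \<open>L / p L\<close>.\<close>

lemma orth_sublattice_prime:
  fixes p :: int
  assumes p: "prime p" "odd p" "coprime p N"
  obtains S where "orthset S" "S \<subseteq> L" "\<forall>v\<in>S. B v v / of_int p \<notin> \<int>"
proof (rule orth_extend[of "\<lambda>v. B v v / of_int p \<notin> \<int>"])
  have p0: "p > 1" "(of_int p :: real) > 0" using p prime_gt_1_int[of p] by auto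
  have ediv: "a * b / of_int p \<in> \<int> \<Longrightarrow> a / of_int p \<in> \<int> \<or> b / of_int p \<in> \<int>" if ab: "a \<in> \<int>" "b \<in> \<int>" for a b :: real
  proof -
    obtain k where k: "a = of_int k" using ab(1) by (rule Ints_cases)
    obtain l where l: "b = of_int l" using ab(2) by (rule Ints_cases)
    note kl = k l
    have iff: "of_int m / of_int p \<in> (\<int> :: real set) \<longleftrightarrow> p dvd m" for m
      by (rule of_int_divide_in_Ints_iff) (use p0 in auto)
    show "a * b / of_int p \<in> \<int> \<Longrightarrow> ?thesis" using iff[of "k * l"] iff[of k] iff[of l] prime_dvd_mult_iff[OF p(1), of k l] unfolding kl
      by simp
  qed
  fix S assume S: "S \<subseteq> L" "finite S" "card S < CARD('n)" and o: "\<forall>v\<in>S. \<forall>w\<in>S. v \<noteq> w \<longrightarrow> B v w = 0" 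
    and g: "\<forall>v\<in>S. B v v / of_int p \<notin> \<int>"
  define E where "E = (\<Prod>v\<in>S. B v v)"
  have Ez: "E \<in> \<int>" unfolding E_def using S B_int by (intro Ints_prod) blast
  have Ep: "E / of_int p \<notin> \<int>"
  proof -
    have "T \<subseteq> S \<Longrightarrow> (\<Prod>v\<in>T. B v v) / of_int p \<notin> \<int> \<and> (\<Prod>v\<in>T. B v v) \<in> \<int>" for T
    proof (induction T rule: infinite_finite_induct)
      case (infinite T) then show ?case using S finite_subset by blast
    next
      case empty
      have "\<not> p dvd 1" using p0 by (simp add: zdvd1_eq)
      then have "(1::real) / of_int p \<notin> \<int>" using of_int_divide_in_Ints_iff[of p 1] p0 by simp
      then show ?case by simp
    next
      case (insert v T)
      then show ?case using ediv[of "B v v" "\<Prod>v\<in>T. B v v"] g B_int[of v v] S by (auto intro: Ints_mult)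
    qed
    then show ?thesis by (auto simp: E_def)
  qed
  show "\<exists>y\<in>L. B (orth_proj S y) (orth_proj S y) / of_int p \<notin> \<int>"
  proof (rule ccontr)
    assume "\<not> ?thesis"
    then have all: "B (orth_proj S y) (orth_proj S y) / of_int p \<in> \<int>" if "y \<in> L" for y using that by blast
    have add: "orth_proj S (x + y) = orth_proj S x + orth_proj S y" for x y
      by (simp add: orth_proj_def algebra_simps sum.distrib)
    have projB: "B (orth_proj S x) (orth_proj S y) = E * B (orth_proj S x) y" for x y
    proof -
      have "B (orth_proj S x) (orth_proj S y) = E * B (orth_proj S x) y - (\<Sum>v\<in>S. ((\<Prod>w\<in>S - {v}. B w w) * B y v) * B (orth_proj S x) v)"
        by (subst (2) orth_proj_def) (simp add: E_def)
      also have "(\<Sum>v\<in>S. ((\<Prod>w\<in>S - {v}. B w w) * B y v) * B (orth_proj S x) v) = 0"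
        using orth_proj_orth[OF S(2) o] by (intro sum.neutral) auto
      finally show ?thesis by simp
    qed
    have two: "of_int 2 / of_int p \<notin> (\<int> :: real set)"
    proof
      assume "of_int 2 / of_int p \<in> (\<int> :: real set)"
      then have "p dvd 2" using of_int_divide_in_Ints_iff[of p 2] p0 by simp
      then have "p \<le> 2" by (rule zdvd_imp_le) simp
      then have "p = 2" using p0 by simp
      then show False using p(2) by simp
    qed
    \<comment> \<open>Otherwise \<open>S\<close> would generate \<open>L / p L\<close>, which has too many elements.\<close>
    have step1: "B (orth_proj S x) y / of_int p \<in> \<int>" if xy: "x \<in> L" "y \<in> L" for x y
    proof -
      have pl: "orth_proj S x \<in> L" "orth_proj S y \<in> L" using orth_proj_in_L S xy by auto
      have bi: "B (orth_proj S x) (orth_proj S y) \<in> \<int>" "B (orth_proj S x) y \<in> \<int>" using B_int pl xy by auto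
      have "B (orth_proj S (x + y)) (orth_proj S (x + y)) = B (orth_proj S x) (orth_proj S x) + of_int 2 * B (orth_proj S x) (orth_proj S y) + B (orth_proj S y) (orth_proj S y)"
        by (simp add: add B_sym[of "orth_proj S y" "orth_proj S x"])
      then have "of_int 2 * B (orth_proj S x) (orth_proj S y) / of_int p = B (orth_proj S (x + y)) (orth_proj S (x + y)) / of_int p
         - B (orth_proj S x) (orth_proj S x) / of_int p - B (orth_proj S y) (orth_proj S y) / of_int p"
        by (simp add: add_divide_distrib)
      also have "\<dots> \<in> \<int>" using all xy subgrpD(4)[OF subL] by (intro Ints_diff) auto
      finally have "B (orth_proj S x) (orth_proj S y) / of_int p \<in> \<int>" using ediv[OF _ bi(1), of "of_int 2"] two by auto
      then show ?thesis using ediv[OF Ez bi(2)] Ep unfolding projB by blast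
    qed
    \<comment> \<open>By \<open>step1\<close> the projection pairs to 0 modulo p with all of
      \<open>L\<close>.\<close>
    have step2: "orth_proj S x \<in> scaled p" if "x \<in> L" for x
      by (rule nondegenerate) (use step1 that orth_proj_in_L S p p0 in auto)
    obtain E' where E': "E = of_int E'" using Ez by (auto elim: Ints_cases)
    have "coprime E' p"
    proof -
      have "\<not> p dvd E'" using Ep p0 of_int_divide_in_Ints_iff[of p E'] unfolding E' by simp
      then show ?thesis using p(1) by (metis coprime_commute prime_imp_coprime)
    qed
    then obtain u v where uv: "u * E' + v * p = 1" by (metis bezout_int coprime_imp_gcd_eq_1)
    \<comment> \<open>The projection is E x minus an integral combination of \<open>S\<close>. As E
      is invertible modulo p, x itself is congruent to an integral combination of
      \<open>S\<close>.\<close>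
    have step3: "\<exists>k. x - (\<Sum>v\<in>S. of_int (k v) *\<^sub>R v) \<in> scaled p" if x: "x \<in> L" for x
    proof -
      obtain l where l: "l \<in> L" "orth_proj S x = of_int p *\<^sub>R l" using step2[OF x] by blast
      have "\<exists>k. (\<Prod>w\<in>S - {v}. B w w) * B x v = of_int k" if "v \<in> S" for v
      proof -
        have "(\<Prod>w\<in>S - {v}. B w w) * B x v \<in> \<int>" using S B_int x that by (intro Ints_mult Ints_prod) auto
        then show ?thesis by (auto elim: Ints_cases)
      qed
      then obtain k where k: "\<And>v. v \<in> S \<Longrightarrow> (\<Prod>w\<in>S - {v}. B w w) * B x v = of_int (k v)" by metis
      have "E *\<^sub>R x = of_int p *\<^sub>R l + (\<Sum>v\<in>S. of_int (k v) *\<^sub>R v)"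
        using l(2) k unfolding orth_proj_def E_def by (simp add: algebra_simps)
      then have Ex: "of_int E' *\<^sub>R x = of_int p *\<^sub>R l + (\<Sum>v\<in>S. of_int (k v) *\<^sub>R v)" unfolding E' .
      have "x = of_int (u * E' + v * p) *\<^sub>R x" unfolding uv by simp
      also have "\<dots> = of_int u *\<^sub>R (of_int E' *\<^sub>R x) + of_int p *\<^sub>R (of_int v *\<^sub>R x)"
        by (simp add: scaleR_left_distrib mult.commute)
      also have "\<dots> = of_int p *\<^sub>R (of_int u *\<^sub>R l + of_int v *\<^sub>R x) + (\<Sum>w\<in>S. of_int (u * k w) *\<^sub>R w)"
        unfolding Ex by (simp add: scaleR_right_distrib scaleR_sum_right mult.commute)
      finally have xx: "x = of_int p *\<^sub>R (of_int u *\<^sub>R l + of_int v *\<^sub>R x) + (\<Sum>w\<in>S. of_int (u * k w) *\<^sub>R w)" .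
      have "x - (\<Sum>w\<in>S. of_int (u * k w) *\<^sub>R w) = of_int p *\<^sub>R (of_int u *\<^sub>R l + of_int v *\<^sub>R x)"
        by (subst diff_eq_eq) (rule xx)
      moreover have "of_int u *\<^sub>R l + of_int v *\<^sub>R x \<in> L"
        by (intro subgrpD(4)[OF subL] subgrp_of_int_scale[OF subL] l x)
      ultimately show ?thesis by (intro exI[of _ "\<lambda>w. u * k w"]) blast
    qed
    obtain R where R: "transversal R L (scaled p)" "card R = nat p ^ CARD('n)" "finite R"
      using lattice_transversal_scaled[OF lat, of p] p0 by auto
    have spL: "subgrp (scaled p)" by (rule subgrp_scaled[OF subL])
    define g where "g k = (\<Sum>v\<in>S. of_int (k v) *\<^sub>R v)" for k :: "real ^ 'n \<Rightarrow> int"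
    have "\<exists>k. k \<in> PiE S (\<lambda>_. {0..<p}) \<and> r - g k \<in> scaled p" if rR: "r \<in> R" for r
    proof -
      obtain k where k: "r - g k \<in> scaled p" using step3 transversalD(1)[OF R(1) rR] unfolding g_def by blast
      let ?k = "restrict (\<lambda>v. k v mod p) S"
      have "g k - g ?k = of_int p *\<^sub>R (\<Sum>v\<in>S. of_int (k v div p) *\<^sub>R v)"
      proof -
        have "of_int (k v) - of_int (k v mod p) = (of_int p * of_int (k v div p) :: real)" for v
          by (metis minus_mod_eq_mult_div of_int_diff of_int_mult)
        then show ?thesis unfolding g_def 
          by (simp add: sum_subtractf[symmetric] scaleR_left_diff_distrib[symmetric] scaleR_sum_right)
      qed
      moreover have "(\<Sum>v\<in>S. of_int (k v div p) *\<^sub>R v) \<in> L"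
        using S by (intro subgrp_sum[OF subL] subgrp_of_int_scale[OF subL]) auto
      ultimately have "g k - g ?k \<in> scaled p" by blast
      moreover have "r - g ?k = (r - g k) + (g k - g ?k)" by simp
      ultimately have "r - g ?k \<in> scaled p" using k subgrpD(4)[OF spL] by metis
      moreover have "?k \<in> PiE S (\<lambda>_. {0..<p})" using p0 by auto
      ultimately show ?thesis by blast
    qed
    \<comment> \<open>The map \<open>h\<close> to reduced coefficients is injective on
      \<open>L / p L\<close>, but its target has only p^(card S) elements.\<close>
    then obtain h where h: "\<And>r. r \<in> R \<Longrightarrow> h r \<in> PiE S (\<lambda>_. {0..<p}) \<and> r - g (h r) \<in> scaled p" by metis
    have "inj_on h R"
    proof (rule inj_onI)
      fix r s assume rs: "r \<in> R" "s \<in> R" "h r = h s"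
      have "r - s = (r - g (h r)) - (s - g (h s))" using rs by simp
      then have "r - s \<in> scaled p" using h rs subgrpD(2)[OF spL] by metis
      then show "r = s" using transversalD(3)[OF R(1) spL] rs by blast
    qed
    moreover have "h ` R \<subseteq> PiE S (\<lambda>_. {0..<p})" using h by blast
    moreover have "finite (PiE S (\<lambda>_. {0..<p}))" using S by (intro finite_PiE) auto
    ultimately have "card R \<le> card (PiE S (\<lambda>_. {0..<p}))" by (rule card_inj_on_le)
    then have "nat p ^ CARD('n) \<le> nat p ^ card S" using R(2) S(2) by (simp add: card_PiE)
    then show False using S(3) p0 by simp
  qed
next
  fix v :: "real ^ 'n"
  assume "B v v / of_int p \<notin> \<int>" then show "v \<noteq> 0" by auto
qed (use that in blast)

end

section \<open>Poisson summation on lattices\<close>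

lemma summable_on_finite_sum:
  fixes f :: "'i \<Rightarrow> 'a \<Rightarrow> complex"
  assumes "\<And>i. i \<in> I \<Longrightarrow> f i summable_on A"
  shows "(\<lambda>x. \<Sum>i\<in>I. f i x) summable_on A"
  using assms by (induction I rule: infinite_finite_induct) (auto intro: summable_on_add)

lemma infsum_sum_swap:
  fixes f :: "'i \<Rightarrow> 'a \<Rightarrow> complex"
  assumes "finite I" "\<And>i. i \<in> I \<Longrightarrow> f i summable_on A"
  shows "(\<Sum>\<^sub>\<infinity>x\<in>A. \<Sum>i\<in>I. f i x) = (\<Sum>i\<in>I. infsum (f i) A)"
  using assms by (induction I rule: finite_induct) (simp_all add: infsum_add summable_on_finite_sum)

lemma powr_times_of_real:
  fixes z c :: complex and b :: real
  assumes "b > 0" "z \<noteq> 0"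
  shows "(z * of_real b) powr c = z powr c * of_real b powr c"
  using Ln_times_of_real[OF assms] assms by (simp add: powr_def mult.commute[of z] distrib_left exp_add Ln_of_real)

lemma sqrt_prod: "sqrt (prod f S) = (\<Prod>v\<in>S. sqrt (f v))"
  by (induction S rule: infinite_finite_induct) (simp_all add: real_sqrt_mult)

lemma powr_minus_half_power: "(z powr (- 1 / 2)) ^ n = z powr (- (of_nat n / 2))" if "z \<noteq> 0" for z :: complex
  using that by (simp add: powr_def exp_of_nat_mult[symmetric])

lemma cvec_simps [simp]:
  "cvec (x + y) = cvec x + cvec y" "cvec (x - y) = cvec x - cvec y" "cvec (- x) = - cvec x" "cvec (c *\<^sub>R x) = of_real c *s cvec x"
  "cvec 0 = 0"
  by (simp_all add: cvec_def vec_eq_iff)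

section \<open>The complexified form and theta series of orthogonal lattices\<close>

context pd_form
begin

lemma cbilin_simps [simp]:
  "cbilin B (z + z') w = cbilin B z w + cbilin B z' w" "cbilin B w (z + z') = cbilin B w z + cbilin B w z'"
  "cbilin B (z - z') w = cbilin B z w - cbilin B z' w" "cbilin B w (z - z') = cbilin B w z - cbilin B w z'"
  "cbilin B (k *s z) w = k * cbilin B z w" "cbilin B w (k *s z) = k * cbilin B w z"
  "cbilin B (- z) w = - cbilin B z w" "cbilin B w (- z) = - cbilin B w z"
  "cbilin B 0 w = 0" "cbilin B w 0 = 0"
  by (simp_all add: cbilin_def algebra_simps sum.distrib sum_subtractf sum_negf sum_distrib_left)

lemma cbilin_sym: "cbilin B z w = cbilin B w z"
proof -
  have "cbilin B z w = (\<Sum>j\<in>UNIV. \<Sum>i\<in>UNIV. z $ i * w $ j * of_real (B (axis i 1) (axis j 1)))"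
    unfolding cbilin_def by (rule sum.swap)
  also have "\<dots> = cbilin B w z" unfolding cbilin_def by (intro sum.cong refl) (simp add: B_sym mult_ac)
  finally show ?thesis .
qed

lemma cbilin_real [simp]: "cbilin B (cvec x) (cvec y) = of_real (B x y)"
  by (rule cbilin_cvec[OF bil])

lemma cquad_real [simp]: "cquad B (cvec x) = of_real (quad B x)"
  by (rule cquad_cvec[OF bil])

lemma cquad_0 [simp]: "cquad B 0 = 0" by (simp add: cquad_def)

lemma cquad_diff: "cquad B (z - w) = cquad B z - cbilin B z w + cquad B w"
  using cbilin_sym[of z w] by (simp add: cquad_def field_simps)

lemma cquad_add: "cquad B (z + w) = cquad B z + cbilin B z w + cquad B w"
  using cbilin_sym[of z w] by (simp add: cquad_def field_simps)

lemma cquad_scale: "cquad B (k *s z) = k\<^sup>2 * cquad B z"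
  by (simp add: cquad_def power2_eq_square)

lemma complex_vec_split:
  obtains a b where "z = cvec a + \<i> *s cvec b"
proof
  show "z = cvec (\<chi> i. Re (z $ i)) + \<i> *s cvec (\<chi> i. Im (z $ i))"
    by (simp add: vec_eq_iff cvec_def complex_eq_iff)
qed

text \<open>The real Parseval identity is applied to real and imaginary part. Squares occur instead
  of absolute values because the complex extension is bilinear.\<close>

lemma cquad_parseval:
  assumes "orthset S"
  shows "cquad B w = (\<Sum>v\<in>S. (cbilin B (cvec v) w)\<^sup>2 / (2 * of_real (B v v)))"
proof -
  obtain a b where w: "w = cvec a + \<i> *s cvec b" by (rule complex_vec_split)
  have "cquad B w = (of_real (B a a) + 2 * \<i> * of_real (B a b) - of_real (B b b)) / 2"
    unfolding cquad_def w using B_sym[of a b] by (simp add: algebra_simps)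
  also have "\<dots> = (\<Sum>v\<in>S. (of_real (B a v * B a v / B v v) + 2 * \<i> * of_real (B a v * B b v / B v v) - of_real (B b v * B b v / B v v)) / 2)"
    unfolding sum_divide_distrib[symmetric] sum.distrib sum_subtractf sum_distrib_left[symmetric] of_real_sum[symmetric]
      orthset_parseval[OF assms, symmetric] ..
  also have "\<dots> = (\<Sum>v\<in>S. (cbilin B (cvec v) w)\<^sup>2 / (2 * of_real (B v v)))"
  proof (rule sum.cong[OF refl])
    fix v assume v: "v \<in> S"
    have c: "cbilin B (cvec v) w = of_real (B a v) + \<i> * of_real (B b v)" unfolding w by (simp add: B_sym[of v])
    have "(cbilin B (cvec v) w)\<^sup>2 = of_real (B a v * B a v) + 2 * \<i> * of_real (B a v * B b v) - of_real (B b v * B b v)"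
      unfolding c by (simp add: power2_eq_square algebra_simps)
    then show "(of_real (B a v * B a v / B v v) + 2 * \<i> * of_real (B a v * B b v / B v v) - of_real (B b v * B b v / B v v)) / 2
       = (cbilin B (cvec v) w)\<^sup>2 / (2 * of_real (B v v))"
      by (simp add: add_divide_distrib diff_divide_distrib mult.commute)
  qed
  finally show ?thesis .
qed

definition theta_term :: "complex \<Rightarrow> complex ^ 'n \<Rightarrow> real ^ 'n \<Rightarrow> complex" where
  "theta_term \<sigma> \<zeta> v = ee (\<sigma> * of_real (quad B v) + cbilin B (cvec v) \<zeta>)"

lemma zspan_param:
  assumes "orthset S"
  shows "bij_betw (\<lambda>k. \<Sum>v\<in>S. of_int (k v) *\<^sub>R v) (PiE S (\<lambda>_. UNIV :: int set)) (zspan S)"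
  unfolding bij_betw_def
proof
  note S = orthset_basis[OF assms]
  have coeff: "B (\<Sum>v\<in>S. of_int (k v) *\<^sub>R v) w / B w w = of_int (k w)" if "w \<in> S" for k :: "_ \<Rightarrow> int" and w
    using B_orth_sum[of S w "\<lambda>v. of_int (k v)"] that assms B_pos[of w] unfolding orthset_def by auto
  show "inj_on (\<lambda>k. \<Sum>v\<in>S. of_int (k v) *\<^sub>R v) (PiE S (\<lambda>_. UNIV :: int set))"
  proof (rule inj_onI)
    fix k l :: "real ^ 'n \<Rightarrow> int"
    assume kl: "k \<in> PiE S (\<lambda>_. UNIV)" "l \<in> PiE S (\<lambda>_. UNIV)" "(\<Sum>v\<in>S. of_int (k v) *\<^sub>R v) = (\<Sum>v\<in>S. of_int (l v) *\<^sub>R v)"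
    have "k w = l w" if "w \<in> S" for w using coeff[OF that, of k] coeff[OF that, of l] kl(3) by simp
    then show "k = l" by (rule PiE_ext[OF kl(1,2)])
  qed
  show "(\<lambda>k. \<Sum>v\<in>S. of_int (k v) *\<^sub>R v) ` PiE S (\<lambda>_. UNIV :: int set) = zspan S"
  proof (intro equalityI subsetI)
    fix x assume "x \<in> zspan S"
    then obtain k :: "_ \<Rightarrow> int" where k: "x = (\<Sum>v\<in>S. of_int (k v) *\<^sub>R v)" unfolding zspan_def by blast
    have "x = (\<Sum>v\<in>S. of_int (restrict k S v) *\<^sub>R v)" unfolding k by (intro sum.cong) auto
    then show "x \<in> (\<lambda>k. \<Sum>v\<in>S. of_int (k v) *\<^sub>R v) ` PiE S (\<lambda>_. UNIV :: int set)"
      using imageI[of "restrict k S" "PiE S (\<lambda>_. UNIV)" "\<lambda>k. \<Sum>v\<in>S. of_int (k v) *\<^sub>R v"] by simp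
  next
    fix x assume "x \<in> (\<lambda>k. \<Sum>v\<in>S. of_int (k v) *\<^sub>R v) ` PiE S (\<lambda>_. UNIV :: int set)"
    then obtain k :: "real ^ 'n \<Rightarrow> int" where "x = (\<Sum>v\<in>S. of_int (k v) *\<^sub>R v)" by (rule imageE)
    then show "x \<in> zspan S" unfolding zspan_def mem_Collect_eq by (intro exI[of _ k] conjI TrueI)
  qed
qed

lemma ee_sum: "ee (sum f S) = (\<Prod>v\<in>S. ee (f v))"
proof -
  have "ee 0 = 1" by (simp add: ee_def)
  then show ?thesis by (induction S rule: infinite_finite_induct) (simp_all add: ee_add)
qed

lemma quad_orth_sum:
  assumes "orthset S"
  shows "quad B (\<Sum>v\<in>S. f v *\<^sub>R v) = (\<Sum>v\<in>S. (f v)\<^sup>2 * B v v / 2)"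
proof -
  have "B (\<Sum>v\<in>S. f v *\<^sub>R v) (\<Sum>v\<in>S. f v *\<^sub>R v) = (\<Sum>w\<in>S. f w * B (\<Sum>v\<in>S. f v *\<^sub>R v) w)"
    by (subst linear_sum[OF lin_right]) (simp only: linear_cmul[OF lin_right] real_scaleR_def)
  also have "\<dots> = (\<Sum>w\<in>S. (f w)\<^sup>2 * B w w)"
  proof (rule sum.cong[OF refl])
    fix w assume "w \<in> S"
    then have "B (\<Sum>v\<in>S. f v *\<^sub>R v) w = f w * B w w" using B_orth_sum[of S w f] assms unfolding orthset_def by blast
    then show "f w * B (\<Sum>v\<in>S. f v *\<^sub>R v) w = (f w)\<^sup>2 * B w w" by (simp only: power2_eq_square mult.assoc)
  qed
  finally show ?thesis by (simp add: quad_def sum_divide_distrib)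
qed

lemma cbilin_orth_sum: "cbilin B (cvec (\<Sum>v\<in>S. f v *\<^sub>R v)) \<zeta> = (\<Sum>v\<in>S. of_real (f v) * cbilin B (cvec v) \<zeta>)"
  by (induction S rule: infinite_finite_induct) simp_all

text \<open>In orthogonal coordinates the summand is a product over \<open>S\<close>, so the sum is
  a product of one-dimensional series with parameter \<open>\<sigma>\<close> times B v v; each is
  transformed separately and the results are multiplied back together over the dual lattice.\<close>

lemma theta_orth:
  assumes S: "orthset S" and \<sigma>: "Im \<sigma> > 0"
  shows "theta_term \<sigma> \<zeta> abs_summable_on zspan S"
    and "infsum (theta_term \<sigma> \<zeta>) (zspan S) = (- \<i> * \<sigma>) powr (- (of_nat CARD('n) / 2)) / of_real (sqrt (\<Prod>v\<in>S. B v v)) *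
       (\<Sum>\<^sub>\<infinity>u\<in>dual_lattice B (zspan S). ee (- cquad B (\<zeta> - cvec u) / \<sigma>))"
proof -
  note SB = orthset_basis[OF S]
  have pos: "B v v > 0" if "v \<in> S" for v using S B_pos that by (auto simp: orthset_def)
  have \<sigma>0: "\<sigma> \<noteq> 0" using \<sigma> by auto
  define z where "z v = cbilin B (cvec v) \<zeta>" for v
  define f where "f v k = ee ((\<sigma> * of_real (B v v)) * of_int k ^ 2 / 2 + of_int k * z v)" for v and k :: int
  define g where "g v m = ee (- (z v - of_int m)\<^sup>2 / (2 * (\<sigma> * of_real (B v v))))" for v and m :: int
  have Im_pos: "Im (\<sigma> * of_real (B v v)) > 0" if "v \<in> S" for v using \<sigma> pos[OF that] by simp
  have fs: "f v abs_summable_on UNIV" if "v \<in> S" for v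
    unfolding f_def by (rule theta_transformation_1(2)[OF Im_pos[OF that]])
  have theta_coeff: "g v abs_summable_on UNIV" if "v \<in> S" for v
    unfolding g_def by (rule theta_transformation_1(3)[OF Im_pos[OF that]])
  \<comment> \<open>Since B v v is a positive real, its power splits off without leaving the
    principal branch, and the remaining power of -i \<open>\<sigma>\<close> is the same for all
    v.\<close>
  have ft: "infsum (f v) UNIV = (- \<i> * \<sigma>) powr (- 1 / 2) * of_real (1 / sqrt (B v v)) * infsum (g v) UNIV" if v: "v \<in> S" for v
  proof -
    have "infsum (f v) UNIV = (- \<i> * (\<sigma> * of_real (B v v))) powr (- 1 / 2) * infsum (g v) UNIV"
      unfolding f_def g_def by (rule theta_transformation_1(1)[OF Im_pos[OF v]])
    moreover have "(- \<i> * (\<sigma> * of_real (B v v))) powr (- 1 / 2) = (- \<i> * \<sigma>) powr (- 1 / 2) * of_real (B v v) powr (- 1 / 2)"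
      using powr_times_of_real[OF pos[OF v], of "- \<i> * \<sigma>" "- 1 / 2"] \<sigma>0 by (simp add: mult.assoc)
    moreover have "(of_real (B v v)) powr (- 1 / 2 :: complex) = of_real (1 / sqrt (B v v))"
    proof -
      have "(of_real (B v v)) powr (- 1 / 2 :: complex) = of_real (B v v powr (- 1/2))"
        using powr_of_real[of "B v v" "-1/2"] pos[OF v] by simp
      also have "B v v powr (- 1/2) = 1 / sqrt (B v v)"
        using powr_minus[of "B v v" "1/2"] powr_half_sqrt[of "B v v"] pos[OF v] by (simp add: inverse_eq_divide)
      finally show ?thesis .
    qed
    ultimately show ?thesis by simp
  qed
  have param: "bij_betw (\<lambda>k. \<Sum>v\<in>S. of_int (k v) *\<^sub>R v) (PiE S (\<lambda>_. UNIV :: int set)) (zspan S)"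
    by (rule zspan_param[OF S])
  have tt: "theta_term \<sigma> \<zeta> (\<Sum>v\<in>S. of_int (k v) *\<^sub>R v) = (\<Prod>v\<in>S. f v (k v))" for k :: "_ \<Rightarrow> int"
  proof -
    have "\<sigma> * of_real (quad B (\<Sum>v\<in>S. of_int (k v) *\<^sub>R v)) + cbilin B (cvec (\<Sum>v\<in>S. of_int (k v) *\<^sub>R v)) \<zeta>
       = (\<Sum>v\<in>S. \<sigma> * of_real (B v v) * (of_int (k v))\<^sup>2 / 2 + of_int (k v) * z v)"
      unfolding quad_orth_sum[OF S] cbilin_orth_sum z_def by (simp add: sum_distrib_left sum.distrib mult_ac)
    then show ?thesis unfolding theta_term_def f_def by (simp only: ee_sum)
  qed
  have prs: "(\<lambda>k. \<Prod>v\<in>S. F v (k v)) abs_summable_on (PiE S (\<lambda>_. UNIV :: int set))"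
    if "\<And>v. v \<in> S \<Longrightarrow> F v abs_summable_on UNIV" for F :: "_ \<Rightarrow> int \<Rightarrow> complex"
    unfolding abs_summable_equivalent
    by (rule abs_summable_on_prod_PiE) (use that SB in \<open>auto simp: abs_summable_equivalent[symmetric]\<close>)
  show sm: "theta_term \<sigma> \<zeta> abs_summable_on zspan S"
    using prs[OF fs] summable_on_reindex_bij_betw[OF param, of "\<lambda>x. norm (theta_term \<sigma> \<zeta> x)"] unfolding tt by simp
  have "infsum (theta_term \<sigma> \<zeta>) (zspan S) = (\<Sum>\<^sub>\<infinity>k\<in>PiE S (\<lambda>_. UNIV). \<Prod>v\<in>S. f v (k v))"
    using infsum_reindex_bij_betw[OF param, of "theta_term \<sigma> \<zeta>"] unfolding tt by simp
  also have "\<dots> = (\<Prod>v\<in>S. infsum (f v) UNIV)"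
    by (rule infsum_prod_PiE_abs) (use SB fs in auto)
  also have "\<dots> = (\<Prod>v\<in>S. (- \<i> * \<sigma>) powr (- 1 / 2)) * (\<Prod>v\<in>S. of_real (1 / sqrt (B v v))) * (\<Prod>v\<in>S. infsum (g v) UNIV)"
    unfolding prod.distrib[symmetric] by (intro prod.cong refl ft)
  also have "(\<Prod>v\<in>S. (- \<i> * \<sigma>) powr (- 1 / 2)) = (- \<i> * \<sigma>) powr (- (of_nat CARD('n) / 2))"
    using powr_minus_half_power[of "- \<i> * \<sigma>"] \<sigma>0 SB by simp
  also have "(\<Prod>v\<in>S. of_real (1 / sqrt (B v v))) = (1 / of_real (sqrt (\<Prod>v\<in>S. B v v)) :: complex)"
    by (simp add: prod_dividef sqrt_prod)
  also have "(\<Prod>v\<in>S. infsum (g v) UNIV) = (\<Sum>\<^sub>\<infinity>k\<in>PiE S (\<lambda>_. UNIV). \<Prod>v\<in>S. g v (k v))"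
    by (rule infsum_prod_PiE_abs[symmetric]) (use SB theta_coeff in auto)
  also have "\<dots> = (\<Sum>\<^sub>\<infinity>u\<in>dual_lattice B (zspan S). ee (- cquad B (\<zeta> - cvec u) / \<sigma>))"
  proof -
    \<comment> \<open>Coordinates with respect to the dual basis v / B v v: the numbers m v are
      exactly the products with the vectors of \<open>S\<close>.\<close>
    define h where "h m = (\<Sum>v\<in>S. (of_int (m v) / B v v) *\<^sub>R v)" for m :: "real ^ 'n \<Rightarrow> int"
    have Bh: "B (h m) w = of_int (m w)" if "w \<in> S" for m w
    proof -
      have "B (h m) w = of_int (m w) / B w w * B w w"
        using B_orth_sum[of S w "\<lambda>v. of_int (m v) / B v v"] that S unfolding h_def orthset_def by blast
      then show ?thesis using pos[OF that] by simp
    qed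
    have bij: "bij_betw h (PiE S (\<lambda>_. UNIV)) (dual_lattice B (zspan S))"
      unfolding bij_betw_def
    proof
      show "inj_on h (PiE S (\<lambda>_. UNIV))"
      proof (rule inj_onI)
        fix k l assume kl: "k \<in> PiE S (\<lambda>_. UNIV)" "l \<in> PiE S (\<lambda>_. UNIV)" "h k = h l"
        have "k w = l w" if "w \<in> S" for w using Bh[OF that, of k] Bh[OF that, of l] kl(3) by simp
        then show "k = l" by (rule PiE_ext[OF kl(1,2)])
      qed
      show "h ` PiE S (\<lambda>_. UNIV) = dual_lattice B (zspan S)"
      proof (intro equalityI subsetI)
        fix x assume "x \<in> h ` PiE S (\<lambda>_. UNIV)"
        then show "x \<in> dual_lattice B (zspan S)" unfolding dual_zspan[OF SB(3)] using Bh by auto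
      next
        fix x assume "x \<in> dual_lattice B (zspan S)"
        then have i: "\<forall>v\<in>S. B x v \<in> \<int>" unfolding dual_zspan[OF SB(3)] .
        have "x = (\<Sum>v\<in>S. (B x v / B v v) *\<^sub>R v)" by (rule orthset_expand[OF S])
        also have "\<dots> = h (restrict (\<lambda>v. \<lfloor>B x v\<rfloor>) S)" unfolding h_def
          by (intro sum.cong refl) (use i in \<open>auto elim!: Ints_cases\<close>)
        finally have xh: "x = h (restrict (\<lambda>v. \<lfloor>B x v\<rfloor>) S)" .
        have "restrict (\<lambda>v. \<lfloor>B x v\<rfloor>) S \<in> PiE S (\<lambda>_. UNIV)" by simp
        from imageI[OF this, of h] show "x \<in> h ` PiE S (\<lambda>_. UNIV)" by (simp only: xh[symmetric])
      qed
    qed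
    have "ee (- cquad B (\<zeta> - cvec (h m)) / \<sigma>) = (\<Prod>v\<in>S. g v (m v))" for m
    proof -
      have "cbilin B (cvec v) (\<zeta> - cvec (h m)) = z v - of_int (m v)" if "v \<in> S" for v
        using Bh[OF that, of m] B_sym[of v "h m"] by (simp add: z_def)
      then have "cquad B (\<zeta> - cvec (h m)) = (\<Sum>v\<in>S. (z v - of_int (m v))\<^sup>2 / (2 * of_real (B v v)))"
        unfolding cquad_parseval[OF S] by (intro sum.cong) auto
      then have "- cquad B (\<zeta> - cvec (h m)) / \<sigma> = (\<Sum>v\<in>S. - (z v - of_int (m v))\<^sup>2 / (2 * (\<sigma> * of_real (B v v))))"
        using \<sigma>0 by (simp add: sum_negf sum_divide_distrib mult_ac)
      then show ?thesis unfolding g_def by (simp only: ee_sum)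
    qed
    then show ?thesis using infsum_reindex_bij_betw[OF bij, of "\<lambda>u. ee (- cquad B (\<zeta> - cvec u) / \<sigma>)"] by simp
  qed
  finally show "infsum (theta_term \<sigma> \<zeta>) (zspan S) = (- \<i> * \<sigma>) powr (- (of_nat CARD('n) / 2)) / of_real (sqrt (\<Prod>v\<in>S. B v v)) *
       (\<Sum>\<^sub>\<infinity>u\<in>dual_lattice B (zspan S). ee (- cquad B (\<zeta> - cvec u) / \<sigma>))" by simp
qed

text \<open>A translation of the lattice is absorbed by the elliptic variable; only a factor
  independent of v remains.\<close>

lemma theta_term_shift: "theta_term \<sigma> \<zeta> (r + v) = theta_term \<sigma> \<zeta> r * theta_term \<sigma> (\<zeta> + \<sigma> *s cvec r) v"
  unfolding theta_term_def ee_add[symmetric]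
  by (rule arg_cong[where f = ee]) (simp add: quad_add algebra_simps B_sym[of r])

text \<open>On the dual side the square is expanded: the terms quadratic in r and the product of r
  with \<open>\<zeta>\<close> cancel against the factor from \<open>theta_term_shift\<close>, and
  the translation survives only as the character u -> B u r.\<close>

lemma dual_term_shift:
  assumes "\<sigma> \<noteq> 0"
  shows "theta_term \<sigma> \<zeta> r * ee (- cquad B (\<zeta> + \<sigma> *s cvec r - cvec u) / \<sigma>) = ee (of_real (B u r)) * ee (- cquad B (\<zeta> - cvec u) / \<sigma>)"
proof -
  have e: "\<zeta> + \<sigma> *s cvec r - cvec u = (\<zeta> - cvec u) + \<sigma> *s cvec r" by simp
  have "cquad B (\<zeta> + \<sigma> *s cvec r - cvec u) = cquad B (\<zeta> - cvec u) + \<sigma> * (cbilin B \<zeta> (cvec r) - of_real (B u r)) + \<sigma>\<^sup>2 * of_real (quad B r)"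
    unfolding e cquad_add by (simp add: cquad_scale)
  then have "\<sigma> * of_real (quad B r) + cbilin B (cvec r) \<zeta> + - cquad B (\<zeta> + \<sigma> *s cvec r - cvec u) / \<sigma>
     = of_real (B u r) + - cquad B (\<zeta> - cvec u) / \<sigma>"
    using assms cbilin_sym[of "cvec r" \<zeta>] by (simp add: field_simps power2_eq_square)
  then show ?thesis unfolding theta_term_def ee_add[symmetric] by simp
qed

text \<open>Dual summands are again theta terms, at -1 / \<open>\<sigma>\<close>, up to a constant;
  their summability follows from that of theta series.\<close>

lemma dual_term_theta_term:
  assumes "\<sigma> \<noteq> 0"
  shows "ee (- cquad B (\<zeta> - cvec u) / \<sigma>) = ee (- cquad B \<zeta> / \<sigma>) * theta_term (- 1 / \<sigma>) ((1 / \<sigma>) *s \<zeta>) u"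
  unfolding theta_term_def ee_add[symmetric] cquad_diff
  by (rule arg_cong[where f = ee]) (use assms cbilin_sym[of "cvec u" \<zeta>] in \<open>simp add: field_simps\<close>)

end

lemma summable_on_ee_mult:
  assumes "f abs_summable_on A"
  shows "(\<lambda>u. ee (of_real (\<phi> u)) * f u) summable_on A"
proof (rule abs_summable_summable)
  show "(\<lambda>u. ee (of_real (\<phi> u)) * f u) abs_summable_on A" using assms by (simp only: norm_mult norm_ee_real mult_1)
qed

section \<open>Summation over the cosets of an orthogonal sublattice\<close>

context int_lattice
begin

lemma zspan_orth_int_lattice:
  assumes "orthset S" "S \<subseteq> L"
  shows "int_lattice B (zspan S)" "zspan S \<subseteq> L"
proof -
  show s: "zspan S \<subseteq> L" by (rule zspan_subset[OF subL assms(2)])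
  show "int_lattice B (zspan S)"
  proof unfold_locales
    show "is_lattice (zspan S)" unfolding is_lattice_zspan using orthset_basis[OF assms(1)] by blast
    show "even_integral B (zspan S)" using s evenL unfolding even_integral_def by blast
  qed
qed

text \<open>The dual lattice is contained in the dual of an orthogonal sublattice, and the latter is
  spanned by an orthogonal basis.\<close>

lemma theta_term_summable:
  assumes "Im \<sigma> > 0" "X \<subseteq> Ld"
  shows "theta_term \<sigma> \<zeta> abs_summable_on X"
proof -
  obtain S where S: "orthset S" "S \<subseteq> L" by (rule orth_sublattice)
  have "Ld \<subseteq> dual_lattice B (zspan S)" by (rule dual_antimono) (rule zspan_orth_int_lattice[OF S])
  also have "\<dots> = zspan (dual_orth S)" using orthset_dual_orth[OF S(1)] by simp
  finally have "X \<subseteq> zspan (dual_orth S)" using assms(2) by blast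
  then show ?thesis using theta_orth(1)[OF orthset_dual_orth(1)[OF S(1)] assms(1), of \<zeta>] summable_on_subset_banach by blast
qed

text \<open>Each coset of \<open>zspan S\<close> contributes its orthogonal series twisted by the
  character u -> B u r. Summing over r retains exactly the u that pair integrally with
  \<open>L\<close>. The constant is left as index over square root of the product of norms.\<close>

lemma poisson_raw:
  assumes S: "orthset S" "S \<subseteq> L" and \<sigma>: "Im \<sigma> > 0" and R: "transversal R L (zspan S)"
  shows "finite R"
    and "infsum (theta_term \<sigma> \<zeta>) L = (- \<i> * \<sigma>) powr (- (of_nat CARD('n) / 2)) * of_real (card R / sqrt (\<Prod>v\<in>S. B v v)) *
       (\<Sum>\<^sub>\<infinity>u\<in>Ld. ee (- cquad B (\<zeta> - cvec u) / \<sigma>))"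
proof -
  interpret Z: int_lattice B "zspan S" by (rule zspan_orth_int_lattice[OF S])
  have ZL: "zspan S \<subseteq> L" by (rule zspan_orth_int_lattice[OF S])
  have LdZ: "Ld \<subseteq> Z.Ld" by (rule dual_antimono[OF ZL])
  have \<sigma>0: "\<sigma> \<noteq> 0" using \<sigma> by auto
  obtain R' where R': "transversal R' Z.Ld (zspan S)" "finite R'" by (rule Z.transversal_dual)
  show fin: "finite R"
    by (rule transversal_finite_subset[OF Z.subL R R'(1) _ R'(2)]) (use L_sub_Ld LdZ in blast)
  define K where "K = (- \<i> * \<sigma>) powr (- (of_nat CARD('n) / 2)) / of_real (sqrt (\<Prod>v\<in>S. B v v))"
  define d where "d u = ee (- cquad B (\<zeta> - cvec u) / \<sigma>)" for u
  have dsum: "d abs_summable_on Z.Ld"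
    unfolding d_def dual_term_theta_term[OF \<sigma>0] norm_mult
    by (intro summable_on_cmult_right Z.theta_term_summable Im_neg_inverse \<sigma> order_refl)
  have "infsum (theta_term \<sigma> \<zeta>) ((+) 0 ` L) = (\<Sum>r\<in>R. \<Sum>\<^sub>\<infinity>h\<in>zspan S. theta_term \<sigma> \<zeta> (0 + r + h))"
    by (rule transversal_infsum[OF Z.subL subL ZL R fin])
       (simp add: abs_summable_summable[OF theta_term_summable[OF \<sigma> L_sub_Ld]])
  then have "infsum (theta_term \<sigma> \<zeta>) L = (\<Sum>r\<in>R. \<Sum>\<^sub>\<infinity>h\<in>zspan S. theta_term \<sigma> \<zeta> (r + h))" by simp
  also have "\<dots> = (\<Sum>r\<in>R. K * (\<Sum>\<^sub>\<infinity>u\<in>Z.Ld. ee (of_real (B u r)) * d u))"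
  proof (rule sum.cong[OF refl])
    fix r
    have "(\<Sum>\<^sub>\<infinity>h\<in>zspan S. theta_term \<sigma> \<zeta> (r + h)) = theta_term \<sigma> \<zeta> r * infsum (theta_term \<sigma> (\<zeta> + \<sigma> *s cvec r)) (zspan S)"
      unfolding theta_term_shift by (rule infsum_cmult_right')
    also have "\<dots> = K * (theta_term \<sigma> \<zeta> r * (\<Sum>\<^sub>\<infinity>u\<in>Z.Ld. ee (- cquad B (\<zeta> + \<sigma> *s cvec r - cvec u) / \<sigma>)))"
      unfolding theta_orth(2)[OF S(1) \<sigma>] K_def by simp
    also have "\<dots> = K * (\<Sum>\<^sub>\<infinity>u\<in>Z.Ld. ee (of_real (B u r)) * d u)"
      unfolding infsum_cmult_right'[symmetric] dual_term_shift[OF \<sigma>0] d_def ..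
    finally show "(\<Sum>\<^sub>\<infinity>h\<in>zspan S. theta_term \<sigma> \<zeta> (r + h)) = K * (\<Sum>\<^sub>\<infinity>u\<in>Z.Ld. ee (of_real (B u r)) * d u)" .
  qed
  also have "\<dots> = K * (\<Sum>\<^sub>\<infinity>u\<in>Z.Ld. \<Sum>r\<in>R. ee (of_real (B u r)) * d u)"
    unfolding sum_distrib_left[symmetric]
    by (subst infsum_sum_swap[OF fin summable_on_ee_mult[OF dsum]]) (rule refl)
  also have "(\<Sum>\<^sub>\<infinity>u\<in>Z.Ld. \<Sum>r\<in>R. ee (of_real (B u r)) * d u) = (\<Sum>\<^sub>\<infinity>u\<in>Z.Ld. (if u \<in> Ld then of_nat (card R) else 0) * d u)"
  proof (rule infsum_cong)
    fix u assume u: "u \<in> Z.Ld"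
    have "(\<Sum>r\<in>R. ee (of_real (B u r))) = (if \<forall>x\<in>L. B u x \<in> \<int> then of_nat (card R) else 0)"
      by (rule transversal_character_sum[OF Z.subL subL R fin]) (use u ZL in \<open>auto simp: dual_lattice_def\<close>)
    then show "(\<Sum>r\<in>R. ee (of_real (B u r)) * d u) = (if u \<in> Ld then of_nat (card R) else 0) * d u"
      by (simp add: sum_distrib_right[symmetric] dual_lattice_def)
  qed
  also have "\<dots> = (\<Sum>\<^sub>\<infinity>u\<in>Ld. of_nat (card R) * d u)"
    by (rule infsum_cong_neutral) (use LdZ in auto)
  also have "\<dots> = of_nat (card R) * infsum d Ld" by (rule infsum_cmult_right')
  finally show "infsum (theta_term \<sigma> \<zeta>) L = (- \<i> * \<sigma>) powr (- (of_nat CARD('n) / 2)) * of_real (card R / sqrt (\<Prod>v\<in>S. B v v)) *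
       (\<Sum>\<^sub>\<infinity>u\<in>Ld. ee (- cquad B (\<zeta> - cvec u) / \<sigma>))"
    unfolding K_def d_def by simp
qed

text \<open>The constant \<open>K\<close> is kept abstract because the translated formula is needed
  twice: in \<open>disc_orth_raw\<close>, where the constant is still unknown, and in
  \<open>theta_poisson\<close>, where it is not.\<close>

lemma poisson_shift:
  assumes \<sigma>: "Im \<sigma> > 0" 
    and P: "\<And>\<zeta>. infsum (theta_term \<sigma> \<zeta>) L = K * (\<Sum>\<^sub>\<infinity>u\<in>Ld. ee (- cquad B (\<zeta> - cvec u) / \<sigma>))"
  shows "(\<Sum>\<^sub>\<infinity>v\<in>L. theta_term \<sigma> \<zeta> (r + v)) = K * (\<Sum>\<^sub>\<infinity>u\<in>Ld. ee (of_real (B u r)) * ee (- cquad B (\<zeta> - cvec u) / \<sigma>))"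
proof -
  have \<sigma>0: "\<sigma> \<noteq> 0" using \<sigma> by auto
  have "(\<Sum>\<^sub>\<infinity>v\<in>L. theta_term \<sigma> \<zeta> (r + v)) = theta_term \<sigma> \<zeta> r * infsum (theta_term \<sigma> (\<zeta> + \<sigma> *s cvec r)) L"
    unfolding theta_term_shift by (rule infsum_cmult_right')
  also have "\<dots> = K * (theta_term \<sigma> \<zeta> r * (\<Sum>\<^sub>\<infinity>u\<in>Ld. ee (- cquad B (\<zeta> + \<sigma> *s cvec r - cvec u) / \<sigma>)))"
    unfolding P by simp
  also have "\<dots> = K * (\<Sum>\<^sub>\<infinity>u\<in>Ld. ee (of_real (B u r)) * ee (- cquad B (\<zeta> - cvec u) / \<sigma>))"
    unfolding infsum_cmult_right'[symmetric] dual_term_shift[OF \<sigma>0] ..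
  finally show ?thesis .
qed

text \<open>Summing the Poisson formula for \<open>t + L\<close> over \<open>t\<close> in the dual lattice modulo \<open>L\<close> and applying it once
  more to \<open>L\<close> returns the theta value at \<open>\<i>\<close> that one started from.\<close>

lemma disc_orth_raw:
  assumes S: "orthset S" "S \<subseteq> L" and R: "transversal R L (zspan S)"
  shows "real (disc B L) * (card R)\<^sup>2 = (\<Prod>v\<in>S. B v v)"
proof -
  define \<delta> where "\<delta> = card R / sqrt (\<Prod>v\<in>S. B v v)"
  have posP: "(\<Prod>v\<in>S. B v v) > 0" using S B_pos by (intro prod_pos) (auto simp: orthset_def)
  have Im_i: "Im \<i> > 0" by simp
  define X where "X = infsum (theta_term \<i> 0) Ld"
  \<comment> \<open>At \<open>\<i>\<close> the power in front equals 1, and by \<open>dt\<close> the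
    dual summands at \<open>\<zeta> = 0\<close> are theta terms at the same point.\<close>
  have P: "infsum (theta_term \<i> \<zeta>) L = of_real \<delta> * (\<Sum>\<^sub>\<infinity>u\<in>Ld. ee (- cquad B (\<zeta> - cvec u) / \<i>))" for \<zeta>
    using poisson_raw(2)[OF S Im_i R, of \<zeta>] by (simp add: \<delta>_def)
  have dt: "ee (- cquad B (0 - cvec u) / \<i>) = theta_term \<i> 0 u" for u
    by (simp add: theta_term_def cquad_def quad_def)
  obtain T where T: "transversal T Ld L" "finite T" "card T = disc B L" by (rule transversal_dual)
  have sumL: "theta_term \<i> 0 abs_summable_on Ld" by (rule theta_term_summable) auto
  have "infsum (theta_term \<i> 0) ((+) 0 ` Ld) = (\<Sum>t\<in>T. \<Sum>\<^sub>\<infinity>h\<in>L. theta_term \<i> 0 (0 + t + h))"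
    by (rule transversal_infsum[OF subL subLd L_sub_Ld T(1,2)]) (simp add: abs_summable_summable[OF sumL])
  then have "X = (\<Sum>t\<in>T. \<Sum>\<^sub>\<infinity>h\<in>L. theta_term \<i> 0 (t + h))" by (simp add: X_def)
  also have "\<dots> = (\<Sum>t\<in>T. of_real \<delta> * (\<Sum>\<^sub>\<infinity>u\<in>Ld. ee (of_real (B u t)) * theta_term \<i> 0 u))"
    unfolding poisson_shift[OF Im_i P] dt ..
  also have "\<dots> = of_real \<delta> * (\<Sum>\<^sub>\<infinity>u\<in>Ld. \<Sum>t\<in>T. ee (of_real (B u t)) * theta_term \<i> 0 u)"
    unfolding sum_distrib_left[symmetric]
    by (subst infsum_sum_swap[OF T(2) summable_on_ee_mult[OF sumL]]) (rule refl)
  also have "(\<Sum>\<^sub>\<infinity>u\<in>Ld. \<Sum>t\<in>T. ee (of_real (B u t)) * theta_term \<i> 0 u) = (\<Sum>\<^sub>\<infinity>u\<in>Ld. (if u \<in> L then of_nat (disc B L) else 0) * theta_term \<i> 0 u)"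
  proof (rule infsum_cong)
    fix u assume u: "u \<in> Ld"
    have "(\<Sum>t\<in>T. ee (of_real (B u t))) = (if \<forall>x\<in>Ld. B u x \<in> \<int> then of_nat (card T) else 0)"
      by (rule transversal_character_sum[OF subL subLd T(1,2) _ _ L_sub_Ld]) (use u in \<open>auto simp: dual_lattice_def\<close>)
    moreover have "(\<forall>x\<in>Ld. B u x \<in> \<int>) \<longleftrightarrow> u \<in> dual_lattice B Ld" by (simp add: dual_lattice_def[of B Ld])
    ultimately show "(\<Sum>t\<in>T. ee (of_real (B u t)) * theta_term \<i> 0 u) = (if u \<in> L then of_nat (disc B L) else 0) * theta_term \<i> 0 u"
      using dual_dual[OF lat] by (simp add: sum_distrib_right[symmetric] T(3))
  qed
  also have "\<dots> = (\<Sum>\<^sub>\<infinity>u\<in>L. of_nat (disc B L) * theta_term \<i> 0 u)"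
    by (rule infsum_cong_neutral) (use L_sub_Ld in auto)
  also have "\<dots> = of_nat (disc B L) * infsum (theta_term \<i> 0) L" by (rule infsum_cmult_right')
  also have "infsum (theta_term \<i> 0) L = of_real \<delta> * X" using P[of 0] unfolding dt X_def .
  finally have "X * 1 = X * of_real (\<delta>\<^sup>2 * disc B L)" by (simp add: power2_eq_square mult_ac)
  \<comment> \<open>At \<open>\<i>\<close> all terms are positive and the one at 0 equals 1, so the
    common theta value may be cancelled.\<close>
  moreover have "X \<noteq> 0"
  proof -
    have tt: "theta_term \<i> 0 u = of_real (exp (- 2 * pi * quad B u))" for u
      by (simp add: theta_term_def ee_def exp_of_real[symmetric] mult_ac)
    have sm: "(\<lambda>u. exp (- 2 * pi * quad B u)) summable_on Ld" using sumL unfolding tt by simp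
    have "(1::real) \<le> (\<Sum>\<^sub>\<infinity>u\<in>Ld. exp (- 2 * pi * quad B u))"
      using finite_sum_le_infsum[OF sm, of "{0}"] subgrpD(1)[OF subLd] by simp
    moreover have "X = of_real (\<Sum>\<^sub>\<infinity>u\<in>Ld. exp (- 2 * pi * quad B u))"
      unfolding X_def tt by (rule infsumI) (use has_sum_infsum[OF sm] has_sum_of_real in blast)
    ultimately show ?thesis by (metis not_one_le_zero of_real_eq_0_iff)
  qed
  ultimately have "\<delta>\<^sup>2 * disc B L = 1" by (metis mult_left_cancel of_real_eq_1_iff)
  then show ?thesis using posP by (simp add: \<delta>_def power_divide field_simps)
qed

text \<open>Here f is the index of the orthogonal sublattice. Thus D agrees with the product of
  norms up to a square, which is all that a Legendre symbol sees.\<close>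

lemma disc_orth:
  assumes "orthset S" "S \<subseteq> L"
  obtains f :: nat where "real (disc B L) * real f ^ 2 = (\<Prod>v\<in>S. B v v)"
proof -
  have "subgrp (zspan S)" by (rule subgrp_zspan)
  then obtain R where "transversal R L (zspan S)" using transversal_exists by blast
  from disc_orth_raw[OF assms this] show ?thesis using that[of "card R"] by simp
qed

lemma theta_poisson:
  assumes \<sigma>: "Im \<sigma> > 0"
  shows "(\<Sum>\<^sub>\<infinity>v\<in>L. theta_term \<sigma> \<zeta> (r + v)) = (- \<i> * \<sigma>) powr (- (of_nat CARD('n) / 2)) / of_real (sqrt (disc B L)) * 
     (\<Sum>\<^sub>\<infinity>u\<in>Ld. ee (of_real (B u r)) * ee (- cquad B (\<zeta> - cvec u) / \<sigma>))"
proof (rule poisson_shift[OF \<sigma>])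
  fix \<zeta>
  obtain S where S: "orthset S" "S \<subseteq> L" by (rule orth_sublattice)
  have "subgrp (zspan S)" by (rule subgrp_zspan)
  then obtain R where R: "transversal R L (zspan S)" using transversal_exists by blast
  have posP: "(\<Prod>v\<in>S. B v v) > 0" using S B_pos by (intro prod_pos) (auto simp: orthset_def)
  have d: "real (disc B L) * (card R)\<^sup>2 = (\<Prod>v\<in>S. B v v)" by (rule disc_orth_raw[OF S R])
  then have "card R \<noteq> 0" using posP by (intro notI) simp
  then have "card R / sqrt (\<Prod>v\<in>S. B v v) = 1 / sqrt (disc B L)"
    unfolding d[symmetric] by (simp add: real_sqrt_mult)
  then show "infsum (theta_term \<sigma> \<zeta>) L = (- \<i> * \<sigma>) powr (- (of_nat CARD('n) / 2)) / of_real (sqrt (disc B L)) * (\<Sum>\<^sub>\<infinity>u\<in>Ld. ee (- cquad B (\<zeta> - cvec u) / \<sigma>))"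
    using poisson_raw(2)[OF S \<sigma> R, of \<zeta>] by simp
qed

text \<open>The exponent a Q(x) / c depends on x modulo \<open>c L\<close> only, even for x in the
  dual lattice. Integrality of Q on \<open>L\<close>, not merely of B, is what handles the quadratic
  term.\<close>

lemma quad_cong_scaled:
  assumes "x \<in> Ld" "l \<in> L" "c \<noteq> 0"
  shows "of_int a * quad B (x + of_int c *\<^sub>R l) / of_int c - of_int a * quad B x / of_int c \<in> \<int>"
proof -
  have "of_int a * quad B (x + of_int c *\<^sub>R l) / of_int c - of_int a * quad B x / of_int c = of_int a * B x l + of_int a * of_int c * quad B l"
    using assms(3) by (simp add: quad_add quad_scale field_simps power2_eq_square)
  also have "\<dots> \<in> \<int>" using B_dual_int(1)[OF assms(1,2)] quad_int[OF assms(2)] by (intro Ints_add Ints_mult) auto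
  finally show ?thesis .
qed

lemma theta_term_add_real: "theta_term (\<sigma> + of_real s) \<zeta> v = ee (of_real (s * quad B v)) * theta_term \<sigma> \<zeta> v"
  by (simp add: theta_term_def ee_add[symmetric] algebra_simps)

lemma theta_term_scale_arg: "theta_term \<sigma> \<zeta> (s *\<^sub>R v) = theta_term (of_real (s\<^sup>2) * \<sigma>) (of_real s *s \<zeta>) v"
  by (simp add: theta_term_def quad_scale mult_ac)

text \<open>Branch bookkeeping. For w in the upper half-plane the imaginary part of Ln w lies
  strictly between 0 and pi, so Ln (i / w) = i pi / 2 - Ln w holds exactly, and the two powers
  combine to one of -i without a further root of unity.\<close>

lemma powr_i_over:
  assumes "Im w > 0" "c > 0"
  shows "w powr (- (of_nat n / 2)) * (- \<i> * (- of_real c / w)) powr (- (of_nat n / 2)) = (- \<i>) powr (of_nat n / 2) * of_real (c powr (- (real n / 2)))"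
proof -
  have w0: "w \<noteq> 0" using assms by auto
  have "Ln (\<i> / w) = \<i> * of_real (pi / 2) - Ln w"
  proof (rule Ln_unique)
    have "exp (\<i> * of_real (pi / 2)) = \<i>" by (simp only: cis_conv_exp[symmetric] cis_pi_half)
    then show "exp (\<i> * of_real (pi / 2) - Ln w) = \<i> / w" using w0 by (simp add: exp_diff)
    have "0 < Im (Ln w)" "Im (Ln w) < pi" using Im_Ln_pos_lt[OF w0] assms by auto
    then show "- pi < Im (\<i> * of_real (pi / 2) - Ln w)" "Im (\<i> * of_real (pi / 2) - Ln w) \<le> pi" by auto
  qed
  moreover have "Ln (of_real c * (\<i> / w)) = of_real (ln c) + Ln (\<i> / w)"
    by (subst Ln_times_of_real) (use assms w0 in \<open>simp_all add: Ln_of_real\<close>)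
  moreover have e: "- \<i> * (- of_real c / w) = of_real c * (\<i> / w)" by simp
  ultimately have L: "Ln (- \<i> * (- of_real c / w)) = of_real (ln c) + (\<i> * of_real (pi / 2) - Ln w)"
    unfolding e by simp
  have "w powr (- (of_nat n / 2)) * (- \<i> * (- of_real c / w)) powr (- (of_nat n / 2))
     = exp (- (of_nat n / 2) * Ln w + - (of_nat n / 2) * Ln (- \<i> * (- of_real c / w)))"
  proof -
    have "- \<i> * (- of_real c / w) \<noteq> 0" using w0 assms by simp
    then show ?thesis using w0 by (simp only: powr_def if_False exp_add)
  qed
  also have "- (of_nat n / 2) * Ln w + - (of_nat n / 2) * Ln (- \<i> * (- of_real c / w))
     = of_nat n / 2 * (- (\<i> * of_real (pi / 2))) + of_real (- (real n / 2) * ln c)"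
    unfolding L by (simp add: algebra_simps)
  also have "exp \<dots> = (- \<i>) powr (of_nat n / 2) * of_real (c powr (- (real n / 2)))"
  proof -
    have 1: "(- \<i>) powr (of_nat n / 2) = exp (of_nat n / 2 * (- (\<i> * of_real (pi / 2))))"
      by (simp add: powr_def Ln_minus_ii)
    have 2: "c powr (- (real n / 2)) = exp (- (real n / 2) * ln c)" using assms by (simp add: powr_def)
    show ?thesis unfolding 1 2 exp_add exp_of_real ..
  qed
  finally show ?thesis .
qed

section \<open>The transformation formula\<close>

text \<open>The still unevaluated coefficient: a Gauss sum with a linear term, over the residues
  modulo \<open>c L\<close> in the coset t + L.\<close>

definition theta_coeff :: "int \<Rightarrow> int \<Rightarrow> int \<Rightarrow> (real ^ 'n) set \<Rightarrow> real ^ 'n \<Rightarrow> real ^ 'n \<Rightarrow> complex" where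
  "theta_coeff a c d R t v = (\<Sum>r\<in>R. ee (of_real ((of_int a * quad B (t + r) - B v (t + r) + of_int d * quad B v) / of_int c)))"

text \<open>The transformed point is a/c - 1/(c w). On a coset x + c L the rational part contributes
  a constant by \<open>quad_cong_scaled\<close>; Poisson summation applies to the rest.\<close>

lemma theta_modular:
  fixes a b c d :: int
  assumes det: "a * d - b * c = 1" and c: "c > 0" and \<tau>: "Im \<tau> > 0" and t: "t \<in> Ld"
    and R: "transversal R L (scaled c)" "finite R" and w: "w = of_int c * \<tau> + of_int d"
  shows "w powr (- (of_nat CARD('n) / 2)) * ee (- (of_int c / w) * cquad B z)
          * theta B L t ((of_int a * \<tau> + of_int b) / w) (\<chi> i. z $ i / w)
        = (- \<i>) powr (of_nat CARD('n) / 2) * of_real (of_int c powr (- (real CARD('n) / 2))) / of_real (sqrt (disc B L)) *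
          (\<Sum>\<^sub>\<infinity>v\<in>Ld. theta_coeff a c d R t v * theta_term \<tau> z v)"
proof -
  have Imw: "Im w > 0" using w c \<tau> by simp
  have w0: "w \<noteq> 0" using Imw by auto
  have c0: "c \<noteq> 0" "(of_int c :: real) > 0" "(of_int c :: complex) \<noteq> 0" using c by auto
  define \<tau>' where "\<tau>' = - 1 / (of_int c * w)"
  \<comment> \<open>This is c^2 times \<open>\<tau>'\<close>: writing the coset x + c L as c times
    (x / c + L) scales Q by c^2.\<close>
  define \<sigma> where "\<sigma> = - of_int c / w"
  define z' where "z' = (1 / w) *s z"
  have zz: "(\<chi> i. z $ i / w) = z'" by (simp add: z'_def vec_eq_iff)
  have gt: "(of_int a * \<tau> + of_int b) / w = \<tau>' + of_real (of_int a / of_int c)"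
  proof -
    have "of_int b * of_int c = (of_int a * of_int d - 1 :: complex)"
      using det by (metis add_diff_cancel_left' diff_add_cancel diff_diff_eq2 of_int_1 of_int_diff of_int_mult)
    then have "of_int a * w - 1 = of_int c * (of_int a * \<tau> + of_int b)" unfolding w by (simp add: algebra_simps)
    moreover have "\<tau>' + of_int a / of_int c = (of_int a * w - 1) / (of_int c * w)"
      unfolding \<tau>'_def using w0 c0 by (simp add: field_simps)
    ultimately show ?thesis using c0 by simp
  qed
  have Im\<tau>': "Im \<tau>' > 0" unfolding \<tau>'_def using Im_neg_inverse[of "of_int c * w"] Imw c by simp
  have Im\<sigma>: "Im \<sigma> > 0"
  proof -
    have "\<sigma> = of_real ((of_int c)\<^sup>2) * \<tau>'" unfolding \<sigma>_def \<tau>'_def using c0 w0 by (simp add: field_simps power2_eq_square)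
    then show ?thesis using Im\<tau>' c0 by simp
  qed
  have Imgt: "Im ((of_int a * \<tau> + of_int b) / w) > 0" unfolding gt using Im\<tau>' by simp
  have tL: "(+) t ` L \<subseteq> Ld" using t L_sub_Ld subgrpD(4)[OF subLd] by blast
  define K where "K = (- \<i> * \<sigma>) powr (- (of_nat CARD('n) / 2)) / of_real (sqrt (disc B L))"
  have cL: "subgrp (scaled c)" "scaled c \<subseteq> L"
    using subgrp_scaled[OF subL] subgrp_of_int_scale[OF subL] by auto
  let ?g = "(of_int a * \<tau> + of_int b) / w"
  have "theta B L t ?g (\<chi> i. z $ i / w) = infsum (theta_term ?g z') ((+) t ` L)"
    unfolding theta_def theta_term_def zz ..
  also have "\<dots> = (\<Sum>r\<in>R. \<Sum>\<^sub>\<infinity>h\<in>scaled c. theta_term ?g z' (t + r + h))"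
    by (rule transversal_infsum[OF cL(1) subL cL(2) R]) (rule abs_summable_summable[OF theta_term_summable[OF Imgt tL]])
  also have "\<dots> = (\<Sum>r\<in>R. K * ee (of_int c / w * cquad B z) * (\<Sum>\<^sub>\<infinity>v\<in>Ld. ee (of_real ((of_int a * quad B (t + r) - B v (t + r) + of_int d * quad B v) / of_int c)) * theta_term \<tau> z v))"
  proof (rule sum.cong[OF refl])
    fix r assume r: "r \<in> R"
    define x where "x = t + r"
    have x: "x \<in> Ld" unfolding x_def using t r transversalD(1)[OF R(1)] L_sub_Ld subgrpD(4)[OF subLd] by blast
    have inj: "inj_on ((*\<^sub>R) (of_int c :: real)) L" using c0 by (auto intro: inj_onI)
    have "(\<Sum>\<^sub>\<infinity>h\<in>scaled c. theta_term ?g z' (x + h)) = (\<Sum>\<^sub>\<infinity>l\<in>L. theta_term ?g z' (x + of_int c *\<^sub>R l))"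
      using infsum_reindex[OF inj, of "\<lambda>h. theta_term ?g z' (x + h)"] by (simp add: o_def)
    also have "\<dots> = (\<Sum>\<^sub>\<infinity>l\<in>L. ee (of_real (of_int a * quad B x / of_int c)) * theta_term \<sigma> (of_int c *s z') ((1 / of_int c) *\<^sub>R x + l))"
    proof (rule infsum_cong)
      fix l assume l: "l \<in> L"
      have e: "x + of_int c *\<^sub>R l = of_int c *\<^sub>R ((1 / of_int c) *\<^sub>R x + l)" using c0 by (simp add: scaleR_right_distrib)
      have "theta_term \<tau>' z' (x + of_int c *\<^sub>R l) = theta_term (of_real ((of_int c)\<^sup>2) * \<tau>') (of_real (of_int c) *s z') ((1 / of_int c) *\<^sub>R x + l)"
        unfolding e theta_term_scale_arg ..
      also have "of_real ((of_int c)\<^sup>2) * \<tau>' = \<sigma>" unfolding \<sigma>_def \<tau>'_def using c0 w0 by (simp add: field_simps power2_eq_square)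
      finally have 1: "theta_term \<tau>' z' (x + of_int c *\<^sub>R l) = theta_term \<sigma> (of_int c *s z') ((1 / of_int c) *\<^sub>R x + l)" by simp
      have 2: "ee (of_real (of_int a / of_int c * quad B (x + of_int c *\<^sub>R l))) = ee (of_real (of_int a * quad B x / of_int c))"
        using quad_cong_scaled[OF x l c0(1), of a] by (intro ee_cong) simp
      show "theta_term ?g z' (x + of_int c *\<^sub>R l) = ee (of_real (of_int a * quad B x / of_int c)) * theta_term \<sigma> (of_int c *s z') ((1 / of_int c) *\<^sub>R x + l)"
        unfolding gt theta_term_add_real 1 2 ..
    qed
    also have "\<dots> = ee (of_real (of_int a * quad B x / of_int c)) * (K * (\<Sum>\<^sub>\<infinity>u\<in>Ld. ee (of_real (B u ((1 / of_int c) *\<^sub>R x))) * ee (- cquad B (of_int c *s z' - cvec u) / \<sigma>)))"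
      unfolding infsum_cmult_right' theta_poisson[OF Im\<sigma>] K_def ..
    \<comment> \<open>The substitution u -> -u gives the product with z the sign that it has in
      \<open>theta_term\<close>; the minus sign moves to the character, as in
      \<open>theta_coeff\<close>.\<close>
    also have "(\<Sum>\<^sub>\<infinity>u\<in>Ld. ee (of_real (B u ((1 / of_int c) *\<^sub>R x))) * ee (- cquad B (of_int c *s z' - cvec u) / \<sigma>))
      = (\<Sum>\<^sub>\<infinity>u\<in>Ld. ee (of_real (B (- u) ((1 / of_int c) *\<^sub>R x))) * ee (- cquad B (of_int c *s z' - cvec (- u)) / \<sigma>))"
    proof -
      have "bij_betw uminus Ld Ld" 
        by (rule bij_betw_byWitness[of _ uminus]) (use subgrpD(3)[OF subLd] in auto)
      from infsum_reindex_bij_betw[OF this, of "\<lambda>u. ee (of_real (B u ((1 / of_int c) *\<^sub>R x))) * ee (- cquad B (of_int c *s z' - cvec u) / \<sigma>)"]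
      show ?thesis by (rule sym)
    qed
    also have "\<dots> = (\<Sum>\<^sub>\<infinity>u\<in>Ld. ee (of_int c / w * cquad B z) * (ee (of_real ((- B u x + of_int d * quad B u) / of_int c)) * theta_term \<tau> z u))"
    proof (rule infsum_cong)
      fix u
      have "cquad B (of_int c *s z' - cvec (- u)) = (of_int c / w)\<^sup>2 * cquad B z + of_int c / w * cbilin B (cvec u) z + of_real (quad B u)"
        using cquad_add[of "of_int c *s z'" "cvec u"] cbilin_sym[of z "cvec u"] by (simp add: cquad_scale z'_def power_divide)
      then have q: "- cquad B (of_int c *s z' - cvec (- u)) / \<sigma> = of_int c / w * cquad B z + cbilin B (cvec u) z + w / of_int c * of_real (quad B u)"
        unfolding \<sigma>_def using w0 c0 by (simp add: field_simps power2_eq_square)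
      have w': "w / of_int c = \<tau> + of_int d / of_int c" unfolding w using c0 by (simp add: field_simps)
      show "ee (of_real (B (- u) ((1 / of_int c) *\<^sub>R x))) * ee (- cquad B (of_int c *s z' - cvec (- u)) / \<sigma>)
        = ee (of_int c / w * cquad B z) * (ee (of_real ((- B u x + of_int d * quad B u) / of_int c)) * theta_term \<tau> z u)"
      proof -
        have r1: "B (- u) ((1 / of_int c) *\<^sub>R x) = - B u x / of_int c" by simp
        have r2: "complex_of_real ((- B u x + of_int d * quad B u) / of_int c) = of_real (- B u x / of_int c) + of_int d / of_int c * of_real (quad B u)"
          by (simp add: add_divide_distrib diff_divide_distrib)
        have "\<And>p X Y e q. p + (X + Y + (\<tau> + e) * q) = X + (p + e * q + (\<tau> * q + Y))" by (simp add: distrib_right)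
        then show ?thesis unfolding q w' theta_term_def ee_add[symmetric] r1 r2 by (rule arg_cong)
      qed
    qed
    also have "\<dots> = ee (of_int c / w * cquad B z) * (\<Sum>\<^sub>\<infinity>u\<in>Ld. ee (of_real ((- B u x + of_int d * quad B u) / of_int c)) * theta_term \<tau> z u)"
      by (rule infsum_cmult_right')
    also have "ee (of_real (of_int a * quad B x / of_int c)) * (K * (ee (of_int c / w * cquad B z) * (\<Sum>\<^sub>\<infinity>u\<in>Ld. ee (of_real ((- B u x + of_int d * quad B u) / of_int c)) * theta_term \<tau> z u)))
       = K * ee (of_int c / w * cquad B z) * (\<Sum>\<^sub>\<infinity>u\<in>Ld. ee (of_real (of_int a * quad B x / of_int c)) * (ee (of_real ((- B u x + of_int d * quad B u) / of_int c)) * theta_term \<tau> z u))"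
      unfolding infsum_cmult_right' by simp
    also have "(\<Sum>\<^sub>\<infinity>u\<in>Ld. ee (of_real (of_int a * quad B x / of_int c)) * (ee (of_real ((- B u x + of_int d * quad B u) / of_int c)) * theta_term \<tau> z u))
      = (\<Sum>\<^sub>\<infinity>v\<in>Ld. ee (of_real ((of_int a * quad B x - B v x + of_int d * quad B v) / of_int c)) * theta_term \<tau> z v)"
    proof (rule infsum_cong)
      fix u
      have "ee (of_real (of_int a * quad B x / of_int c)) * ee (of_real ((- B u x + of_int d * quad B u) / of_int c)) = ee (of_real ((of_int a * quad B x - B u x + of_int d * quad B u) / of_int c))"
      proof -
        have "of_int a * quad B x / of_int c + (- B u x + of_int d * quad B u) / of_int c = (of_int a * quad B x - B u x + of_int d * quad B u) / of_int c"
          by (simp only: add_divide_distrib diff_divide_distrib)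
        then show ?thesis by (simp only: ee_add[symmetric] of_real_add[symmetric])
      qed
      then show "ee (of_real (of_int a * quad B x / of_int c)) * (ee (of_real ((- B u x + of_int d * quad B u) / of_int c)) * theta_term \<tau> z u)
        = ee (of_real ((of_int a * quad B x - B u x + of_int d * quad B u) / of_int c)) * theta_term \<tau> z u" by (simp only: mult.assoc[symmetric])
    qed
    finally show "(\<Sum>\<^sub>\<infinity>h\<in>scaled c. theta_term ?g z' (t + r + h)) = K * ee (of_int c / w * cquad B z) * (\<Sum>\<^sub>\<infinity>v\<in>Ld. ee (of_real ((of_int a * quad B (t + r) - B v (t + r) + of_int d * quad B v) / of_int c)) * theta_term \<tau> z v)"
      unfolding x_def .
  qed
  also have "\<dots> = K * ee (of_int c / w * cquad B z) * (\<Sum>\<^sub>\<infinity>v\<in>Ld. theta_coeff a c d R t v * theta_term \<tau> z v)"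
    unfolding sum_distrib_left[symmetric] theta_coeff_def sum_distrib_right
    by (subst infsum_sum_swap[OF R(2) summable_on_ee_mult[OF theta_term_summable[OF \<tau> order_refl, of z]]]) (rule refl)
  finally have T: "theta B L t ?g (\<chi> i. z $ i / w) = K * ee (of_int c / w * cquad B z) * (\<Sum>\<^sub>\<infinity>v\<in>Ld. theta_coeff a c d R t v * theta_term \<tau> z v)" .
  have e1: "ee (- (of_int c / w) * cquad B z) * ee (of_int c / w * cquad B z) = 1"
    unfolding ee_add[symmetric] by (simp add: ee_def)
  have "w powr (- (of_nat CARD('n) / 2)) * ee (- (of_int c / w) * cquad B z) * theta B L t ?g (\<chi> i. z $ i / w)
    = (ee (- (of_int c / w) * cquad B z) * ee (of_int c / w * cquad B z)) * (w powr (- (of_nat CARD('n) / 2)) * K) * (\<Sum>\<^sub>\<infinity>v\<in>Ld. theta_coeff a c d R t v * theta_term \<tau> z v)"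
    unfolding T by (simp only: mult_ac)
  also have "w powr (- (of_nat CARD('n) / 2)) * K = (- \<i>) powr (of_nat CARD('n) / 2) * of_real (of_int c powr (- (real CARD('n) / 2))) / of_real (sqrt (disc B L))"
    using powr_i_over[OF Imw c0(2), of "CARD('n)"] unfolding K_def \<sigma>_def by (simp only: times_divide_eq_right of_real_of_int_eq)
  finally show ?thesis unfolding e1 mult_1 .
qed


section \<open>Gauss sums of lattices\<close>

text \<open>An arbitrary fixed choice, from which \<open>gauss_transversal\<close> frees the Gauss
  sums.\<close>

definition coset_reps :: "int \<Rightarrow> (real ^ 'n) set" where
  "coset_reps c = (SOME R. transversal R L (scaled c))"

lemma sub_scaled: "subgrp (scaled c)" "scaled c \<subseteq> L"
  using subgrp_scaled[OF subL] subgrp_of_int_scale[OF subL] by auto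

lemma coset_reps:
  assumes "c > 0"
  shows "transversal (coset_reps c) L (scaled c)" "finite (coset_reps c)" "card (coset_reps c) = nat c ^ CARD('n)"
proof -
  obtain R where R: "transversal R L (scaled c)" "card R = nat c ^ CARD('n)" "finite R"
    using lattice_transversal_scaled[OF lat assms] .
  show t: "transversal (coset_reps c) L (scaled c)" unfolding coset_reps_def using R(1) by (rule someI)
  show "finite (coset_reps c)" "card (coset_reps c) = nat c ^ CARD('n)"
    using transversal_card_eq[OF sub_scaled(1) t R(1)] R by auto
qed

definition gauss :: "int \<Rightarrow> int \<Rightarrow> complex" where
  "gauss a c = (\<Sum>r\<in>coset_reps c. ee (of_real (of_int a * quad B r / of_int c)))"

lemma gauss_term_cong:
  assumes "x \<in> L" "y \<in> L" "x - y \<in> scaled c" "c \<noteq> 0"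
  shows "ee (of_real (of_int a * quad B x / of_int c)) = ee (of_real (of_int a * quad B y / of_int c))"
proof -
  obtain l where l: "l \<in> L" "x - y = of_int c *\<^sub>R l" using assms(3) by blast
  then have "x = y + of_int c *\<^sub>R l" by (metis add_diff_cancel_left' diff_add_cancel add.commute)
  then show ?thesis using quad_cong_scaled[of y l c a] assms l L_sub_Ld by (intro ee_cong) auto
qed

lemma gauss_transversal:
  assumes "c > 0" "transversal R L (scaled c)"
  shows "gauss a c = (\<Sum>r\<in>R. ee (of_real (of_int a * quad B r / of_int c)))"
  unfolding gauss_def
  by (rule transversal_sum_eq[OF sub_scaled(1) coset_reps(1)[OF assms(1)] assms(2) gauss_term_cong]) (use assms in auto)

lemma gauss_cong:
  assumes "c > 0" "[a = a'] (mod c)"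
  shows "gauss a c = gauss a' c"
  unfolding gauss_def
proof (rule sum.cong[OF refl], rule ee_cong)
  fix r assume "r \<in> coset_reps c"
  then have "r \<in> L" using transversalD(1)[OF coset_reps(1)[OF assms(1)]] by blast
  obtain k where "a - a' = c * k" using assms(2) by (metis cong_iff_dvd_diff dvdE)
  then have "of_int a - of_int a' = (of_int c * of_int k :: real)" by (metis of_int_diff of_int_mult)
  moreover have "of_int a * quad B r / of_int c - of_int a' * quad B r / of_int c = (of_int a - of_int a') * quad B r / of_int c"
    by (simp add: algebra_simps diff_divide_distrib)
  ultimately have "of_int a * quad B r / of_int c - of_int a' * quad B r / of_int c = of_int k * quad B r"
    using assms(1) by simp
  then show "of_int a * quad B r / of_int c - of_int a' * quad B r / of_int c \<in> \<int>"
    using quad_int[OF \<open>r \<in> L\<close>] by simp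
qed

lemma gauss_minus: "gauss (- a) c = cnj (gauss a c)"
proof -
  have 1: "ee (of_real (- x)) = cnj (ee (of_real x))" for x by (simp add: ee_def exp_cnj)
  show ?thesis unfolding gauss_def cnj_sum 1[symmetric] by simp
qed

lemma gauss_1: "gauss a 1 = 1"
proof -
  have "r \<in> L" if "r \<in> coset_reps 1" for r using transversalD(1)[OF coset_reps(1)[of 1]] that by simp
  then have "ee (of_real (of_int a * quad B r / of_int 1)) = 1" if "r \<in> coset_reps 1" for r
    using quad_int that by (intro ee_Ints) auto
  then have "gauss a 1 = (\<Sum>r\<in>coset_reps 1. 1)" unfolding gauss_def by (intro sum.cong refl)
  then show ?thesis using coset_reps(3)[of 1] by simp
qed

text \<open>Completing the square with c c' = 1 + a N j. As N maps the dual lattice into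
  \<open>L\<close>, the coset of t contains c c' t, and v differs from c c' v by a times a vector m
  of \<open>L\<close>. Translating by -m then absorbs the linear term. The congruence is taken
  modulo a N, not N, to obtain this factor a.\<close>

lemma theta_coeff_eq:
  fixes a b c d c' :: int
  assumes det: "a * d - b * c = 1" and c: "c > 0" and a0: "a \<noteq> 0"
    and inv: "[c * c' = 1] (mod (a * N))" and t: "t \<in> Ld" and v: "v \<in> Ld"
  shows "theta_coeff a c d (coset_reps c) t v = ee (of_real (of_int (b + c') / of_int a * quad B v - of_int c' * B t v + of_int a * of_int c' * quad B t)) * gauss a c"
proof -
  obtain j where j: "c * c' = 1 + a * N * j" using inv by (metis cong_iff_lin cong_sym)
  have jr: "of_int c * of_int c' = (1 + of_int a * of_int N * of_int j :: real)"
    using arg_cong[OF j, of real_of_int] by simp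
  have c0: "(of_int c :: real) \<noteq> 0" "(of_int a :: real) \<noteq> 0" using c a0 by auto
  note R = coset_reps(1)[OF c]
  define f where "f x = ee (of_real ((of_int a * quad B x - B v x + of_int d * quad B v) / of_int c))" for x
  have fcong: "f (t + x) = f (t + y)" if xy: "x \<in> L" "y \<in> L" "x - y \<in> scaled c" for x y
  proof -
    obtain l where l: "l \<in> L" "x - y = of_int c *\<^sub>R l" using xy(3) by blast
    then have x: "t + x = (t + y) + of_int c *\<^sub>R l" by (metis add.assoc add.commute diff_add_cancel)
    have ty: "t + y \<in> Ld" using t xy L_sub_Ld subgrpD(4)[OF subLd] by blast
    have "(of_int a * quad B (t + x) - B v (t + x) + of_int d * quad B v) / of_int c - (of_int a * quad B (t + y) - B v (t + y) + of_int d * quad B v) / of_int c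
      = (of_int a * quad B ((t + y) + of_int c *\<^sub>R l) / of_int c - of_int a * quad B (t + y) / of_int c) - B v l"
      unfolding x using c0 by (simp add: add_divide_distrib diff_divide_distrib)
    also have "\<dots> \<in> \<int>" by (rule Ints_diff[OF quad_cong_scaled[OF ty l(1)] B_dual_int(1)[OF v l(1)]]) (use c in simp)
    finally show ?thesis unfolding f_def by (rule ee_cong)
  qed
  \<comment> \<open>The corrections to t and v: t + s = c c' t and v = c c' v + a m.\<close>
  define s where "s = of_int (a * j) *\<^sub>R (of_int N *\<^sub>R t)"
  define m where "m = - (of_int j *\<^sub>R (of_int N *\<^sub>R v))"
  have s: "s \<in> L" unfolding s_def using level_mult[OF t] subgrp_of_int_scale[OF subL] by blast
  have m: "m \<in> L" unfolding m_def using level_mult[OF v] subgrp_of_int_scale[OF subL] subgrpD(3)[OF subL] by blast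
  define e where "e = (of_int c * of_int c' :: real)"
  have e: "e = 1 + of_int a * of_int N * of_int j" unfolding e_def by (rule jr)
  have ts: "t + s = e *\<^sub>R t" unfolding s_def e by (simp add: scaleR_left_distrib mult_ac)
  have vm: "v = e *\<^sub>R v + of_int a *\<^sub>R m" unfolding m_def e by (simp add: scaleR_left_distrib mult_ac)
  have "theta_coeff a c d (coset_reps c) t v = (\<Sum>r\<in>coset_reps c. f (t + r))" unfolding theta_coeff_def f_def ..
  also have "\<dots> = (\<Sum>r\<in>(+) s ` coset_reps c. f (t + r))"
    by (rule transversal_sum_eq[OF sub_scaled(1) R transversal_shift[OF subL R s] fcong])
  also have "\<dots> = (\<Sum>r\<in>coset_reps c. f (e *\<^sub>R t + r))"
    by (subst sum.reindex) (auto simp: o_def ts[symmetric] add.assoc)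
  also have "\<dots> = (\<Sum>r\<in>coset_reps c. ee (of_real (of_int (b + c') / of_int a * quad B v - of_int c' * B t v + of_int a * of_int c' * quad B t))
      * ee (of_real (of_int a * quad B (- m + r) / of_int c)))"
  proof (rule sum.cong[OF refl])
    fix r assume "r \<in> coset_reps c"
    then have r: "r \<in> L" using transversalD(1)[OF R] by blast
    \<comment> \<open>What the exponent contains beyond the target. Each summand is integral: t and
      v pair integrally with \<open>L\<close>, and N clears the denominators of Q on the dual
      lattice.\<close>
    define I where "I = of_int a * of_int c' * B t r - of_int c' * B v r
       + of_int c' * of_int a * of_int a * of_int j * (of_int N * quad B t) - of_int c' * of_int j * (of_int N * quad B v)"
    have "I \<in> \<int>"
    proof -
      obtain i1 i2 i3 i4 where "B t r = of_int i1" "B v r = of_int i2" "of_int N * quad B t = of_int i3" "of_int N * quad B v = of_int i4"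
        using B_dual_int(1)[OF t r] B_dual_int(1)[OF v r] level(2)[OF t] level(2)[OF v] by (metis Ints_cases)
      then have "I = of_int (a * c' * i1 - c' * i2 + c' * a * a * j * i3 - c' * j * i4)" unfolding I_def by (simp only: of_int_add of_int_diff of_int_mult)
      then show ?thesis by simp
    qed
    have E: "e / of_int c = of_int c'" unfolding e_def using c0 by simp
    have t1: "of_int a * quad B (e *\<^sub>R t + r) / of_int c = of_int a * of_int c' * e * quad B t + of_int a * of_int c' * B t r + of_int a * quad B r / of_int c"
      unfolding E[symmetric] using c0 B_sym[of r t] by (simp add: quad_add quad_scale field_simps power2_eq_square)
    have t2: "B v (e *\<^sub>R t + r) / of_int c = of_int c' * B t v + of_int c' * B v r + of_int a * B m r / of_int c"
    proof -
      have "B v r = e * B v r + of_int a * B m r" by (subst vm) simp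
      then have "B v (e *\<^sub>R t + r) = e * B t v + (e * B v r + of_int a * B m r)" by (simp add: B_sym[of v t])
      then show ?thesis unfolding E[symmetric] using c0 by (simp add: field_simps)
    qed
    have t3: "of_int a * quad B (- m + r) / of_int c = of_int a * quad B r / of_int c - of_int a * B m r / of_int c + of_int a * quad B m / of_int c"
      unfolding quad_add using c0 by (simp add: field_simps)
    have qm: "of_int a * quad B m / of_int c = (e - 1)\<^sup>2 / (of_int a * of_int c) * quad B v"
      unfolding m_def e using c0 by (simp add: quad_scale field_simps power2_eq_square)
    \<comment> \<open>The quotient (b + c') / a arises here, from a d = 1 + b c.\<close>
    have dd: "of_int d * quad B v / of_int c - (e - 1)\<^sup>2 / (of_int a * of_int c) * quad B v
        = of_int (b + c') / of_int a * quad B v - of_int c' * of_int j * (of_int N * quad B v)"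
    proof -
      have ad: "of_int a * of_int d = (1 + of_int b * of_int c :: real)" 
        using arg_cong[OF det, of real_of_int] by simp
      have "of_int d / of_int c - (e - 1)\<^sup>2 / (of_int a * of_int c) = (of_int a * of_int d - (e - 1)\<^sup>2) / (of_int a * of_int c)"
        using c0 by (simp add: field_simps)
      also have "of_int a * of_int d - (e - 1)\<^sup>2 = of_int c * (of_int (b + c') - of_int c' * (e - 1))"
        unfolding ad by (simp add: e_def algebra_simps power2_eq_square)
      also have "\<dots> / (of_int a * of_int c) = of_int (b + c') / of_int a - of_int c' * ((e - 1) / of_int a)"
        using c0 by (simp add: field_simps)
      also have "(e - 1) / of_int a = of_int N * of_int j" unfolding e using c0 by simp
      finally have "of_int d / of_int c - (e - 1)\<^sup>2 / (of_int a * of_int c) = of_int (b + c') / of_int a - of_int c' * (of_int N * of_int j)" .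
      from arg_cong[OF this, of "\<lambda>x. x * quad B v"] show ?thesis by (simp add: algebra_simps)
    qed
    have "(of_int a * quad B (e *\<^sub>R t + r) - B v (e *\<^sub>R t + r) + of_int d * quad B v) / of_int c
       = of_int a * quad B (e *\<^sub>R t + r) / of_int c - B v (e *\<^sub>R t + r) / of_int c + of_int d * quad B v / of_int c"
      by (simp only: add_divide_distrib diff_divide_distrib)
    also have "\<dots> = of_int (b + c') / of_int a * quad B v - of_int c' * B t v + of_int a * of_int c' * quad B t
        + of_int a * quad B (- m + r) / of_int c + I"
    proof -
      have "of_int a * of_int c' * e * quad B t = of_int a * of_int c' * quad B t + of_int a * (of_int c' * of_int a * of_int j * (of_int N * quad B t))"
        unfolding e by (simp add: algebra_simps)
      note 1 = this
      show ?thesis using dd unfolding t1 t2 t3 qm 1 I_def by (simp add: algebra_simps)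
    qed
    finally have "(of_int a * quad B (e *\<^sub>R t + r) - B v (e *\<^sub>R t + r) + of_int d * quad B v) / of_int c
       - (of_int (b + c') / of_int a * quad B v - of_int c' * B t v + of_int a * of_int c' * quad B t
        + of_int a * quad B (- m + r) / of_int c) = I" by simp
    then have "f (e *\<^sub>R t + r) = ee (of_real (of_int (b + c') / of_int a * quad B v - of_int c' * B t v + of_int a * of_int c' * quad B t
        + of_int a * quad B (- m + r) / of_int c))"
      unfolding f_def using \<open>I \<in> \<int>\<close> by (intro ee_cong) (simp only:)
    then show "f (e *\<^sub>R t + r) = ee (of_real (of_int (b + c') / of_int a * quad B v - of_int c' * B t v + of_int a * of_int c' * quad B t))
      * ee (of_real (of_int a * quad B (- m + r) / of_int c))" by (simp only: of_real_add ee_add)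
  qed
  also have "\<dots> = ee (of_real (of_int (b + c') / of_int a * quad B v - of_int c' * B t v + of_int a * of_int c' * quad B t))
      * (\<Sum>r\<in>(+) (- m) ` coset_reps c. ee (of_real (of_int a * quad B r / of_int c)))"
    unfolding sum_distrib_left[symmetric] by (subst sum.reindex) (auto simp: o_def)
  also have "(\<Sum>r\<in>(+) (- m) ` coset_reps c. ee (of_real (of_int a * quad B r / of_int c))) = gauss a c"
    by (rule gauss_transversal[OF c transversal_shift[OF subL R subgrpD(3)[OF subL m]], symmetric])
  finally show ?thesis .
qed

lemma theta_modular_gauss:
  fixes a b c d c' :: int
  assumes "a * d - b * c = 1" "c > 0" "a \<noteq> 0" "[c * c' = 1] (mod (a * N))" "t \<in> Ld" "Im \<tau> > 0"
    and w: "w = of_int c * \<tau> + of_int d"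
  shows "w powr (- (of_nat CARD('n) / 2)) * ee (- (of_int c / w) * cquad B z)
          * theta B L t ((of_int a * \<tau> + of_int b) / w) (\<chi> i. z $ i / w)
        = (- \<i>) powr (of_nat CARD('n) / 2) * of_real (of_int c powr (- (real CARD('n) / 2))) / of_real (sqrt (disc B L)) * gauss a c *
          (\<Sum>\<^sub>\<infinity>v\<in>Ld. ee (of_real (of_int (b + c') / of_int a * quad B v - of_int c' * B t v + of_int a * of_int c' * quad B t))
             * ee (\<tau> * of_real (quad B v)) * ee (cbilin B (cvec v) z))"
proof -
  have "(\<Sum>\<^sub>\<infinity>v\<in>Ld. theta_coeff a c d (coset_reps c) t v * theta_term \<tau> z v) = 
     (\<Sum>\<^sub>\<infinity>v\<in>Ld. gauss a c * (ee (of_real (of_int (b + c') / of_int a * quad B v - of_int c' * B t v + of_int a * of_int c' * quad B t))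
             * ee (\<tau> * of_real (quad B v)) * ee (cbilin B (cvec v) z)))"
  proof (rule infsum_cong)
    fix v assume v: "v \<in> Ld"
    show "theta_coeff a c d (coset_reps c) t v * theta_term \<tau> z v = gauss a c * (ee (of_real (of_int (b + c') / of_int a * quad B v - of_int c' * B t v + of_int a * of_int c' * quad B t))
             * ee (\<tau> * of_real (quad B v)) * ee (cbilin B (cvec v) z))"
      unfolding theta_coeff_eq[OF assms(1-5) v] theta_term_def ee_add by (simp only: mult_ac)
  qed
  then show ?thesis
    using theta_modular[OF assms(1,2,6,5) coset_reps(1,2)[OF assms(2)] w, of z] by (simp only: infsum_cmult_right' mult.assoc)
qed

lemma transversal_unit:
  assumes R: "transversal R L (scaled c)" and u: "coprime u c"
  shows "transversal ((*\<^sub>R) (of_int u) ` R) L (scaled c)"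
    and "u \<noteq> 0 \<Longrightarrow> inj_on ((*\<^sub>R) (of_int u)) R"
proof -
  obtain u' k where "u * u' + c * k = 1" using u by (metis bezout_int coprime_imp_gcd_eq_1 mult.commute)
  then have uk: "of_int u * of_int u' + of_int c * of_int k = (1::real)" by (metis of_int_1 of_int_add of_int_mult)
  have key: "x = of_int u' *\<^sub>R (of_int u *\<^sub>R x) + of_int c *\<^sub>R (of_int k *\<^sub>R x)" for x :: "real ^ 'n"
    using uk by (simp add: scaleR_left_distrib[symmetric] mult.commute)
  have cL: "of_int c *\<^sub>R (of_int i *\<^sub>R x) \<in> scaled c" if "x \<in> L" for x i
    using subgrp_of_int_scale[OF subL that] by blast
  show "transversal ((*\<^sub>R) (of_int u) ` R) L (scaled c)"
  proof (rule transversalI[OF sub_scaled(1)])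
    show "(*\<^sub>R) (of_int u) ` R \<subseteq> L" using transversalD(1)[OF R] subgrp_of_int_scale[OF subL] by blast
    fix x assume x: "x \<in> L"
    then have "of_int u' *\<^sub>R x \<in> L" using subgrp_of_int_scale[OF subL] by blast
    then obtain r where r: "r \<in> R" "of_int u' *\<^sub>R x - r \<in> scaled c" using transversalD(2)[OF R] by blast
    have "x - of_int u *\<^sub>R r = of_int u *\<^sub>R (of_int u' *\<^sub>R x - r) + of_int c *\<^sub>R (of_int k *\<^sub>R x)"
    proof -
      have "x = of_int u *\<^sub>R (of_int u' *\<^sub>R x) + of_int c *\<^sub>R (of_int k *\<^sub>R x)" using key[of x] by (simp add: mult.commute)
      then show ?thesis by (simp add: scaleR_right_diff_distrib)
    qed
    also have "\<dots> \<in> scaled c"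
      by (intro subgrpD(4)[OF sub_scaled(1)] subgrp_of_int_scale[OF sub_scaled(1)] r(2) cL x)
    finally show "\<exists>r\<in>(*\<^sub>R) (of_int u) ` R. x - r \<in> scaled c" using r(1) by blast
  next
    fix r s assume "r \<in> (*\<^sub>R) (of_int u) ` R" "s \<in> (*\<^sub>R) (of_int u) ` R" and d: "r - s \<in> scaled c"
    then obtain r' s' where rs: "r' \<in> R" "s' \<in> R" "r = of_int u *\<^sub>R r'" "s = of_int u *\<^sub>R s'" by blast
    have "r' - s' = of_int u' *\<^sub>R (r - s) + of_int c *\<^sub>R (of_int k *\<^sub>R (r' - s'))"
      using key[of "r' - s'"] unfolding rs scaleR_right_diff_distrib .
    also have "\<dots> \<in> scaled c"
      by (intro subgrpD(4)[OF sub_scaled(1)] subgrp_of_int_scale[OF sub_scaled(1)] d cL subgrpD(2)[OF subL] transversalD(1)[OF R] rs(1,2))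
    finally have "r' = s'" by (rule transversalD(3)[OF R sub_scaled(1) rs(1,2)])
    then show "r = s" using rs by simp
  qed
  show "inj_on ((*\<^sub>R) (of_int u)) R" if "u \<noteq> 0" using that by (auto intro: inj_onI)
qed

text \<open>Chinese remainders: c2 r + c1 s runs over \<open>L\<close> modulo c1 c2, and the mixed
  term a B r s of the exponent is an integer.\<close>

lemma gauss_mult:
  assumes c: "c1 > 0" "c2 > 0" "coprime c1 c2"
  shows "gauss a (c1 * c2) = gauss (a * c2) c1 * gauss (a * c1) c2"
proof -
  let ?R1 = "(*\<^sub>R) (of_int c2) ` coset_reps c1" and ?R2 = "(*\<^sub>R) (of_int c1) ` coset_reps c2"
  have t1: "transversal ?R1 (scaled c2) (scaled (c1 * c2))"
    using transversal_scaled[OF coset_reps(1)[OF c(1)], of "of_int c2"] c by (simp add: image_image mult.commute)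
  have t2: "transversal ?R2 L (scaled c2)"
    by (rule transversal_unit[OF coset_reps(1)[OF c(2)] c(3)])
  have sub: "scaled (c1 * c2) \<subseteq> scaled c2"
  proof
    fix x assume "x \<in> scaled (c1 * c2)"
    then obtain l where l: "l \<in> L" "x = of_int (c1 * c2) *\<^sub>R l" by blast
    then have "x = of_int c2 *\<^sub>R (of_int c1 *\<^sub>R l)" by (simp add: mult.commute)
    then show "x \<in> scaled c2" using subgrp_of_int_scale[OF subL l(1)] by blast
  qed
  note P = transversal_prod[OF sub_scaled(1) sub_scaled(1) subL sub sub_scaled(2) t1 t2]
  have c12: "c1 * c2 > 0" using c by simp
  have "gauss a (c1 * c2) = (\<Sum>x\<in>(\<lambda>(r, s). r + s) ` (?R1 \<times> ?R2). ee (of_real (of_int a * quad B x / of_int (c1 * c2))))"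
    by (rule gauss_transversal[OF c12 P(1)])
  also have "\<dots> = (\<Sum>(r, s)\<in>?R1 \<times> ?R2. ee (of_real (of_int a * quad B (r + s) / of_int (c1 * c2))))"
    by (subst sum.reindex[OF P(2)]) (simp add: o_def case_prod_unfold)
  also have "\<dots> = (\<Sum>r\<in>?R1. \<Sum>s\<in>?R2. ee (of_real (of_int a * quad B (r + s) / of_int (c1 * c2))))"
    by (simp add: sum.cartesian_product)
  also have "\<dots> = (\<Sum>r\<in>coset_reps c1. \<Sum>s\<in>coset_reps c2. ee (of_real (of_int a * quad B (of_int c2 *\<^sub>R r + of_int c1 *\<^sub>R s) / of_int (c1 * c2))))"
    using c by (simp add: sum.reindex inj_on_def o_def)
  also have "\<dots> = (\<Sum>r\<in>coset_reps c1. \<Sum>s\<in>coset_reps c2. ee (of_real (of_int (a * c2) * quad B r / of_int c1)) * ee (of_real (of_int (a * c1) * quad B s / of_int c2)))"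
  proof (intro sum.cong refl)
    fix r s assume rs: "r \<in> coset_reps c1" "s \<in> coset_reps c2"
    then have L: "r \<in> L" "s \<in> L" using transversalD(1)[OF coset_reps(1)] c by auto
    have "of_int a * quad B (of_int c2 *\<^sub>R r + of_int c1 *\<^sub>R s) / of_int (c1 * c2)
      - (of_int (a * c2) * quad B r / of_int c1 + of_int (a * c1) * quad B s / of_int c2) = of_int a * B r s"
      using c B_sym[of s r] by (simp add: quad_add quad_scale field_simps power2_eq_square)
    also have "\<dots> \<in> \<int>" using B_int[OF L] by simp
    finally have "ee (of_real (of_int a * quad B (of_int c2 *\<^sub>R r + of_int c1 *\<^sub>R s) / of_int (c1 * c2)))
      = ee (of_real (of_int (a * c2) * quad B r / of_int c1 + of_int (a * c1) * quad B s / of_int c2))" by (rule ee_cong)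
    then show "ee (of_real (of_int a * quad B (of_int c2 *\<^sub>R r + of_int c1 *\<^sub>R s) / of_int (c1 * c2)))
      = ee (of_real (of_int (a * c2) * quad B r / of_int c1)) * ee (of_real (of_int (a * c1) * quad B s / of_int c2))"
      by (simp only: of_real_add ee_add)
  qed
  also have "\<dots> = gauss (a * c2) c1 * gauss (a * c1) c2" by (simp only: gauss_def sum_product)
  finally show ?thesis .
qed

text \<open>Residues are written as s + p^(k+1) r. Modulo 1 the exponent is linear in r, so by
  nondegeneracy the sum over r vanishes unless s lies in \<open>p L\<close>; then s = p s' leaves a
  sum modulo p^k. Working with Q rather than B keeps the argument valid for p = 2.\<close>

lemma gauss_prime_power:
  fixes p a :: int
  assumes p: "prime p" "coprime p N" "coprime a p"
  shows "gauss a (p ^ (k + 2)) = of_int p ^ CARD('n) * gauss a (p ^ k)"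
proof -
  have p0: "p > 0" "(of_int p :: real) > 0" using prime_gt_0_int[OF p(1)] by auto
  define c1 where "c1 = p ^ (k + 1)"
  have c1: "c1 > 0" "p ^ (k + 2) = p * c1" "c1 = p * p ^ k" "p ^ k > 0" using p0 by (auto simp: c1_def)
  let ?R1 = "(*\<^sub>R) (of_int c1) ` coset_reps p" and ?R2 = "coset_reps c1"
  have t1: "transversal ?R1 (scaled c1) (scaled (p * c1))"
    using transversal_scaled[OF coset_reps(1)[OF p0(1)], of "of_int c1"] c1(1) by (simp add: image_image mult.commute)
  have sub: "scaled (i * j) \<subseteq> scaled j" for i j
  proof
    fix x assume "x \<in> scaled (i * j)"
    then obtain l where l: "l \<in> L" "x = of_int (i * j) *\<^sub>R l" by blast
    then have "x = of_int j *\<^sub>R (of_int i *\<^sub>R l)" by (simp add: mult.commute)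
    then show "x \<in> scaled j" using subgrp_of_int_scale[OF subL l(1)] by blast
  qed
  note P = transversal_prod[OF sub_scaled(1) sub_scaled(1) subL sub sub_scaled(2) t1 coset_reps(1)[OF c1(1)]]
  have pc: "p * c1 > 0" using p0 c1 by simp
  have "gauss a (p * c1) = (\<Sum>x\<in>(\<lambda>(r, s). r + s) ` (?R1 \<times> ?R2). ee (of_real (of_int a * quad B x / of_int (p * c1))))"
    by (rule gauss_transversal[OF pc P(1)])
  also have "\<dots> = (\<Sum>(r, s)\<in>?R1 \<times> ?R2. ee (of_real (of_int a * quad B (r + s) / of_int (p * c1))))"
    by (subst sum.reindex[OF P(2)]) (simp add: o_def case_prod_unfold)
  also have "\<dots> = (\<Sum>r\<in>?R1. \<Sum>s\<in>?R2. ee (of_real (of_int a * quad B (r + s) / of_int (p * c1))))"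
    by (simp add: sum.cartesian_product)
  also have "\<dots> = (\<Sum>s\<in>?R2. \<Sum>r\<in>coset_reps p. ee (of_real (of_int a * quad B (of_int c1 *\<^sub>R r + s) / of_int (p * c1))))"
    using c1(1) by (subst sum.swap) (simp add: sum.reindex inj_on_def o_def)
  also have "\<dots> = (\<Sum>s\<in>?R2. ee (of_real (of_int a * quad B s / of_int (p * c1))) * (\<Sum>r\<in>coset_reps p. ee (of_real (of_int a * B s r / of_int p))))"
    unfolding sum_distrib_left
  proof (intro sum.cong refl)
    fix s r assume rs: "s \<in> ?R2" "r \<in> coset_reps p"
    then have L: "r \<in> L" "s \<in> L"
      using transversalD(1)[OF coset_reps(1)[OF c1(1)]] transversalD(1)[OF coset_reps(1)[OF p0(1)]] by blast+
    have "of_int a * quad B (of_int c1 *\<^sub>R r + s) / of_int (p * c1)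
      - (of_int a * quad B s / of_int (p * c1) + of_int a * B s r / of_int p) = of_int a * of_int c1 * quad B r / of_int p"
      using c1(1) p0 B_sym[of r s] by (simp add: quad_add quad_scale field_simps power2_eq_square)
    also have "\<dots> = of_int a * of_int (p ^ k) * quad B r" unfolding c1(3) using p0 by simp
    also have "\<dots> \<in> \<int>" using quad_int[OF L(1)] by (intro Ints_mult) auto
    finally have "ee (of_real (of_int a * quad B (of_int c1 *\<^sub>R r + s) / of_int (p * c1)))
      = ee (of_real (of_int a * quad B s / of_int (p * c1) + of_int a * B s r / of_int p))" by (rule ee_cong)
    then show "ee (of_real (of_int a * quad B (of_int c1 *\<^sub>R r + s) / of_int (p * c1)))
      = ee (of_real (of_int a * quad B s / of_int (p * c1))) * ee (of_real (of_int a * B s r / of_int p))"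
      by (simp only: of_real_add ee_add)
  qed
  also have "\<dots> = (\<Sum>s\<in>?R2. ee (of_real (of_int a * quad B s / of_int (p * c1))) * (if s \<in> scaled p then of_int p ^ CARD('n) else 0))"
  proof (intro sum.cong refl arg_cong2[where f = "(*)"])
    fix s assume "s \<in> ?R2"
    then have s: "s \<in> L" using transversalD(1)[OF coset_reps(1)] c1 by auto
    have pk: "of_int m / of_int p \<in> (\<int> :: real set) \<longleftrightarrow> p dvd m" for m
      by (rule of_int_divide_in_Ints_iff) (use p0 in simp)
    have cond: "(\<forall>x\<in>L. of_int a * B s x / of_int p \<in> \<int>) \<longleftrightarrow> s \<in> scaled p"
    proof
      assume l: "\<forall>x\<in>L. of_int a * B s x / of_int p \<in> \<int>"
      show "s \<in> scaled p"
      proof (rule nondegenerate[OF s _ p(2) p0(1)])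
        fix y assume y: "y \<in> L"
        obtain k where k: "B s y = of_int k" using B_int[OF s y] by (rule Ints_cases)
        have "of_int (a * k) / of_int p \<in> (\<int> :: real set)" using l y k by auto
        then have "p dvd a * k" unfolding pk .
        then have "p dvd k" using p(3) by (metis coprime_commute coprime_dvd_mult_right_iff)
        then show "B s y / of_int p \<in> \<int>" unfolding k pk .
      qed
    next
      assume "s \<in> scaled p"
      then obtain l where "l \<in> L" "s = of_int p *\<^sub>R l" by blast
      then show "\<forall>x\<in>L. of_int a * B s x / of_int p \<in> \<int>" using B_int p0 by simp
    qed
    have "(\<Sum>r\<in>coset_reps p. ee (of_real (of_int a * B s r / of_int p))) = (if \<forall>x\<in>L. of_int a * B s x / of_int p \<in> \<int> then of_nat (card (coset_reps p)) else 0)"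
    proof (rule transversal_character_sum[OF sub_scaled(1) subL coset_reps(1,2)[OF p0(1)] _ _ sub_scaled(2)])
      fix h assume "h \<in> scaled p"
      then obtain l where "l \<in> L" "h = of_int p *\<^sub>R l" by blast
      then show "of_int a * B s h / of_int p \<in> \<int>" using B_int[OF s] p0 by simp
    qed (simp add: distrib_left add_divide_distrib)
    then show "(\<Sum>r\<in>coset_reps p. ee (of_real (of_int a * B s r / of_int p))) = (if s \<in> scaled p then of_int p ^ CARD('n) else 0)"
      unfolding cond coset_reps(3)[OF p0(1)] using p0 by simp
  qed
  also have "\<dots> = of_int p ^ CARD('n) * (\<Sum>s\<in>?R2 \<inter> scaled p. ee (of_real (of_int a * quad B s / of_int (p * c1))))"
    using coset_reps(2)[OF c1(1)] by (simp add: sum.inter_restrict sum_distrib_left if_distrib mult.commute cong: if_cong)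
  also have "(\<Sum>s\<in>?R2 \<inter> scaled p. ee (of_real (of_int a * quad B s / of_int (p * c1)))) = gauss a (p ^ k)"
  proof -
    \<comment> \<open>The surviving representatives divided by p; they represent \<open>L\<close>
      modulo p^k.\<close>
    define R where "R = {x \<in> L. of_int p *\<^sub>R x \<in> ?R2}"
    have inj: "of_int p *\<^sub>R x \<in> scaled c1 \<longleftrightarrow> x \<in> scaled (p ^ k)" for x
    proof
      assume "of_int p *\<^sub>R x \<in> scaled c1"
      then obtain l where l: "l \<in> L" "of_int p *\<^sub>R x = of_int c1 *\<^sub>R l" by blast
      then have "of_int p *\<^sub>R x = of_int p *\<^sub>R (of_int (p ^ k) *\<^sub>R l)" unfolding c1(3) by simp
      then have "x = of_int (p ^ k) *\<^sub>R l" using p0 by (metis scaleR_left_imp_eq less_irrefl)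
      then show "x \<in> scaled (p ^ k)" using l by blast
    next
      assume "x \<in> scaled (p ^ k)"
      then obtain l where l: "l \<in> L" "x = of_int (p ^ k) *\<^sub>R l" by blast
      then have "of_int p *\<^sub>R x = of_int c1 *\<^sub>R l" unfolding c1(3) by simp
      then show "of_int p *\<^sub>R x \<in> scaled c1" using l by blast
    qed
    have tR: "transversal R L (scaled (p ^ k))"
    proof (rule transversalI[OF sub_scaled(1)])
      show "R \<subseteq> L" by (auto simp: R_def)
      fix x assume x: "x \<in> L"
      then have px: "of_int p *\<^sub>R x \<in> L" using subgrp_of_int_scale[OF subL] by blast
      then obtain r where r: "r \<in> ?R2" "of_int p *\<^sub>R x - r \<in> scaled c1" using transversalD(2)[OF coset_reps(1)[OF c1(1)]] by blast
      then obtain l where l: "l \<in> L" "of_int p *\<^sub>R x - r = of_int c1 *\<^sub>R l" by blast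
      define r' where "r' = x - of_int (p ^ k) *\<^sub>R l"
      have "r = of_int p *\<^sub>R x - of_int c1 *\<^sub>R l" using l(2) by (simp add: algebra_simps)
      then have rr: "r = of_int p *\<^sub>R r'" unfolding r'_def c1(3) by (simp add: scaleR_right_diff_distrib)
      have "r' \<in> L" unfolding r'_def by (intro subgrpD(2)[OF subL] x subgrp_of_int_scale[OF subL] l)
      then have "r' \<in> R" unfolding R_def using r rr by blast
      moreover have "x - r' = of_int (p ^ k) *\<^sub>R l" by (simp add: r'_def)
      then have "x - r' \<in> scaled (p ^ k)" using l(1) by blast
      ultimately show "\<exists>r\<in>R. x - r \<in> scaled (p ^ k)" by blast
    next
      fix r s assume rs: "r \<in> R" "s \<in> R" "r - s \<in> scaled (p ^ k)"
      then have "of_int p *\<^sub>R r - of_int p *\<^sub>R s \<in> scaled c1" using inj[of "r - s"] by (simp add: scaleR_right_diff_distrib)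
      then have "of_int p *\<^sub>R r = of_int p *\<^sub>R s"
        using transversalD(3)[OF coset_reps(1)[OF c1(1)] sub_scaled(1)] rs unfolding R_def by blast
      then show "r = s" using p0 by (metis scaleR_left_imp_eq less_irrefl)
    qed
    have im: "?R2 \<inter> scaled p = (*\<^sub>R) (of_int p) ` R" unfolding R_def by blast
    have "(\<Sum>s\<in>?R2 \<inter> scaled p. ee (of_real (of_int a * quad B s / of_int (p * c1)))) = (\<Sum>r\<in>R. ee (of_real (of_int a * quad B (of_int p *\<^sub>R r) / of_int (p * c1))))"
      unfolding im using p0 by (subst sum.reindex) (auto simp: inj_on_def)
    also have "\<dots> = (\<Sum>r\<in>R. ee (of_real (of_int a * quad B r / of_int (p ^ k))))"
      using p0 c1(4) by (simp add: quad_scale c1(3) power2_eq_square)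
    finally show ?thesis using gauss_transversal[OF c1(4) tR, of a] by simp
  qed
  finally show ?thesis unfolding c1(2) .
qed


section \<open>Reciprocity by comparison of constant terms\<close>

lemma theta_term_imaginary: "theta_term (\<i> * of_real y) 0 v = of_real (exp (- 2 * pi * y * quad B v))"
  by (simp add: theta_term_def ee_def exp_of_real[symmetric] mult_ac)

text \<open>Q takes values in (1/N) Z on the dual lattice. This gap makes all nonconstant terms
  decay uniformly in \<open>constant_term_zero\<close>.\<close>

lemma quad_dual_ge: "v \<in> Ld \<Longrightarrow> v \<noteq> 0 \<Longrightarrow> quad B v \<ge> 1 / of_int N"
proof -
  assume v: "v \<in> Ld" "v \<noteq> 0"
  obtain k where k: "of_int N * quad B v = of_int k" using level(2)[OF v(1)] by (rule Ints_cases)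
  have N: "(of_int N :: real) > 0" using level(1) by simp
  then have "of_int k > (0::real)" using quad_pos[OF v(2)] k by (metis mult_pos_pos)
  then have "of_int k \<ge> (1::real)" by simp
  then show ?thesis using k N by (simp add: field_simps)
qed

text \<open>As the imaginary part tends to infinity only the constant term survives.\<close>

lemma constant_term_zero:
  fixes \<alpha> :: "real ^ 'n \<Rightarrow> complex"
  assumes bnd: "\<And>v. v \<in> Ld \<Longrightarrow> norm (\<alpha> v) \<le> C"
    and zero: "\<And>y. y > 0 \<Longrightarrow> (\<Sum>\<^sub>\<infinity>v\<in>Ld. \<alpha> v * theta_term (\<i> * of_real y) 0 v) = 0"
  shows "\<alpha> 0 = 0"
proof -
  have z: "0 \<in> Ld" by (rule subgrpD(1)[OF subLd])
  have C0: "C \<ge> 0" using bnd[OF z] norm_ge_zero order_trans by blast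
  define m where "m = 1 / real_of_int N"
  have m: "m > 0" using level(1) by (simp add: m_def)
  define M where "M = (\<Sum>\<^sub>\<infinity>v\<in>Ld - {0}. exp (- 2 * pi * quad B v))"
  have sm1: "(\<lambda>v. exp (- 2 * pi * quad B v)) summable_on Ld - {0}"
    using theta_term_summable[of "\<i> * of_real 1" "Ld - {0}" 0] unfolding theta_term_imaginary by simp
  have M0: "M \<ge> 0" unfolding M_def by (intro infsum_nonneg) simp
  \<comment> \<open>Of the weight y, the part y - 1 is spent on the gap \<open>m\<close> and yields
    the decay, while the remaining 1 keeps the series convergent.\<close>
  have bound: "norm (\<alpha> 0) \<le> exp (- 2 * pi * m * (y - 1)) * (C * M)" if y: "y > 1" for y
  proof -
    have ts: "theta_term (\<i> * of_real y) 0 abs_summable_on Ld" by (rule theta_term_summable) (use y in auto)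
    define f where "f v = \<alpha> v * theta_term (\<i> * of_real y) 0 v" for v
    have fbound: "norm (f v) \<le> C * norm (theta_term (\<i> * of_real y) 0 v)" if "v \<in> Ld" for v
      unfolding f_def norm_mult by (intro mult_right_mono bnd that) simp
    have fs: "f abs_summable_on Ld"
      by (rule summable_on_comparison_test[OF summable_on_cmult_right[OF ts, of C]]) (use fbound in auto)
    then have fs': "f abs_summable_on Ld - {0}" by (rule summable_on_subset_banach) auto
    have "Ld = {0} \<union> (Ld - {0})" using z by blast
    then have "infsum f Ld = infsum f {0} + infsum f (Ld - {0})"
      using infsum_Un_disjoint[of f "{0}" "Ld - {0}"] abs_summable_summable[OF fs'] by simp
    then have "f 0 = - infsum f (Ld - {0})" using zero[of y] y unfolding f_def by (simp add: eq_neg_iff_add_eq_0)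
    moreover have "f 0 = \<alpha> 0" by (simp add: f_def theta_term_imaginary)
    ultimately have "norm (\<alpha> 0) = norm (infsum f (Ld - {0}))" by simp
    also have "\<dots> \<le> (\<Sum>\<^sub>\<infinity>v\<in>Ld - {0}. norm (f v))" by (rule norm_infsum_bound[OF fs'])
    also have "\<dots> \<le> (\<Sum>\<^sub>\<infinity>v\<in>Ld - {0}. (C * exp (- 2 * pi * m * (y - 1))) * exp (- 2 * pi * quad B v))"
    proof (rule infsum_mono[OF fs' summable_on_cmult_right[OF sm1]])
      fix v assume v: "v \<in> Ld - {0}"
      have "quad B v \<ge> m" using quad_dual_ge v by (simp add: m_def)
      then have "(y - 1) * quad B v \<ge> (y - 1) * m" using y by (intro mult_left_mono) auto
      then have "2 * pi * (m * (y - 1) + quad B v) \<le> 2 * pi * (y * quad B v)" by (intro mult_left_mono) (auto simp: algebra_simps)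
      then have "exp (- 2 * pi * y * quad B v) \<le> exp (- 2 * pi * m * (y - 1) + - 2 * pi * quad B v)" by (simp add: algebra_simps)
      then have "norm (theta_term (\<i> * of_real y) 0 v) \<le> exp (- 2 * pi * m * (y - 1)) * exp (- 2 * pi * quad B v)"
        unfolding theta_term_imaginary exp_add by simp
      then have "C * norm (theta_term (\<i> * of_real y) 0 v) \<le> C * (exp (- 2 * pi * m * (y - 1)) * exp (- 2 * pi * quad B v))"
        using C0 by (rule mult_left_mono)
      with fbound[of v] v show "norm (f v) \<le> (C * exp (- 2 * pi * m * (y - 1))) * exp (- 2 * pi * quad B v)"
        by (simp add: mult.assoc) 
    qed
    also have "\<dots> = C * exp (- 2 * pi * m * (y - 1)) * M" unfolding M_def by (rule infsum_cmult_right')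
    finally show ?thesis by (simp add: mult_ac)
  qed
  have "((\<lambda>y. exp (- 2 * pi * m * (y - 1)) * (C * M)) \<longlongrightarrow> 0 * (C * M)) at_top"
  proof (intro tendsto_mult tendsto_const)
    show "((\<lambda>y. exp (- 2 * pi * m * (y - 1))) \<longlongrightarrow> 0) at_top"
      using m by real_asymp
  qed
  moreover have "\<forall>\<^sub>F y in at_top. norm (\<alpha> 0) \<le> exp (- 2 * pi * m * (y - 1)) * (C * M)"
    using eventually_gt_at_top[of 1] by eventually_elim (rule bound)
  ultimately have "norm (\<alpha> 0) \<le> 0 * (C * M)"
    by (intro tendsto_lowerbound[of _ _ at_top]) auto
  then show ?thesis by simp
qed

text \<open>Theta at \<open>\<tau> / (c \<tau> + 1)\<close> is expanded in two ways: by
  \<open>theta_modular\<close>, where \<open>gauss 1 c\<close> appears in the constant term, and by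
  inversion, translation and inversion again, where the sum over \<open>Ld / L\<close>
  appears.\<close>

lemma gauss_reciprocity:
  assumes c: "c > 0" and T: "transversal T Ld L" "finite T"
  shows "gauss 1 c = (- \<i>) powr (- (of_nat CARD('n) / 2)) * of_real (of_int c powr (real CARD('n) / 2)) / of_real (sqrt (disc B L))
       * (\<Sum>t\<in>T. ee (of_real (- of_int c * quad B t)))"
proof -
  let ?k = "- (of_nat CARD('n) / 2) :: complex"
  define K where "K = (- \<i>) powr (of_nat CARD('n) / 2) * of_real (of_int c powr (- (real CARD('n) / 2))) / of_real (sqrt (disc B L))"
  define s where "s = complex_of_real (sqrt (disc B L))"
  define \<beta> where "\<beta> v = (\<Sum>t\<in>T. ee (of_real (- of_int c * quad B t + B v t)))" for v
  \<comment> \<open>The difference of the coefficients of the two expansions. Being built from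
    finite sums of numbers of modulus 1, it is bounded as \<open>constant_term_zero\<close>
    requires.\<close>
  define \<alpha> where "\<alpha> v = K * theta_coeff 1 c 1 (coset_reps c) 0 v - \<beta> v / (s * s)" for v
  have s0: "s \<noteq> 0" unfolding s_def using disc_pos by simp
  have "\<alpha> 0 = 0"
  proof (rule constant_term_zero)
    fix v :: "real ^ 'n"
    have "norm (theta_coeff 1 c 1 (coset_reps c) 0 v) \<le> of_nat (card (coset_reps c)) * 1" unfolding theta_coeff_def
      by (rule sum_norm_bound) (simp only: norm_ee_real order_refl)
    moreover have "norm (\<beta> v) \<le> of_nat (card T) * 1" unfolding \<beta>_def
      by (rule sum_norm_bound) (simp only: norm_ee_real order_refl)
    ultimately show "norm (\<alpha> v) \<le> norm K * (of_nat (card (coset_reps c)) * 1) + of_nat (card T) * 1 / norm (s * s)"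
      unfolding \<alpha>_def
      by (intro order_trans[OF norm_triangle_ineq4] add_mono) (auto simp: norm_mult norm_divide intro!: mult_left_mono divide_right_mono)
  next
    fix y :: real assume y: "y > 0"
    define \<tau> where "\<tau> = \<i> * of_real y"
    define w where "w = of_int c * \<tau> + of_int 1"
    have Im\<tau>: "Im \<tau> > 0" using y by (simp add: \<tau>_def)
    have \<tau>0: "\<tau> \<noteq> 0" using y by (simp add: \<tau>_def)
    have Rew: "Re w = 1" unfolding w_def \<tau>_def by simp
    then have w0: "w \<noteq> 0" by auto
    have z0: "(\<chi> i. (0 :: complex ^ 'n) $ i / w) = 0" by (simp add: vec_eq_iff)
    define g where "g = \<tau> / w"
    have g0: "g \<noteq> 0" using \<tau>0 w0 by (simp add: g_def)
    \<comment> \<open>The matrix (1, 0; c, 1) decomposed: inversion turns it into a translation by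
      -c.\<close>
    have gw: "- 1 / g = - 1 / \<tau> + of_real (- of_int c)"
      unfolding g_def using \<tau>0 w0 by (simp add: field_simps) (simp add: w_def algebra_simps)
    have Img: "Im g > 0"
    proof -
      have "Im g = y / ((Re w)\<^sup>2 + (Im w)\<^sup>2)" unfolding g_def \<tau>_def using Rew by (simp add: Im_divide)
      moreover have "(Re w)\<^sup>2 + (Im w)\<^sup>2 > 0" using Rew by (simp add: add_pos_nonneg)
      ultimately show ?thesis using y by simp
    qed
    have Im2: "Im (- 1 / \<tau>) > 0" by (rule Im_neg_inverse[OF Im\<tau>])
    have "theta B L 0 g 0 = infsum (theta_term g 0) L" unfolding theta_def theta_term_def by simp
    then have l: "theta B L 0 ((of_int 1 * \<tau> + of_int 0) / w) (\<chi> i. (0 :: complex ^ 'n) $ i / w) = infsum (theta_term g 0) L"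
      unfolding z0 by (simp add: g_def)
    have "w powr ?k * ee (- (of_int c / w) * cquad B 0) * infsum (theta_term g 0) L
      = K * (\<Sum>\<^sub>\<infinity>v\<in>Ld. theta_coeff 1 c 1 (coset_reps c) 0 v * theta_term \<tau> 0 v)"
      unfolding K_def l[symmetric]
      by (rule theta_modular[OF _ c Im\<tau> subgrpD(1)[OF subLd] coset_reps(1,2)[OF c] w_def]) simp
    then have A: "w powr ?k * infsum (theta_term g 0) L = K * (\<Sum>\<^sub>\<infinity>v\<in>Ld. theta_coeff 1 c 1 (coset_reps c) 0 v * theta_term \<tau> 0 v)"
      by (simp add: ee_def)
    have dt: "ee (- cquad B (0 - cvec u) / \<sigma>) = theta_term (- 1 / \<sigma>) 0 u" if "\<sigma> \<noteq> 0" for u \<sigma>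
      using that by (simp add: theta_term_def cquad_def quad_def mult.commute)
    have sumL: "theta_term (- 1 / g) 0 abs_summable_on Ld" by (rule theta_term_summable[OF Im_neg_inverse[OF Img] order_refl])
    have "infsum (theta_term g 0) L = (\<Sum>\<^sub>\<infinity>v\<in>L. theta_term g 0 (0 + v))" by simp
    also have "\<dots> = (- \<i> * g) powr ?k / s * (\<Sum>\<^sub>\<infinity>u\<in>Ld. ee (of_real (B u 0)) * ee (- cquad B (0 - cvec u) / g))"
      unfolding s_def by (rule theta_poisson[OF Img])
    also have "(\<Sum>\<^sub>\<infinity>u\<in>Ld. ee (of_real (B u 0)) * ee (- cquad B (0 - cvec u) / g)) = infsum (theta_term (- 1 / g) 0) ((+) 0 ` Ld)"
      unfolding dt[OF g0] by (simp add: ee_def)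
    also have "\<dots> = (\<Sum>t\<in>T. \<Sum>\<^sub>\<infinity>h\<in>L. theta_term (- 1 / g) 0 (0 + t + h))"
      by (rule transversal_infsum[OF subL subLd L_sub_Ld T]) (use abs_summable_summable[OF sumL] in simp)
    also have "\<dots> = (\<Sum>t\<in>T. (- \<i> * (- 1 / \<tau>)) powr ?k / s * (\<Sum>\<^sub>\<infinity>u\<in>Ld. ee (of_real (- of_int c * quad B t + B u t)) * theta_term \<tau> 0 u))"
    proof (rule sum.cong[OF refl])
      fix t assume "t \<in> T"
      then have t: "t \<in> Ld" using transversalD(1)[OF T(1)] by blast
      have "(\<Sum>\<^sub>\<infinity>h\<in>L. theta_term (- 1 / g) 0 (0 + t + h)) = (\<Sum>\<^sub>\<infinity>h\<in>L. ee (of_real (- of_int c * quad B t)) * theta_term (- 1 / \<tau>) 0 (t + h))"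
      proof (rule infsum_cong)
        fix h assume h: "h \<in> L"
        have "- of_int c * quad B (t + h) - - of_int c * quad B t = - of_int c * (B t h + quad B h)"
          using B_sym[of h t] by (simp add: quad_add algebra_simps)
        also have "\<dots> \<in> \<int>" using B_dual_int(1)[OF t h] quad_int[OF h] by (intro Ints_mult Ints_add) auto
        finally have "ee (of_real (- of_int c * quad B (t + h))) = ee (of_real (- of_int c * quad B t))" by (rule ee_cong)
        then show "theta_term (- 1 / g) 0 (0 + t + h) = ee (of_real (- of_int c * quad B t)) * theta_term (- 1 / \<tau>) 0 (t + h)"
          unfolding gw theta_term_add_real by simp
      qed
      also have "\<dots> = ee (of_real (- of_int c * quad B t)) * ((- \<i> * (- 1 / \<tau>)) powr ?k / s * (\<Sum>\<^sub>\<infinity>u\<in>Ld. ee (of_real (B u t)) * ee (- cquad B (0 - cvec u) / (- 1 / \<tau>))))"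
        unfolding infsum_cmult_right' theta_poisson[OF Im2] s_def ..
      also have "\<dots> = (- \<i> * (- 1 / \<tau>)) powr ?k / s * (\<Sum>\<^sub>\<infinity>u\<in>Ld. ee (of_real (- of_int c * quad B t)) * (ee (of_real (B u t)) * theta_term \<tau> 0 u))"
        using dt[of "- 1 / \<tau>"] \<tau>0 unfolding infsum_cmult_right' by simp
      also have "\<dots> = (- \<i> * (- 1 / \<tau>)) powr ?k / s * (\<Sum>\<^sub>\<infinity>u\<in>Ld. ee (of_real (- of_int c * quad B t + B u t)) * theta_term \<tau> 0 u)"
        by (simp only: of_real_add ee_add mult.assoc)
      finally show "(\<Sum>\<^sub>\<infinity>h\<in>L. theta_term (- 1 / g) 0 (0 + t + h)) = (- \<i> * (- 1 / \<tau>)) powr ?k / s * (\<Sum>\<^sub>\<infinity>u\<in>Ld. ee (of_real (- of_int c * quad B t + B u t)) * theta_term \<tau> 0 u)" .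
    qed
    also have "\<dots> = (- \<i> * (- 1 / \<tau>)) powr ?k / s * (\<Sum>\<^sub>\<infinity>u\<in>Ld. \<beta> u * theta_term \<tau> 0 u)"
      unfolding sum_distrib_left[symmetric] \<beta>_def sum_distrib_right
      by (subst infsum_sum_swap[OF T(2) summable_on_ee_mult[OF theta_term_summable[OF Im\<tau> order_refl]]]) (rule refl)
    finally have B1: "infsum (theta_term g 0) L = (- \<i> * g) powr ?k / s * ((- \<i> * (- 1 / \<tau>)) powr ?k / s * (\<Sum>\<^sub>\<infinity>u\<in>Ld. \<beta> u * theta_term \<tau> 0 u))" .
    \<comment> \<open>Here -i g = y / w and -i (-1 / \<open>\<tau>\<close>) = 1 / y, with y > 0 and
      Re w = 1; all arguments avoid the branch cut and the three powers cancel exactly.\<close>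
    have pw: "w powr ?k * ((- \<i> * g) powr ?k * (- \<i> * (- 1 / \<tau>)) powr ?k) = 1"
    proof -
      have e1: "- \<i> * g = inverse w * of_real y" unfolding g_def \<tau>_def by (simp add: field_simps)
      have e2: "- \<i> * (- 1 / \<tau>) = inverse (of_real y)" unfolding \<tau>_def using y by (simp add: field_simps)
      have nw: "w \<notin> \<real>\<^sub>\<le>\<^sub>0" using Rew by (auto simp: complex_nonpos_Reals_iff)
      have ny: "complex_of_real y \<notin> \<real>\<^sub>\<le>\<^sub>0" using y by (auto simp: complex_nonpos_Reals_iff)
      have inv: "x powr ?k * inverse x powr ?k = 1" if "x \<notin> \<real>\<^sub>\<le>\<^sub>0" for x
      proof -
        have "x \<noteq> 0" using that by auto
        then show ?thesis using that Ln_inverse[OF that] by (simp add: powr_def exp_minus)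
      qed
      have "(inverse w * of_real y) powr ?k = inverse w powr ?k * of_real y powr ?k"
        by (rule powr_times_of_real) (use y w0 in auto)
      then have "w powr ?k * ((- \<i> * g) powr ?k * (- \<i> * (- 1 / \<tau>)) powr ?k)
        = (w powr ?k * inverse w powr ?k) * (of_real y powr ?k * inverse (of_real y) powr ?k)"
        unfolding e1 e2 by (simp only: mult_ac)
      then show ?thesis unfolding inv[OF nw] inv[OF ny] by simp
    qed
    have "w powr ?k * infsum (theta_term g 0) L = (w powr ?k * ((- \<i> * g) powr ?k * (- \<i> * (- 1 / \<tau>)) powr ?k)) / (s * s) * (\<Sum>\<^sub>\<infinity>u\<in>Ld. \<beta> u * theta_term \<tau> 0 u)"
      unfolding B1 by simp
    then have E: "K * (\<Sum>\<^sub>\<infinity>v\<in>Ld. theta_coeff 1 c 1 (coset_reps c) 0 v * theta_term \<tau> 0 v) = 1 / (s * s) * (\<Sum>\<^sub>\<infinity>u\<in>Ld. \<beta> u * theta_term \<tau> 0 u)"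
      unfolding A pw .
    have sg: "(\<lambda>v. theta_coeff 1 c 1 (coset_reps c) 0 v * theta_term \<tau> 0 v) summable_on Ld"
      unfolding theta_coeff_def sum_distrib_right
      by (intro summable_on_finite_sum summable_on_ee_mult theta_term_summable[OF Im\<tau> order_refl])
    have sb: "(\<lambda>v. \<beta> v * theta_term \<tau> 0 v) summable_on Ld"
      unfolding \<beta>_def sum_distrib_right
      by (intro summable_on_finite_sum summable_on_ee_mult theta_term_summable[OF Im\<tau> order_refl])
    have "(\<Sum>\<^sub>\<infinity>v\<in>Ld. \<alpha> v * theta_term (\<i> * of_real y) 0 v)
       = (\<Sum>\<^sub>\<infinity>v\<in>Ld. K * (theta_coeff 1 c 1 (coset_reps c) 0 v * theta_term \<tau> 0 v) + (- (1 / (s * s))) * (\<beta> v * theta_term \<tau> 0 v))"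
      unfolding \<alpha>_def \<tau>_def by (simp add: algebra_simps)
    also have "\<dots> = (\<Sum>\<^sub>\<infinity>v\<in>Ld. K * (theta_coeff 1 c 1 (coset_reps c) 0 v * theta_term \<tau> 0 v)) + (\<Sum>\<^sub>\<infinity>v\<in>Ld. (- (1 / (s * s))) * (\<beta> v * theta_term \<tau> 0 v))"
      by (rule infsum_add[OF summable_on_cmult_right[OF sg] summable_on_cmult_right[OF sb]])
    also have "\<dots> = 0" unfolding infsum_cmult_right' E by simp
    finally show "(\<Sum>\<^sub>\<infinity>v\<in>Ld. \<alpha> v * theta_term (\<i> * of_real y) 0 v) = 0" .
  qed
  moreover have "theta_coeff 1 c 1 (coset_reps c) 0 0 = gauss 1 c" by (simp add: theta_coeff_def gauss_def)
  ultimately have E: "K * gauss 1 c = (\<Sum>t\<in>T. ee (of_real (- of_int c * quad B t))) / (s * s)"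
    by (simp add: \<alpha>_def \<beta>_def)
  have cc: "of_int c powr (- (real CARD('n) / 2)) * of_int c powr (real CARD('n) / 2) = (1 :: real)"
    using c by (simp add: powr_add[symmetric])
  have ii: "(- \<i>) powr (of_nat CARD('n) / 2) * (- \<i>) powr (- (of_nat CARD('n) / 2)) = 1"
    by (simp add: powr_add[symmetric])
  define K' where "K' = (- \<i>) powr (- (of_nat CARD('n) / 2)) * of_real (of_int c powr (real CARD('n) / 2))"
  have "K' * K = ((- \<i>) powr (of_nat CARD('n) / 2) * (- \<i>) powr (- (of_nat CARD('n) / 2))) *
      of_real (of_int c powr (- (real CARD('n) / 2)) * of_int c powr (real CARD('n) / 2)) / s"
    unfolding K_def K'_def s_def by (simp only: of_real_mult times_divide_eq_right mult_ac)
  then have "K' * K = 1 / s" unfolding cc ii by simp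
  then have "gauss 1 c / s = K' * (K * gauss 1 c)" by (simp add: mult.assoc[symmetric])
  then have "gauss 1 c = K' / s * (\<Sum>t\<in>T. ee (of_real (- of_int c * quad B t)))" unfolding E using s0 by (simp add: field_simps)
  then show ?thesis unfolding K'_def s_def .
qed

end

section \<open>Quadratic Gauss sums of integers\<close>

text \<open>By Euler's criterion both sides agree modulo p, and they differ by at most 2 <
  p.\<close>

lemma Legendre_mult:
  fixes p :: int
  assumes "prime p" "odd p"
  shows "Legendre (a * b) p = Legendre a p * Legendre b p"
proof -
  obtain q where q: "p = int q" using prime_ge_0_int[OF assms(1)] by (metis nonneg_int_cases)
  have pq: "prime q" using assms(1) q by simp
  have q2: "2 < q" using assms pq prime_ge_2_nat[OF pq] unfolding q by (cases "q = 2") auto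
  have "[Legendre (a * b) p = (a * b) ^ ((q - 1) div 2)] (mod p)" unfolding q by (rule euler_criterion[OF pq q2])
  moreover have "[Legendre a p * Legendre b p = a ^ ((q - 1) div 2) * b ^ ((q - 1) div 2)] (mod p)"
    unfolding q by (intro cong_mult euler_criterion[OF pq q2])
  ultimately have "[Legendre (a * b) p = Legendre a p * Legendre b p] (mod p)"
    by (metis cong_sym cong_trans power_mult_distrib)
  then have d: "p dvd Legendre (a * b) p - Legendre a p * Legendre b p" by (simp add: cong_iff_dvd_diff)
  have 1: "\<bar>Legendre x p\<bar> \<le> 1" for x by (simp add: Legendre_def)
  have "\<bar>Legendre a p * Legendre b p\<bar> \<le> 1" unfolding abs_mult by (intro mult_le_one 1 abs_ge_zero)
  then have "\<bar>Legendre (a * b) p - Legendre a p * Legendre b p\<bar> \<le> 2" using 1[of "a * b"] by linarith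
  moreover have "\<bar>p\<bar> > 2" using q2 q by simp
  ultimately have "Legendre (a * b) p - Legendre a p * Legendre b p = 0"
    using dvd_imp_le_int[OF _ d] by linarith
  then show ?thesis by simp
qed

lemma Legendre_nonzero: "\<not> p dvd a \<Longrightarrow> (Legendre a p)\<^sup>2 = 1"
  by (auto simp: Legendre_def cong_0_iff)

lemma Legendre_cong: "[a = b] (mod p) \<Longrightarrow> Legendre a p = Legendre b p"
  by (simp add: Legendre_def QuadRes_def cong_def)

lemma Legendre_square:
  assumes "\<not> p dvd (a::int)" "prime p" shows "Legendre (a\<^sup>2) p = 1"
proof -
  have "\<not> [a\<^sup>2 = 0] (mod p)" using assms by (simp add: cong_0_iff prime_dvd_power_iff)
  moreover have "QuadRes p (a\<^sup>2)" unfolding QuadRes_def by (rule exI[of _ a]) simp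
  ultimately show ?thesis by (simp add: Legendre_def)
qed

lemma card_square_roots:
  fixes p u :: int
  assumes p: "prime p" "odd p" and u: "u \<in> {0..<p}"
  shows "int (card {x \<in> {0..<p}. x\<^sup>2 mod p = u}) = 1 + Legendre u p"
proof -
  have p0: "p > 2" using p prime_ge_2_int[OF p(1)] by (cases "p = 2") auto
  have sq: "x\<^sup>2 mod p = u \<longleftrightarrow> [x\<^sup>2 = u] (mod p)" for x using u by (simp add: cong_def)
  consider "u = 0" | "u \<noteq> 0" "QuadRes p u" | "u \<noteq> 0" "\<not> QuadRes p u" by blast
  then show ?thesis
  proof cases
    case 1
    have "{x \<in> {0..<p}. x\<^sup>2 mod p = u} = {0}"
    proof (intro equalityI subsetI)
      fix x assume "x \<in> {x \<in> {0..<p}. x\<^sup>2 mod p = u}"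
      then have x: "x \<in> {0..<p}" "p dvd x\<^sup>2" using 1 by (auto simp: mod_eq_0_iff_dvd)
      then have "p dvd x" using p(1) prime_dvd_power by blast
      then show "x \<in> {0}" using x(1) by (auto dest: zdvd_imp_le)
    qed (use p0 1 in auto)
    then show ?thesis using 1 by (simp add: Legendre_def)
  next
    case 2
    then obtain y where y: "[y\<^sup>2 = u] (mod p)" by (auto simp: QuadRes_def)
    have nu: "\<not> p dvd u" using u 2 by (auto dest: zdvd_imp_le)
    have ny: "\<not> p dvd y"
    proof
      assume "p dvd y"
      then have "p dvd y\<^sup>2" by (simp add: power2_eq_square)
      then show False using y nu by (metis cong_dvd_iff)
    qed
    define z where "z = y mod p"
    have z: "z \<in> {0..<p}" "z \<noteq> 0" using p0 ny by (auto simp: z_def mod_eq_0_iff_dvd)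
    have zz: "[z\<^sup>2 = u] (mod p)" unfolding z_def using y by (simp add: cong_def power_mod)
    have "{x \<in> {0..<p}. x\<^sup>2 mod p = u} = {z, p - z}"
    proof (intro equalityI subsetI)
      fix x assume "x \<in> {x \<in> {0..<p}. x\<^sup>2 mod p = u}"
      then have x: "x \<in> {0..<p}" "[x\<^sup>2 = u] (mod p)" using sq by auto
      then have "[x\<^sup>2 = z\<^sup>2] (mod p)" using zz cong_sym cong_trans by blast
      then have "p dvd x\<^sup>2 - z\<^sup>2" by (simp add: cong_iff_dvd_diff)
      then have "p dvd (x - z) * (x + z)" by (simp add: power2_eq_square algebra_simps)
      then have "p dvd x - z \<or> p dvd x + z" using p(1) by (simp add: prime_dvd_mult_iff)
      then show "x \<in> {z, p - z}"
      proof
        assume "p dvd x - z"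
        then have "x mod p = z mod p" by (simp add: mod_eq_dvd_iff)
        then show ?thesis using x z by simp
      next
        assume "p dvd x + z"
        then obtain k where k: "x + z = p * k" by blast
        have "0 < p * k" "p * k < p * 2" using x z unfolding k[symmetric] by auto
        then have "k = 1" using p0 by (simp add: zero_less_mult_iff)
        then show ?thesis using k by simp
      qed
    next
      fix x assume "x \<in> {z, p - z}"
      moreover have "[(p - z)\<^sup>2 = z\<^sup>2] (mod p)"
      proof -
        have "(p - z)\<^sup>2 - z\<^sup>2 = p * (p - 2 * z)" by (simp add: power2_eq_square algebra_simps)
        then show ?thesis by (metis cong_iff_dvd_diff dvd_triv_left)
      qed
      then have "[(p - z)\<^sup>2 = u] (mod p)" using zz cong_trans by blast
      ultimately show "x \<in> {x \<in> {0..<p}. x\<^sup>2 mod p = u}" using z zz sq by auto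
    qed
    moreover have "z \<noteq> p - z" using p(2) by presburger
    ultimately have "card {x \<in> {0..<p}. x\<^sup>2 mod p = u} = 2" by simp
    then show ?thesis using 2 nu by (simp add: Legendre_def cong_0_iff)
  next
    case 3
    have e: "{x \<in> {0..<p}. x\<^sup>2 mod p = u} = {}" using 3 sq by (auto simp: QuadRes_def)
    have "\<not> p dvd u" using u 3 by (auto dest: zdvd_imp_le)
    then show ?thesis unfolding e using 3 by (simp add: Legendre_def cong_0_iff)
  qed
qed

definition qgauss :: "int \<Rightarrow> int \<Rightarrow> complex" where
  "qgauss m c = (\<Sum>x\<in>{0..<c}. ee (of_real (of_int m * (of_int x)\<^sup>2 / of_int c)))"

definition echar :: "int \<Rightarrow> int \<Rightarrow> complex" where
  "echar c x = ee (of_real (of_int x / of_int c))"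

lemma echar_cong: "c > 0 \<Longrightarrow> [x = y] (mod c) \<Longrightarrow> echar c x = echar c y"
proof -
  assume c: "c > 0" and "[x = y] (mod c)"
  then have "c dvd x - y" by (simp add: cong_iff_dvd_diff)
  then have "(of_int (x - y) / of_int c :: real) \<in> \<int>" using of_int_divide_in_Ints_iff[of c "x - y"] c by simp
  then show ?thesis unfolding echar_def by (intro ee_cong) (simp add: diff_divide_distrib)
qed

lemma echar_add: "echar c (x + y) = echar c x * echar c y"
  unfolding echar_def by (simp add: add_divide_distrib ee_add)

lemma qgauss_ec: "qgauss m c = (\<Sum>x\<in>{0..<c}. echar c (m * x\<^sup>2))"
  unfolding qgauss_def echar_def by simp

lemma sum_mult_mod:
  fixes f :: "int \<Rightarrow> complex"
  assumes c: "c > 0" "coprime m c" and f: "\<And>x y. [x = y] (mod c) \<Longrightarrow> f x = f y"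
  shows "(\<Sum>x\<in>{0..<c}. f (m * x)) = (\<Sum>x\<in>{0..<c}. f x)"
proof -
  have "inj_on (\<lambda>x. (m * x) mod c) {0..<c}"
  proof (rule inj_onI)
    fix x y assume xy: "x \<in> {0..<c}" "y \<in> {0..<c}" "m * x mod c = m * y mod c"
    then have "[m * x = m * y] (mod c)" by (simp add: cong_def)
    then have "[x = y] (mod c)" using c(2) cong_mult_lcancel by blast
    then show "x = y" using xy by (simp add: cong_def)
  qed
  moreover have "(\<lambda>x. (m * x) mod c) ` {0..<c} \<subseteq> {0..<c}" using c by auto
  ultimately have b: "bij_betw (\<lambda>x. (m * x) mod c) {0..<c} {0..<c}"
    by (simp add: bij_betw_def endo_inj_surj)
  have "(\<Sum>x\<in>{0..<c}. f (m * x)) = (\<Sum>x\<in>{0..<c}. f ((m * x) mod c))"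
    by (intro sum.cong refl f) (simp add: cong_def)
  also have "\<dots> = (\<Sum>x\<in>{0..<c}. f x)" by (rule sum.reindex_bij_betw[OF b])
  finally show ?thesis .
qed

lemma sum_ec_eq_0:
  assumes c: "c > 1" "coprime m c"
  shows "(\<Sum>x\<in>{0..<c}. echar c (m * x)) = 0"
proof -
  have "(\<Sum>x\<in>{0..<c}. echar c (m * x)) = (\<Sum>x\<in>{0..<c}. echar c x)"
    by (rule sum_mult_mod) (use c echar_cong in auto)
  also have "\<dots> = 0"
  proof -
    have "(\<Sum>x\<in>{0..<c}. echar c x) = (\<Sum>x\<in>{0..<c}. echar c (x + 1))"
    proof -
      have "inj_on (\<lambda>x. (x + 1) mod c) {0..<c}"
      proof (rule inj_onI)
        fix x y assume xy: "x \<in> {0..<c}" "y \<in> {0..<c}" "(x + 1) mod c = (y + 1) mod c"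
        then have "[x + 1 = y + 1] (mod c)" by (simp add: cong_def)
        then have "[x = y] (mod c)" by (simp add: cong_add_rcancel)
        then show "x = y" using xy by (simp add: cong_def)
      qed
      moreover have "(\<lambda>x. (x + 1) mod c) ` {0..<c} \<subseteq> {0..<c}" using c by auto
      ultimately have b: "bij_betw (\<lambda>x. (x + 1) mod c) {0..<c} {0..<c}"
        by (simp add: bij_betw_def endo_inj_surj)
      have "(\<Sum>x\<in>{0..<c}. echar c (x + 1)) = (\<Sum>x\<in>{0..<c}. echar c ((x + 1) mod c))"
        by (intro sum.cong refl echar_cong) (use c in \<open>auto simp: cong_def\<close>)
      also have "\<dots> = (\<Sum>x\<in>{0..<c}. echar c x)" by (rule sum.reindex_bij_betw[OF b])
      finally show ?thesis by simp
    qed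
    also have "\<dots> = echar c 1 * (\<Sum>x\<in>{0..<c}. echar c x)" by (simp add: echar_add sum_distrib_left mult.commute)
    finally have "(1 - echar c 1) * (\<Sum>x\<in>{0..<c}. echar c x) = 0" by (simp add: algebra_simps)
    moreover have "echar c 1 \<noteq> 1"
    proof
      assume "echar c 1 = 1"
      then have "(of_int 1 / of_int c :: real) \<in> \<int>" unfolding echar_def by (rule ee_real_eq_1)
      then have "c dvd 1" using of_int_divide_in_Ints_iff[of c 1] c by simp
      then show False using c(1) by (simp add: zdvd1_eq)
    qed
    ultimately show ?thesis by simp
  qed
  finally show ?thesis .
qed

text \<open>Grouping by the value of x^2 and counting square roots turns the sum into a character
  sum weighted by Legendre symbols; the 1 in the count contributes nothing. The substitution u -> m
  u then extracts the symbol of m.\<close>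

lemma gq_Legendre:
  fixes p m :: int
  assumes p: "prime p" "odd p" and m: "\<not> p dvd m"
  shows "qgauss m p = of_int (Legendre m p) * qgauss 1 p"
proof -
  have p1: "p > 1" using prime_gt_1_int[OF p(1)] .
  have cop: "coprime m p" if "\<not> p dvd m" for m using p(1) that by (metis coprime_commute prime_imp_coprime)
  define t where "t m = (\<Sum>u\<in>{0..<p}. of_int (Legendre u p) * echar p (m * u))" for m
  have 1: "qgauss m p = t m" if m: "\<not> p dvd m" for m
  proof -
    have "qgauss m p = (\<Sum>u\<in>{0..<p}. \<Sum>x\<in>{x \<in> {0..<p}. x\<^sup>2 mod p = u}. echar p (m * x\<^sup>2))"
      unfolding qgauss_ec by (rule sum.group[symmetric]) (use p1 in auto)
    also have "\<dots> = (\<Sum>u\<in>{0..<p}. \<Sum>x\<in>{x \<in> {0..<p}. x\<^sup>2 mod p = u}. echar p (m * u))"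
    proof (intro sum.cong refl echar_cong)
      fix u x assume "x \<in> {x \<in> {0..<p}. x\<^sup>2 mod p = u}"
      then have "[x\<^sup>2 = u] (mod p)" by (auto simp: cong_def)
      then show "[m * x\<^sup>2 = m * u] (mod p)" by (intro cong_mult cong_refl)
    qed (use p1 in simp)
    also have "\<dots> = (\<Sum>u\<in>{0..<p}. of_int (int (card {x \<in> {0..<p}. x\<^sup>2 mod p = u})) * echar p (m * u))" by simp
    also have "\<dots> = (\<Sum>u\<in>{0..<p}. of_int (1 + Legendre u p) * echar p (m * u))"
      by (intro sum.cong refl) (simp only: card_square_roots[OF p])
    also have "\<dots> = (\<Sum>u\<in>{0..<p}. echar p (m * u)) + t m"
      by (simp add: t_def distrib_right sum.distrib)
    finally show ?thesis using sum_ec_eq_0[OF p1 cop[OF m]] by simp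
  qed
  have "of_int (Legendre m p) * t m = (\<Sum>u\<in>{0..<p}. of_int (Legendre (m * u) p) * echar p (m * u))"
    unfolding t_def sum_distrib_left Legendre_mult[OF p] by (simp add: mult.assoc)
  also have "\<dots> = (\<Sum>u\<in>{0..<p}. of_int (Legendre u p) * echar p u)"
    by (rule sum_mult_mod) (use p1 cop[OF m] echar_cong Legendre_cong in \<open>auto intro!: arg_cong2[where f = "(*)"]\<close>)
  also have "\<dots> = qgauss 1 p" using 1[of 1] p1 by (simp add: t_def zdvd1_eq)
  finally have "of_int (Legendre m p) * qgauss m p = qgauss 1 p" using 1[OF m] by simp
  moreover have "of_int (Legendre m p) * (of_int (Legendre m p) :: complex) = 1"
    using Legendre_nonzero[OF m] by (metis of_int_1 of_int_mult power2_eq_square)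
  ultimately show ?thesis by (metis mult.assoc mult_1)
qed

section \<open>Kronecker symbols and induction over moduli\<close>

lemma kronecker_pos: "m > 0 \<Longrightarrow> kronecker a m = (\<Prod>p\<in>#prime_factorization m. kronecker_prime a p)"
  by (simp add: kronecker_def)

lemma kronecker_1 [simp]: "kronecker a 1 = 1"
  by (simp add: kronecker_pos)

lemma kronecker_mult: "c1 > 0 \<Longrightarrow> c2 > 0 \<Longrightarrow> kronecker a (c1 * c2) = kronecker a c1 * kronecker a c2"
  by (simp add: kronecker_pos prime_factorization_mult)

lemma kronecker_power: "c > 0 \<Longrightarrow> kronecker a (c ^ k) = kronecker a c ^ k"
  by (induction k) (simp_all add: kronecker_mult)

lemma kronecker_prime_eq: "prime p \<Longrightarrow> kronecker a p = kronecker_prime a p"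
  using prime_gt_0_int[of p] by (simp add: kronecker_pos prime_factorization_prime)

lemma kronecker_odd_prime: "prime p \<Longrightarrow> odd p \<Longrightarrow> kronecker a p = Legendre a p"
  by (auto simp: kronecker_prime_eq kronecker_prime_def)

text \<open>The case \<open>square\<close> is shaped after the recursion of Gauss sums at prime powers, which raises the
  exponent by two.\<close>

lemma coprime_prime_power_induct [consumes 1, case_names one prime square coprime]:
  fixes c :: int
  assumes "c > 0"
    and "P 1" "\<And>p. prime p \<Longrightarrow> P p" "\<And>p k. prime p \<Longrightarrow> P (p ^ k) \<Longrightarrow> P (p ^ (k + 2))"
    and "\<And>c1 c2. c1 > 0 \<Longrightarrow> c2 > 0 \<Longrightarrow> coprime c1 c2 \<Longrightarrow> P c1 \<Longrightarrow> P c2 \<Longrightarrow> P (c1 * c2)"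
  shows "P c"
proof -
  have pp: "P (p ^ k)" if "prime p" for p :: int and k
  proof (induction k rule: less_induct)
    case (less k)
    consider "k = 0" | "k = 1" | j where "k = j + 2" by (metis add_2_eq_Suc' not0_implies_Suc One_nat_def)
    then show ?case using assms(2-4) that less by cases auto
  qed
  show ?thesis using assms(1)
  proof (induction "nat c" arbitrary: c rule: less_induct)
    case less
    show ?case
    proof (cases "c = 1")
      case True then show ?thesis using assms(2) by simp
    next
      case False
      then obtain p where p: "prime p" "p dvd c" using prime_factor_int[of c] less.prems by auto
      have p1: "p > 1" using prime_gt_1_int[OF p(1)] .
      have "c \<noteq> 0" "\<not> is_unit p" using less.prems p1 by (auto simp: zdvd1_eq)
      then obtain m where m: "c = p ^ multiplicity p c * m" "\<not> p dvd m" by (rule multiplicity_decompose')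
      have k: "multiplicity p c > 0" using m p(2) by (intro gr0I) auto
      have pk: "p ^ multiplicity p c > 0" using p1 by simp
      have "0 < p ^ multiplicity p c * m" using m(1) less.prems by simp
      then have m0: "m > 0" using pk by (rule zero_less_mult_pos)
      have "p ^ multiplicity p c > 1" using p1 k by (simp add: one_less_power)
      then have "1 * m < p ^ multiplicity p c * m" using m0 by (rule mult_strict_right_mono)
      then have "m < c" using m(1) by simp
      then have "P m" using less.hyps[of m] m0 less.prems by simp
      moreover have "coprime (p ^ multiplicity p c) m" using p(1) m(2) by (simp add: prime_imp_coprime)
      ultimately have "P (p ^ multiplicity p c * m)" using pk m0 pp[OF p(1)] by (intro assms(5))
      then show ?thesis using m(1) by simp
    qed
  qed
qed

text \<open>The lattice Z with Q(x) = m x^2, whose lattice Gauss sums are the classical ones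
  (\<open>line_gauss\<close>).\<close>

definition line_form :: "int \<Rightarrow> real ^ 1 \<Rightarrow> real ^ 1 \<Rightarrow> real" where
  "line_form m x y = 2 * of_int m * (x $ 1) * (y $ 1)"

definition line_lattice :: "(real ^ 1) set" where
  "line_lattice = {x. x $ 1 \<in> \<int>}"

lemma quad_line_form: "quad (line_form m) x = of_int m * (x $ 1)\<^sup>2"
  by (simp add: quad_def line_form_def power2_eq_square)

lemma line_int_lattice:
  assumes "m > 0"
  shows "int_lattice (line_form m) line_lattice"
proof unfold_locales
  have ne: "x $ 1 \<noteq> 0" if "x \<noteq> 0" for x :: "real ^ 1"
    using that by (auto simp: vec_eq_iff)
  show "pos_def_inner_product (line_form m)"
    unfolding pos_def_inner_product_def
  proof (intro conjI allI impI)
    show "bilinear (line_form m)"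
      unfolding bilinear_def line_form_def by (auto intro!: linearI simp: algebra_simps)
    show "line_form m x y = line_form m y x" for x y by (simp add: line_form_def)
    show "line_form m x x > 0" if "x \<noteq> 0" for x
      using ne[OF that] assms by (auto simp: line_form_def mult.assoc zero_less_mult_iff linorder_neq_iff)
  qed
  show "is_lattice line_lattice"
    unfolding is_lattice_zspan
  proof (intro exI conjI)
    let ?b = "axis 1 1 :: real ^ 1"
    have xb: "x = (x $ 1) *\<^sub>R ?b" for x :: "real ^ 1" by (simp add: vec_eq_iff axis_def)
    show "independent {?b}" by (simp add: vec_eq_iff axis_def)
    show "span {?b} = UNIV"
    proof (intro equalityI subset_UNIV subsetI)
      fix x :: "real ^ 1"
      show "x \<in> span {?b}" by (subst xb) (intro span_scale span_base singletonI)
    qed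
    show "line_lattice = zspan {?b}"
    proof (intro equalityI subsetI)
      fix x assume "x \<in> line_lattice"
      then obtain k where k: "x $ 1 = of_int k" unfolding line_lattice_def by (auto elim: Ints_cases)
      have "x = of_int k *\<^sub>R ?b" using xb[of x] k by simp
      then show "x \<in> zspan {?b}" unfolding zspan_def mem_Collect_eq by (intro exI[of _ "\<lambda>_. k"]) simp
    next
      fix x assume "x \<in> zspan {?b}"
      then obtain k :: "real ^ 1 \<Rightarrow> int" where "x = (\<Sum>v\<in>{?b}. of_int (k v) *\<^sub>R v)" unfolding zspan_def by blast
      then show "x \<in> line_lattice" by (simp add: line_lattice_def axis_def)
    qed
  qed
  show "even_integral (line_form m) line_lattice"
    unfolding even_integral_def by (auto simp: quad_line_form line_lattice_def)
qed

lemma line_dual: "m > 0 \<Longrightarrow> dual_lattice (line_form m) line_lattice = {x. 2 * of_int m * (x $ 1) \<in> \<int>}"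
proof (intro equalityI subsetI)
  fix x assume "x \<in> dual_lattice (line_form m) line_lattice"
  moreover have "(\<chi> i. 1) \<in> line_lattice" by (simp add: line_lattice_def)
  ultimately have "line_form m x (\<chi> i. 1) \<in> \<int>" by (simp add: dual_lattice_def)
  then show "x \<in> {x. 2 * of_int m * (x $ 1) \<in> \<int>}" by (simp add: line_form_def)
qed (auto simp: dual_lattice_def line_lattice_def line_form_def)

text \<open>The number \<open>s\<close> is the inverse of the spacing, so that one lemma serves both
  \<open>L / c L\<close>, with s = 1 and q = c, and \<open>Ld / L\<close>, with s = q = 2 m.\<close>

lemma line_transversal:
  fixes s :: real
  assumes q: "q > 0" and s: "s \<noteq> 0"
  shows "transversal ((\<lambda>j. \<chi> i. real_of_int j / s) ` {0..<q}) {x :: real ^ 1. s * (x $ 1) \<in> \<int>} {x. s * (x $ 1) / of_int q \<in> \<int>}"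
    and "inj_on (\<lambda>j. (\<chi> i. real_of_int j / s) :: real ^ 1) {0..<q}"
proof -
  show "inj_on (\<lambda>j. (\<chi> i. real_of_int j / s) :: real ^ 1) {0..<q}"
    using s by (auto intro!: inj_onI simp: vec_eq_iff)
  show "transversal ((\<lambda>j. \<chi> i. real_of_int j / s) ` {0..<q}) {x :: real ^ 1. s * (x $ 1) \<in> \<int>} {x. s * (x $ 1) / of_int q \<in> \<int>}"
  proof (rule transversalI)
    show "subgrp {x :: real ^ 1. s * (x $ 1) / of_int q \<in> \<int>}"
      unfolding subgrp_def by (auto simp: right_diff_distrib diff_divide_distrib)
    show "(\<lambda>j. \<chi> i. real_of_int j / s) ` {0..<q} \<subseteq> {x :: real ^ 1. s * (x $ 1) \<in> \<int>}" using s by auto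
    fix x :: "real ^ 1" assume "x \<in> {x. s * (x $ 1) \<in> \<int>}"
    then obtain k where k: "s * (x $ 1) = of_int k" by (auto elim: Ints_cases)
    have "s * (x $ 1 - of_int (k mod q) / s) / of_int q = of_int (k - k mod q) / of_int q"
      using s k by (simp add: right_diff_distrib)
    also have "\<dots> \<in> \<int>" by (subst of_int_divide_in_Ints_iff) (use q in auto)
    finally have "x - (\<chi> i. real_of_int (k mod q) / s) \<in> {x. s * (x $ 1) / of_int q \<in> \<int>}" by simp
    moreover have "k mod q \<in> {0..<q}" using q by simp
    ultimately show "\<exists>r\<in>(\<lambda>j. \<chi> i. real_of_int j / s) ` {0..<q}. x - r \<in> {x. s * (x $ 1) / of_int q \<in> \<int>}" by blast
  next
    fix r r' :: "real ^ 1"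
    assume "r \<in> (\<lambda>j. \<chi> i. real_of_int j / s) ` {0..<q}" "r' \<in> (\<lambda>j. \<chi> i. real_of_int j / s) ` {0..<q}"
      and d: "r - r' \<in> {x. s * (x $ 1) / of_int q \<in> \<int>}"
    then obtain j j' where j: "j \<in> {0..<q}" "j' \<in> {0..<q}" "r = (\<chi> i. real_of_int j / s)" "r' = (\<chi> i. real_of_int j' / s)" by blast
    have "s * (of_int j / s - of_int j' / s) / of_int q = (of_int (j - j') / of_int q :: real)"
      using s by (simp add: right_diff_distrib)
    then have "(of_int (j - j') / of_int q :: real) \<in> \<int>" using d j by simp
    then have "q dvd j - j'" using of_int_divide_in_Ints_iff[of q "j - j'"] q by simp
    then have "j mod q = j' mod q" by (simp add: mod_eq_dvd_iff)
    then show "r = r'" using j by simp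
  qed
qed

lemma line_gauss:
  assumes "m > 0" "c > 0"
  shows "int_lattice.gauss (line_form m) line_lattice a c = qgauss (a * m) c"
proof -
  interpret int_lattice "line_form m" line_lattice by (rule line_int_lattice[OF assms(1)])
  have "(*\<^sub>R) (of_int c) ` line_lattice = {x. 1 * (x $ 1) / of_int c \<in> \<int>}"
  proof (intro equalityI subsetI)
    fix x assume x: "x \<in> {x :: real ^ 1. 1 * (x $ 1) / of_int c \<in> \<int>}"
    have "x = of_int c *\<^sub>R ((1 / of_int c) *\<^sub>R x)" using assms(2) by simp
    moreover have "(1 / of_int c) *\<^sub>R x \<in> line_lattice" using x by (simp add: line_lattice_def)
    ultimately show "x \<in> (*\<^sub>R) (of_int c) ` line_lattice" by blast
  qed (use assms(2) in \<open>auto simp: line_lattice_def\<close>)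
  then have "transversal ((\<lambda>j. \<chi> i. real_of_int j / 1) ` {0..<c}) line_lattice ((*\<^sub>R) (of_int c) ` line_lattice)"
    using line_transversal(1)[OF assms(2), of 1] by (simp add: line_lattice_def)
  then have "gauss a c = (\<Sum>r\<in>(\<lambda>j. \<chi> i. real_of_int j / 1) ` {0..<c}. ee (of_real (of_int a * quad (line_form m) r / of_int c)))"
    by (rule gauss_transversal[OF assms(2)])
  also have "\<dots> = (\<Sum>j\<in>{0..<c}. ee (of_real (of_int a * quad (line_form m) (\<chi> i. real_of_int j / 1) / of_int c)))"
    using line_transversal(2)[OF assms(2), of 1] by (subst sum.reindex) auto
  also have "\<dots> = qgauss (a * m) c" unfolding qgauss_def quad_line_form by (simp add: mult.assoc)
  finally show ?thesis .
qed

lemma qgauss_mult: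
  assumes "c1 > 0" "c2 > 0" "coprime c1 c2"
  shows "qgauss a (c1 * c2) = qgauss (a * c2) c1 * qgauss (a * c1) c2"
proof -
  interpret int_lattice "line_form 1" line_lattice by (rule line_int_lattice) simp
  show ?thesis using gauss_mult[OF assms, of a] assms by (simp add: line_gauss)
qed

lemma qgauss_cong: "c > 0 \<Longrightarrow> [a = a'] (mod c) \<Longrightarrow> qgauss a c = qgauss a' c"
proof -
  interpret int_lattice "line_form 1" line_lattice by (rule line_int_lattice) simp
  show "c > 0 \<Longrightarrow> [a = a'] (mod c) \<Longrightarrow> qgauss a c = qgauss a' c" using gauss_cong[of c a a'] by (simp add: line_gauss)
qed

lemma qgauss_1 [simp]: "qgauss a 1 = 1"
proof -
  have "{0..<1} = {0 :: int}" by auto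
  then show ?thesis by (simp add: qgauss_def ee_def)
qed

lemma qgauss_prime_power:
  assumes p: "prime p" "odd p" "coprime a p"
  shows "qgauss a (p ^ (k + 2)) = of_int p * qgauss a (p ^ k)"
proof -
  interpret int_lattice "line_form 1" line_lattice by (rule line_int_lattice) simp
  have p0: "p > 0" using prime_gt_0_int[OF p(1)] .
  \<comment> \<open>The dual of Z under 2 x y is (1/2) Z, where Q takes the value 1/4, so the level
    is 4 and an odd p is prime to it.\<close>
  have "N dvd 4"
  proof -
    have "(\<chi> i. 1/2) \<in> Ld" by (simp add: line_dual)
    from level(2)[OF this] have "(of_int N / of_int 4 :: real) \<in> \<int>" by (simp add: quad_line_form power2_eq_square)
    then have 4: "4 dvd N" using of_int_divide_in_Ints_iff[of 4 N] by simp
    have "level (line_form 1) line_lattice \<le> 4"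
      unfolding level_def
    proof (rule Least_le, intro conjI ballI)
      fix x assume "x \<in> Ld"
      then obtain k where k: "2 * (x $ 1) = of_int k" by (auto simp: line_dual elim: Ints_cases)
      have "real 4 * quad (line_form 1) x = (2 * (x $ 1))\<^sup>2" by (simp add: quad_line_form power2_eq_square)
      then show "real 4 * quad (line_form 1) x \<in> \<int>" unfolding k by simp
    qed simp
    then show ?thesis using 4 level(1) by (auto dest!: zdvd_imp_le)
  qed
  moreover have "coprime p 4"
  proof -
    have "coprime p (2 ^ 2)" using p(2) by (simp only: coprime_power_right_iff coprime_right_2_iff_odd) simp
    then show ?thesis by simp
  qed
  ultimately have "coprime p N" using coprime_divisors[of p p N 4] by simp
  from gauss_prime_power[OF p(1) this p(3), of k] show ?thesis using p0 by (simp add: line_gauss)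
qed

text \<open>The Landsberg-Schaar identity: for Q = m x^2 the dual lattice is (1/(2 m)) Z, the
  discriminant is 2 m, and the power of -i equals e(1/8).\<close>

lemma qgauss_reciprocity:
  assumes m: "m > 0" and c: "c > 0"
  shows "qgauss m c = ee (1 / 8) * of_real (sqrt (of_int c)) / of_real (sqrt (2 * of_int m)) * (\<Sum>j\<in>{0..<2 * m}. ee (of_real (- of_int c * (of_int j)\<^sup>2 / (4 * of_int m))))"
proof -
  interpret int_lattice "line_form m" line_lattice by (rule line_int_lattice[OF m])
  let ?s = "2 * of_int m :: real"
  have s: "?s \<noteq> 0" and m2: "2 * m > 0" using m by auto
  let ?f = "\<lambda>j. (\<chi> i. real_of_int j / ?s) :: real ^ 1"
  have "{x :: real ^ 1. ?s * (x $ 1) / of_int (2 * m) \<in> \<int>} = line_lattice" using m by (simp add: line_lattice_def)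
  then have T: "transversal (?f ` {0..<2 * m}) Ld line_lattice"
    using line_transversal(1)[OF m2 s] unfolding line_dual[OF m] by simp
  have inj: "inj_on ?f {0..<2 * m}" by (rule line_transversal(2)[OF m2 s])
  have "disc (line_form m) line_lattice = card (?f ` {0..<2 * m})"
    unfolding disc_def by (rule transversal_quotient_card[OF subL T])
  then have D: "real (disc (line_form m) line_lattice) = 2 * of_int m" using m by (simp add: card_image[OF inj])
  have "qgauss m c = gauss 1 c" using line_gauss[OF m c, of 1] by simp
  also have "\<dots> = (- \<i>) powr (- (1 / 2)) * of_real (of_int c powr (1 / 2)) / of_real (sqrt (2 * of_int m))
       * (\<Sum>t\<in>?f ` {0..<2 * m}. ee (of_real (- of_int c * quad (line_form m) t)))"
    using gauss_reciprocity[OF c T] D by simp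
  also have "(\<Sum>t\<in>?f ` {0..<2 * m}. ee (of_real (- of_int c * quad (line_form m) t))) = (\<Sum>j\<in>{0..<2 * m}. ee (of_real (- of_int c * (of_int j)\<^sup>2 / (4 * of_int m))))"
  proof (subst sum.reindex[OF inj], unfold o_def, rule sum.cong[OF refl])
    fix j
    have "- of_int c * quad (line_form m) (?f j) = - of_int c * (of_int j)\<^sup>2 / (4 * of_int m)"
      using m by (simp add: quad_line_form power2_eq_square field_simps)
    then show "ee (of_real (- of_int c * quad (line_form m) (?f j))) = ee (of_real (- of_int c * (of_int j)\<^sup>2 / (4 * of_int m)))" by (simp only:)
  qed
  also have "(- \<i>) powr (- (1 / 2)) = ee (1 / 8)"
    by (simp add: powr_def Ln_minus_ii ee_def)
  also have "of_int c powr (1 / 2) = sqrt (of_int c)" using c by (simp add: powr_half_sqrt)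
  finally show ?thesis .
qed

section \<open>Explicit values of classical Gauss sums\<close>

lemma ee_quarter: "ee (1 / 4) = \<i>" "ee (- 1 / 4) = - \<i>" "ee (1 / 2) = - 1" "ee (- 1 / 2) = - 1"
proof -
  have 1: "ee (of_real x) = cis (2 * pi * x)" for x by (simp add: ee_def cis_conv_exp mult_ac)
  have h: "2 * pi * (1/4) = pi / 2" by simp
  show a: "ee (1 / 4) = \<i>" using 1[of "1/4"] unfolding h cis_pi_half by simp
  have "ee (1/4 + - 1/4) = ee (1 / 4) * ee (- 1 / 4)" by (simp add: ee_add[symmetric])
  moreover have "ee (1/4 + - 1/4) = 1" by (simp add: ee_def)
  ultimately have "\<i> * ee (- 1 / 4) = 1" unfolding a by simp
  then show b: "ee (- 1 / 4) = - \<i>" by (metis mult_minus_right i_squared minus_minus mult_left_cancel imaginary_unit.code complex_i_not_zero power2_eq_square)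
  show "ee (1 / 2) = - 1" using ee_add[of "1/4" "1/4"] unfolding a by simp
  show "ee (- 1 / 2) = - 1" using ee_add[of "- 1/4" "- 1/4"] unfolding b by simp
qed

lemma ee_eighth: "ee (1 / 8) = (1 + \<i>) / of_real (sqrt 2)"
proof -
  have "ee (1 / 8) = cis (pi / 4)" by (simp add: ee_def cis_conv_exp mult_ac)
  also have "\<dots> = of_real (sqrt 2 / 2) * (1 + \<i>)" by (simp add: complex_eq_iff cos_45 sin_45)
  also have "sqrt 2 / 2 = 1 / sqrt 2" by (simp add: field_simps)
  finally show ?thesis by simp
qed

text \<open>Gauss's sign factor for odd moduli; the value \<open>\<i>\<close> is meant for the
  residue 3.\<close>

definition eps :: "int \<Rightarrow> complex" where
  "eps c = (if c mod 4 = 1 then 1 else \<i>)"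

text \<open>Reciprocity with m = 1 leaves only the two terms j = 0 and j = 1 on the dual
  side.\<close>

lemma qgauss_one:
  assumes "c > 0" "odd c"
  shows "qgauss 1 c = of_real (sqrt (of_int c)) * eps c"
proof -
  have set: "{0..<2 * 1} = {0, 1 :: int}" by auto
  have "qgauss 1 c = ee (1 / 8) * of_real (sqrt (of_int c)) / of_real (sqrt 2) * (1 + ee (of_real (- of_int c / 4)))"
    using qgauss_reciprocity[of 1 c] assms unfolding set by (simp add: ee_def)
  then have main: "qgauss 1 c = of_real (sqrt (of_int c)) * ((1 + \<i>) / of_real (sqrt 2) / of_real (sqrt 2) * (1 + ee (of_real (- of_int c / 4))))"
    unfolding ee_eighth by (simp only: times_divide_eq_left times_divide_eq_right mult_ac)
  have E: "ee (of_real (- of_int c / 4)) = (if c mod 4 = 1 then - \<i> else \<i>)"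
  proof (cases "c mod 4 = 1")
    case True
    have "- of_int c / 4 - (- 1 / 4) = (of_int (- (c div 4)) :: real)"
    proof -
      have "c = 4 * (c div 4) + 1" using True by presburger
      then have "(of_int c :: real) = 4 * of_int (c div 4) + 1" by (metis of_int_1 of_int_add of_int_mult of_int_numeral)
      then show ?thesis by (simp add: field_simps)
    qed
    then have "ee (of_real (- of_int c / 4)) = ee (of_real (- 1 / 4))" by (intro ee_cong) simp
    then show ?thesis using True ee_quarter(2) by simp
  next
    case False
    then have c3: "c mod 4 = 3" using assms(2) by presburger
    have "- of_int c / 4 - 1 / 4 = (of_int (- (c div 4) - 1) :: real)"
    proof -
      have "c = 4 * (c div 4) + 3" using c3 by presburger
      then have "(of_int c :: real) = 4 * of_int (c div 4) + 3" by (metis of_int_numeral of_int_add of_int_mult)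
      then show ?thesis by (simp add: field_simps)
    qed
    then have "ee (of_real (- of_int c / 4)) = ee (of_real (1 / 4))" by (intro ee_cong) simp
    then show ?thesis using False ee_quarter(1) by simp
  qed
  have "(1 + \<i>) / of_real (sqrt 2) / of_real (sqrt 2) * (1 + - \<i>) = 1" "(1 + \<i>) / of_real (sqrt 2) / of_real (sqrt 2) * (1 + \<i>) = \<i>"
  proof -
    have s2: "of_real (sqrt 2) * of_real (sqrt 2) = (2::complex)" by (simp flip: of_real_mult)
    show "(1 + \<i>) / of_real (sqrt 2) / of_real (sqrt 2) * (1 + - \<i>) = 1" "(1 + \<i>) / of_real (sqrt 2) / of_real (sqrt 2) * (1 + \<i>) = \<i>"
      unfolding divide_divide_eq_left s2 by (simp_all add: complex_eq_iff)
  qed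
  then show ?thesis unfolding main E eps_def by (cases "c mod 4 = 1") (simp_all only: if_True if_False simp_thms mult_1_right)
qed

text \<open>Reciprocity with m = 2 leaves four terms: those for j = 0 and j = 2 cancel, those for j
  = 1 and j = 3 coincide. The single root that remains, times e(1/8), is the origin of e((1 -
  \<open>c\<^sub>0\<close>)/8) in the final formula.\<close>

lemma qgauss_two:
  assumes "c > 0" "odd c"
  shows "qgauss 2 c = of_real (sqrt (of_int c)) * ee (of_int (1 - c) / 8)"
proof -
  have set: "{0..<2 * 2} = {0, 1, 2, 3 :: int}" by auto
  have e: "ee (of_real (- of_int c * 4 / 8)) = - 1"
  proof -
    have "c = 2 * (c div 2) + 1" using assms(2) by presburger
    then have "(of_int c :: real) = 2 * of_int (c div 2) + 1" by (metis of_int_1 of_int_add of_int_mult of_int_numeral)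
    then have "- of_int c * 4 / 8 - 1 / 2 = (of_int (- (c div 2) - 1) :: real)" by (simp add: field_simps)
    then have "ee (of_real (- of_int c * 4 / 8)) = ee (of_real (1 / 2))" by (intro ee_cong) simp
    then show ?thesis using ee_quarter(3) by simp
  qed
  have e3: "ee (of_real (- of_int c * 9 / 8)) = ee (of_real (- of_int c / 8))"
    by (rule ee_cong) simp
  have s4: "sqrt (2 * of_int 2) = 2" by simp
  have "qgauss 2 c = ee (1 / 8) * of_real (sqrt (of_int c)) / of_real (sqrt (2 * of_int 2)) * (\<Sum>j\<in>{0..<2 * 2}. ee (of_real (- of_int c * (of_int j)\<^sup>2 / (4 * of_int 2))))"
    by (rule qgauss_reciprocity) (use assms in auto)
  also have "(\<Sum>j\<in>{0..<2 * 2}. ee (of_real (- of_int c * (of_int j)\<^sup>2 / (4 * of_int 2)))) = 1 + (ee (of_real (- of_int c / 8)) + (ee (of_real (- of_int c * 4 / 8)) + ee (of_real (- of_int c * 9 / 8))))"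
    unfolding set by (simp add: ee_def mult_ac)
  also have "\<dots> = 2 * ee (of_real (- of_int c / 8))" unfolding e e3 by simp
  finally have "qgauss 2 c = of_real (sqrt (of_int c)) * (ee (1 / 8) * ee (of_real (- of_int c / 8)))" unfolding s4 by simp
  also have "ee (1 / 8) * ee (of_real (- of_int c / 8)) = ee (of_int (1 - c) / 8)"
    unfolding ee_add[symmetric] by (simp add: diff_divide_distrib)
  finally show ?thesis .
qed

text \<open>Splitting the modulus multiplies the numerator by the complementary factor, so the
  induction must carry an arbitrary x besides a.\<close>

lemma qgauss_kronecker:
  assumes "c > 0"
  shows "odd c \<Longrightarrow> coprime a c \<Longrightarrow> coprime x c \<Longrightarrow> qgauss (a * x) c = of_int (kronecker a c) * qgauss x c"
  using assms
proof (induction c arbitrary: a x rule: coprime_prime_power_induct)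
  case one
  then show ?case by simp
next
  case (prime p)
  have nd: "\<not> p dvd y" if "coprime y p" for y using that prime(1) by (metis coprime_common_divisor dvd_refl not_prime_unit)
  have "\<not> p dvd a * x" using nd prime by (simp add: prime_dvd_mult_iff)
  then show ?case
    using gq_Legendre[OF prime(1,2), of "a * x"] gq_Legendre[OF prime(1,2) nd[OF prime(4)]] prime
    by (simp add: Legendre_mult kronecker_odd_prime)
next
  case (square p k)
  have p0: "p > 0" using prime_gt_0_int[OF square(1)] .
  have o: "odd p" using square.prems(1) by simp
  have c: "coprime a p" "coprime x p" using square.prems by auto
  have k: "kronecker a (p ^ (k + 2)) = kronecker a (p ^ k)"
  proof -
    have "\<not> p dvd a" using c(1) square(1) by (metis coprime_common_divisor dvd_refl not_prime_unit)
    then have "(kronecker a p)\<^sup>2 = 1" using Legendre_nonzero kronecker_odd_prime[OF square(1) o] by simp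
    moreover have "kronecker a (p ^ (k + 2)) = kronecker a p ^ k * (kronecker a p)\<^sup>2"
      unfolding kronecker_power[OF p0] by (rule power_add)
    ultimately show ?thesis by (simp add: kronecker_power[OF p0])
  qed
  have "qgauss (a * x) (p ^ k) = of_int (kronecker a (p ^ k)) * qgauss x (p ^ k)"
    by (rule square.IH) (use o c in auto)
  then show ?case
    using qgauss_prime_power[OF square(1) o, of "a * x" k] qgauss_prime_power[OF square(1) o c(2), of k] c k by simp
next
  case (coprime c1 c2)
  have cc: "coprime c2 c1" using coprime.hyps(3) by (rule coprime_commute[THEN iffD1])
  have 1: "qgauss (a * (x * c2)) c1 = of_int (kronecker a c1) * qgauss (x * c2) c1"
    by (rule coprime.IH(1)) (use coprime.prems cc in auto)
  have 2: "qgauss (a * (x * c1)) c2 = of_int (kronecker a c2) * qgauss (x * c1) c2"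
    by (rule coprime.IH(2)) (use coprime.prems coprime.hyps in auto)
  show ?case
    unfolding qgauss_mult[OF coprime.hyps(1-3)] kronecker_mult[OF coprime.hyps(1,2)]
    using 1 2 by (simp add: mult_ac)
qed

section \<open>Evaluation of the Gauss sums\<close>

lemma ee_power: "ee x ^ k = ee (of_nat k * x)"
  by (simp add: ee_def exp_of_nat_mult[symmetric] mult_ac)

lemma even_exponent_of_square:
  fixes s :: int
  assumes "s\<^sup>2 = 2 ^ k"
  shows "even k"
proof -
  have "s \<noteq> 0" using assms by (intro notI) simp
  have "multiplicity 2 (s\<^sup>2) = 2 * multiplicity 2 s" by (rule prime_elem_multiplicity_power_distrib) (use \<open>s \<noteq> 0\<close> in auto)
  moreover have "multiplicity (2::int) (2 ^ k) = k" by (rule multiplicity_same_power) auto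
  ultimately show ?thesis unfolding assms by (metis dvd_triv_left)
qed

lemma kronecker_power_add_2:
  assumes "c > 0" "(kronecker a c)\<^sup>2 = 1"
  shows "kronecker a (c ^ (k + 2)) = kronecker a (c ^ k)"
proof -
  have "kronecker a (c ^ (k + 2)) = kronecker a c ^ k * (kronecker a c)\<^sup>2"
    unfolding kronecker_power[OF assms(1)] by (rule power_add)
  then show ?thesis using assms by (simp add: kronecker_power)
qed

lemma kronecker_sq:
  assumes "c > 0" "coprime a c"
  shows "(kronecker a c)\<^sup>2 = 1"
  using assms
proof (induction c rule: coprime_prime_power_induct)
  case one then show ?case by simp
next
  case (prime p)
  have "\<not> p dvd a" using prime by (metis coprime_common_divisor dvd_refl not_prime_unit)
  then show ?case using Legendre_nonzero[of p a] prime(1)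
    by (cases "p = 2") (auto simp: kronecker_prime_eq kronecker_prime_def)
next
  case (square p k)
  have "p > 0" using prime_gt_0_int[OF square(1)] .
  have "coprime a p" using square.prems by simp
  then have "\<not> p dvd a" using square.hyps by (metis coprime_common_divisor dvd_refl not_prime_unit)
  then have "(kronecker a p)\<^sup>2 = 1" using Legendre_nonzero[of p a] square(1)
    by (cases "p = 2") (auto simp: kronecker_prime_eq kronecker_prime_def)
  then show ?case unfolding kronecker_power[OF \<open>p > 0\<close>] by (metis power_mult mult.commute power_one)
next
  case (coprime c1 c2)
  then show ?case by (simp add: kronecker_mult power_mult_distrib)
qed

text \<open>A check of the odd residues modulo 8. By \<open>qgauss_one\<close> and
  \<open>qgauss_two\<close> it expresses the symbol (D/2) through the ratio of the two Gauss sums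
  modulo D, which is how \<open>gauss_two\<close> meets it.\<close>

lemma kronecker_two:
  fixes D :: int
  assumes "odd D"
  shows "eps D = of_int (kronecker D 2) * ee (of_int (1 - D) / 8)"
proof -
  have k2: "kronecker D 2 = (if D mod 8 \<in> {1, 7} then 1 else -1)"
    using assms by (simp add: kronecker_prime_eq kronecker_prime_def)
  define s where "s = D mod 8"
  have s: "s = 1 \<or> s = 3 \<or> s = 5 \<or> s = 7" using assms unfolding s_def by presburger
  have D: "D = 8 * (D div 8) + s" by (simp add: s_def)
  have "of_int (1 - D) / 8 - of_int (1 - s) / 8 = (of_int (- (D div 8)) :: real)"
    using arg_cong[OF D, of real_of_int] by (simp add: field_simps)
  then have "ee (of_real (of_int (1 - D) / 8)) = ee (of_real (of_int (1 - s) / 8))" by (intro ee_cong) simp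
  then have e: "ee (of_int (1 - D) / 8) = ee (of_int (1 - s) / 8)" by simp
  have m4: "D mod 4 = s mod 4" by (simp add: s_def mod_mod_cancel)
  have e34: "ee (- (3 / 4)) = \<i>"
  proof -
    have "ee (- (3 / 4)) = ee (- 1 / 2) * ee (- 1 / 4)" unfolding ee_add[symmetric] by (simp add: field_simps)
    then show ?thesis unfolding ee_quarter by simp
  qed
  have q: "ee (- (1 / 4)) = - \<i>" "ee (- (1 / 2)) = - 1" "ee 0 = 1" using ee_quarter by (simp_all add: ee_def)
  show ?thesis unfolding k2 e eps_def m4 s_def[symmetric]
    using s by (elim disjE) (simp_all add: q e34)
qed

section \<open>Lattice Gauss sums for odd moduli\<close>

context int_lattice
begin

abbreviation D :: int where "D \<equiv> int (disc B L)"

text \<open>An orthogonal system with norms 2 q(v) prime to p represents \<open>L\<close> modulo p,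
  so the sum factors into classical ones with numerators a q(v). Symbols of 2 q(v) are split off,
  not of q(v), because the product of the norms is D up to a square; the compensating factor 2 goes
  to a.\<close>

lemma gauss_prime:
  fixes p a :: int
  assumes p: "prime p" "odd p" "coprime p N" and a: "coprime a p"
  shows "gauss a p = of_int (kronecker D p) * qgauss (2 * a) p ^ CARD('n)"
proof -
  have p0: "p > 0" using prime_gt_0_int[OF p(1)] .
  obtain S where S: "orthset S" "S \<subseteq> L" "\<forall>v\<in>S. B v v / of_int p \<notin> \<int>" using orth_sublattice_prime[OF p] .
  note SB = orthset_basis[OF S(1)]
  have "\<exists>k. quad B v = of_int k" if "v \<in> S" for v using quad_int[of v] S that by (auto elim: Ints_cases)
  then obtain q where q: "\<And>v. v \<in> S \<Longrightarrow> quad B v = of_int (q v)" by metis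
  have Bq: "B v v = of_int (2 * q v)" if "v \<in> S" for v using q[OF that] by (simp add: quad_def)
  have nd: "\<not> p dvd 2 * q v" if "v \<in> S" for v
    using S(3) that Bq[OF that] of_int_divide_in_Ints_iff[of p "2 * q v"] p0 by auto
  define g where "g k = (\<Sum>v\<in>S. of_int (k v) *\<^sub>R v)" for k :: "real ^ 'n \<Rightarrow> int"
  define K where "K = PiE S (\<lambda>_. {0..<p})"
  have Bg: "B (g k) v = of_int (k v * (2 * q v))" if "v \<in> S" for k v
  proof -
    have "B (g k) v = of_int (k v) * B v v"
      using B_orth_sum[of S v "\<lambda>v. of_int (k v)"] S(1) that unfolding g_def orthset_def by blast
    then show ?thesis using Bq[OF that] by simp
  qed
  \<comment> \<open>Pairing with v recovers the coefficient at v up to the factor 2 q(v), which is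
    invertible modulo p.\<close>
  have key: "k = l" if kl: "k \<in> K" "l \<in> K" "g k - g l \<in> scaled p" for k l
  proof (rule PiE_ext[OF kl(1,2)[unfolded K_def]])
    fix v assume v: "v \<in> S"
    obtain x where x: "x \<in> L" "g k - g l = of_int p *\<^sub>R x" using kl(3) by blast
    obtain j where j: "B x v = of_int j" using B_int[OF x(1), of v] v S(2) by (auto elim: Ints_cases)
    have "B (g k - g l) v = of_int (p * j)" unfolding x(2) using j by simp
    moreover have "B (g k - g l) v = of_int ((k v - l v) * (2 * q v))" using Bg[OF v, of k] Bg[OF v, of l] by (simp add: algebra_simps)
    ultimately have "(k v - l v) * (2 * q v) = p * j" by (metis of_int_eq_iff)
    then have "p dvd (k v - l v) * (2 * q v)" by simp
    then have "p dvd k v - l v" using nd[OF v] p(1) prime_dvd_mult_iff by blast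
    then have "k v mod p = l v mod p" by (simp add: mod_eq_dvd_iff)
    moreover have "k v \<in> {0..<p}" "l v \<in> {0..<p}" using kl v unfolding K_def by auto
    ultimately show "k v = l v" by simp
  qed
  have inj: "inj_on g K"
  proof (rule inj_onI)
    fix k l assume "k \<in> K" "l \<in> K" "g k = g l"
    then show "k = l" using key[of k l] subgrpD(1)[OF sub_scaled(1)[of p]] by simp
  qed
  have T: "transversal (g ` K) L (scaled p)"
  proof (rule transversal_of_card[OF sub_scaled(1) coset_reps(1,2)[OF p0]])
    show "g ` K \<subseteq> L" unfolding g_def using S(2) by (auto intro!: subgrp_sum[OF subL] subgrp_of_int_scale[OF subL])
    show "card (g ` K) = card (coset_reps p)" unfolding card_image[OF inj] coset_reps(3)[OF p0] using SB by (simp add: K_def card_PiE)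
    fix r s assume "r \<in> g ` K" "s \<in> g ` K" "r - s \<in> scaled p"
    then show "r = s" using key by blast
  qed
  have "gauss a p = (\<Sum>k\<in>K. ee (of_real (of_int a * quad B (g k) / of_int p)))"
    unfolding gauss_transversal[OF p0 T] by (rule sum.reindex[OF inj, unfolded o_def])
  also have "\<dots> = (\<Sum>k\<in>K. \<Prod>v\<in>S. ee (of_real (of_int (a * q v) * (of_int (k v))\<^sup>2 / of_int p)))"
  proof (rule sum.cong[OF refl])
    fix k
    have "quad B (g k) = (\<Sum>v\<in>S. of_int (q v) * (of_int (k v))\<^sup>2)"
      unfolding g_def quad_orth_sum[OF S(1)] by (intro sum.cong refl) (simp add: Bq)
    then have e: "of_int a * quad B (g k) / of_int p = (\<Sum>v\<in>S. of_int (a * q v) * (of_int (k v))\<^sup>2 / of_int p)"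
      by (simp add: sum_distrib_left sum_divide_distrib mult.assoc)
    show "ee (of_real (of_int a * quad B (g k) / of_int p)) = (\<Prod>v\<in>S. ee (of_real (of_int (a * q v) * (of_int (k v))\<^sup>2 / of_int p)))"
      unfolding e of_real_sum ee_sum ..
  qed
  also have "\<dots> = (\<Prod>v\<in>S. qgauss (a * q v) p)"
    unfolding K_def qgauss_def by (rule prod_sum_PiE[symmetric]) (use SB in auto)
  also have "\<dots> = (\<Prod>v\<in>S. of_int (Legendre (2 * q v) p) * qgauss (2 * a) p)"
  proof (rule prod.cong[OF refl])
    fix v assume v: "v \<in> S"
    have na: "\<not> p dvd a" using a p(1) by (metis coprime_common_divisor dvd_refl not_prime_unit)
    have nq: "\<not> p dvd q v" using nd[OF v] by auto
    have n2: "\<not> p dvd 2" using nd[OF v] by (metis dvd_mult2)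
    have "Legendre (2 * q v) p * Legendre (2 * a) p = (Legendre 2 p)\<^sup>2 * Legendre (a * q v) p"
      by (simp add: Legendre_mult[OF p(1,2)] power2_eq_square)
    then have L: "Legendre (2 * q v) p * Legendre (2 * a) p = Legendre (a * q v) p" using Legendre_nonzero[OF n2] by simp
    have "qgauss (a * q v) p = of_int (Legendre (a * q v) p) * qgauss 1 p"
      by (rule gq_Legendre[OF p(1,2)]) (use na nq p(1) in \<open>simp add: prime_dvd_mult_iff\<close>)
    moreover have "qgauss (2 * a) p = of_int (Legendre (2 * a) p) * qgauss 1 p"
      by (rule gq_Legendre[OF p(1,2)]) (use na n2 p(1) in \<open>simp add: prime_dvd_mult_iff\<close>)
    ultimately show "qgauss (a * q v) p = of_int (Legendre (2 * q v) p) * qgauss (2 * a) p" unfolding L[symmetric] by simp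
  qed
  also have "\<dots> = of_int (\<Prod>v\<in>S. Legendre (2 * q v) p) * qgauss (2 * a) p ^ CARD('n)"
    using SB by (simp add: prod.distrib)
  \<comment> \<open>By \<open>disc_orth\<close> the product of the norms is D f^2, and f is prime to
    p since the norms are.\<close>
  also have "(\<Prod>v\<in>S. Legendre (2 * q v) p) = Legendre D p"
  proof -
    obtain f where f: "real (disc B L) * real f ^ 2 = (\<Prod>v\<in>S. B v v)" by (rule disc_orth[OF S(1,2)])
    have "real_of_int (D * (int f)\<^sup>2) = real_of_int (\<Prod>v\<in>S. 2 * q v)"
      using f by (simp add: Bq)
    then have F: "D * (int f)\<^sup>2 = (\<Prod>v\<in>S. 2 * q v)" by (metis of_int_eq_iff)
    have "\<not> p dvd (\<Prod>v\<in>S. 2 * q v)" using nd p(1) SB(3) by (meson prime_dvd_prod_iff)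
    then have "\<not> p dvd int f" unfolding F[symmetric] by (auto simp: power2_eq_square)
    then have "Legendre D p = Legendre (D * (int f)\<^sup>2) p" using Legendre_square p(1) by (simp add: Legendre_mult[OF p(1,2)])
    also have "\<dots> = (\<Prod>v\<in>S. Legendre (2 * q v) p)" unfolding F
    proof -
      have one: "Legendre 1 p = 1" using Legendre_square[of p 1] p(1) prime_gt_1_int[OF p(1)] by simp
      show "Legendre (\<Prod>v\<in>S. 2 * q v) p = (\<Prod>v\<in>S. Legendre (2 * q v) p)"
        using SB(3) by (induction S rule: finite_induct) (simp_all add: one, simp add: Legendre_mult[OF p(1,2)])
    qed
    finally show ?thesis by simp
  qed
  finally show ?thesis using kronecker_odd_prime[OF p(1,2)] by simp
qed

text \<open>Both sides split in the same way over coprime factors, and at prime powers both gain the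
  factor p^n when the exponent grows by two. The numerator varies in the induction because splitting
  multiplies it by the other modulus.\<close>

lemma gauss_odd:
  assumes "c > 0"
  shows "odd c \<Longrightarrow> coprime c N \<Longrightarrow> coprime a c \<Longrightarrow> gauss a c = of_int (kronecker D c) * qgauss (2 * a) c ^ CARD('n)"
  using assms
proof (induction c arbitrary: a rule: coprime_prime_power_induct)
  case one
  then show ?case by (simp add: gauss_1)
next
  case (prime p)
  then show ?case by (intro gauss_prime)
next
  case (square p k)
  have p0: "p > 0" using prime_gt_0_int[OF square(1)] .
  have o: "odd p" using square.prems(1) by simp
  have c: "coprime p N" "coprime a p" using square.prems by auto
  have c2: "coprime (2 * a) p" using c(2) o by (simp add: coprime_commute[of 2] coprime_right_2_iff_odd)
  have "(kronecker D p)\<^sup>2 = 1" using kronecker_sq[OF p0, of D] coprime_disc[OF c(1)] by (simp add: coprime_commute)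
  then have k: "kronecker D (p ^ (k + 2)) = kronecker D (p ^ k)" by (rule kronecker_power_add_2[OF p0])
  have "gauss a (p ^ k) = of_int (kronecker D (p ^ k)) * qgauss (2 * a) (p ^ k) ^ CARD('n)"
    by (rule square.IH) (use o c in auto)
  then show ?case unfolding k gauss_prime_power[OF square(1) c] qgauss_prime_power[OF square(1) o c2]
    by (simp add: power_mult_distrib mult_ac)
next
  case (coprime c1 c2)
  have cc: "coprime c2 c1" using coprime.hyps(3) by (rule coprime_commute[THEN iffD1])
  have 1: "gauss (a * c2) c1 = of_int (kronecker D c1) * qgauss (2 * (a * c2)) c1 ^ CARD('n)"
    by (rule coprime.IH(1)) (use coprime.prems cc in auto)
  have 2: "gauss (a * c1) c2 = of_int (kronecker D c2) * qgauss (2 * (a * c1)) c2 ^ CARD('n)"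
    by (rule coprime.IH(2)) (use coprime.prems coprime.hyps in auto)
  show ?case
    unfolding gauss_mult[OF coprime.hyps(1-3)] qgauss_mult[OF coprime.hyps(1-3)] kronecker_mult[OF coprime.hyps(1,2)] 1 2
    by (simp add: power_mult_distrib mult_ac)
qed

section \<open>The prime 2\<close>

text \<open>By reciprocity the normalised Gauss sum for \<open>a = 1\<close> depends on \<open>c\<close> modulo the level only, so
  \<open>c = 2\<close> may be traded for an odd modulus.\<close>

lemma gauss_two:
  assumes N: "coprime 2 N" and a: "odd a"
  shows "gauss a 2 = of_int (kronecker D 2) * of_real (sqrt 2 ^ CARD('n))"
proof -
  have oN: "odd N" "odd D" using N coprime_disc[OF N] by (simp_all add: coprime_left_2_iff_odd)
  have N0: "N > 0" "D > 0" using level(1) disc_pos by auto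
  have "coprime 8 (N * D)"
  proof -
    have "coprime (2 ^ 3) (N * D)" using oN by (simp only: coprime_power_left_iff coprime_left_2_iff_odd) simp
    then show ?thesis by simp
  qed
  \<comment> \<open>The residue 1 modulo 8 makes the new modulus odd and removes the eighth roots of
    unity; 2 modulo N leaves the dual side of reciprocity unchanged; 2 modulo D lets the symbol
    (D/c) be compared with (D/2).\<close>
  then obtain x where x: "[x = 1] (mod 8)" "[x = 2] (mod N * D)" using binary_chinese_remainder_int by blast
  define c where "c = x mod (8 * (N * D))"
  have c8: "[c = 1] (mod 8)" and cND: "[c = 2] (mod N * D)"
    using x unfolding c_def cong_def by (simp_all add: mod_mod_cancel)
  have c_ge: "c \<ge> 0" unfolding c_def using N0 by simp
  have m8: "c mod 8 = 1" using c8 by (simp add: cong_def)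
  then have c0: "c > 0" using c_ge by (cases "c = 0") auto
  have "c mod 2 = c mod 8 mod 2" "c mod 4 = c mod 8 mod 4" by (simp_all add: mod_mod_cancel)
  then have oc: "odd c" and cm4: "c mod 4 = 1" unfolding m8 by (auto simp: odd_iff_mod_2_eq_one)
  have cN: "[c = 2] (mod N)" and cD: "[c = 2] (mod D)" using cND by (meson cong_dvd_modulus dvd_triv_left dvd_triv_right)+
  have copN: "coprime c N" using cN N by (metis cong_imp_coprime cong_sym)
  have copD: "coprime c D" by (rule coprime_disc[OF copN])
  obtain T where T: "transversal T Ld L" "finite T" by (rule transversal_dual)
  define K where "K = (- \<i>) powr (- (of_nat CARD('n) / 2)) / of_real (sqrt (disc B L))"
  have rec: "gauss 1 m = of_real (sqrt (of_int m) ^ CARD('n)) * (K * (\<Sum>t\<in>T. ee (of_real (- of_int m * quad B t))))" if "m > 0" for m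
  proof -
    have "of_int m powr (real CARD('n) / 2) = (of_int m powr (1 / 2)) powr real CARD('n)" by (simp add: powr_powr)
    also have "\<dots> = sqrt (of_int m) ^ CARD('n)" using that by (simp add: powr_half_sqrt powr_realpow)
    finally show ?thesis unfolding gauss_reciprocity[OF that T] K_def by simp
  qed
  \<comment> \<open>N Q(t) is integral on the dual lattice, so only the residue of the modulus
    modulo N is seen.\<close>
  have "(\<Sum>t\<in>T. ee (of_real (- of_int 2 * quad B t))) = (\<Sum>t\<in>T. ee (of_real (- of_int c * quad B t)))"
  proof (rule sum.cong[OF refl], rule ee_cong)
    fix t assume "t \<in> T"
    then have t: "t \<in> Ld" using transversalD(1)[OF T(1)] by blast
    obtain j where "c - 2 = N * j" using cN by (metis cong_iff_dvd_diff dvdE)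
    then have "of_int c - of_int 2 = (of_int N * of_int j :: real)" by (metis of_int_diff of_int_mult)
    then have "- of_int 2 * quad B t - - of_int c * quad B t = of_int j * (of_int N * quad B t)" by (simp add: algebra_simps)
    then show "- of_int 2 * quad B t - - of_int c * quad B t \<in> \<int>" using level(2)[OF t] by (metis Ints_mult Ints_of_int)
  qed
  note sums = this
  have Gc: "gauss 1 c = of_int (kronecker D c) * of_real (sqrt (of_int c) ^ CARD('n))"
  proof -
    have "(of_int (1 - c) / 8 :: real) \<in> \<int>"
      using of_int_divide_in_Ints_iff[of 8 "1 - c"] c8 by (simp add: cong_iff_dvd_diff dvd_diff_commute)
    then have "ee (of_real (of_int (1 - c) / 8)) = 1" by (rule ee_Ints)
    then have "qgauss 2 c = of_real (sqrt (of_int c))" using qgauss_two[OF c0 oc] by simp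
    then show ?thesis using gauss_odd[OF c0 oc copN, of 1] by simp
  qed
  have "gauss 1 2 = of_real (sqrt 2 ^ CARD('n)) * (K * (\<Sum>t\<in>T. ee (of_real (- of_int c * quad B t))))"
    using rec[of 2] unfolding sums by simp
  moreover have "K * (\<Sum>t\<in>T. ee (of_real (- of_int c * quad B t))) = of_int (kronecker D c)"
    using rec[OF c0] Gc c0 by simp
  ultimately have G2: "gauss 1 2 = of_int (kronecker D c) * of_real (sqrt 2 ^ CARD('n))" by simp
  \<comment> \<open>This sum is evaluated twice. Split over D and c it gives e((1 - D)/8) times
    (D/c), as c is 2 modulo D; evaluated as a whole it gives \<open>eps D\<close>. With
    \<open>kronecker_two\<close> the comparison yields (D/c) = (D/2).\<close>
  have "qgauss 1 (D * c) = qgauss (1 * c) D * qgauss (1 * D) c"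
    by (rule qgauss_mult) (use N0 c0 copD in \<open>auto simp: coprime_commute\<close>)
  moreover have "qgauss (1 * c) D = qgauss 2 D" using qgauss_cong[OF N0(2) cD] by simp
  moreover have "qgauss (1 * D) c = of_int (kronecker D c) * qgauss 1 c"
    using qgauss_kronecker[OF c0 oc, of D 1] copD by (simp add: coprime_commute)
  moreover have "eps (D * c) = eps D" using cm4 by (simp add: eps_def mod_mult_right_eq[of D c 4, symmetric])
  ultimately have "of_real (sqrt (of_int (D * c))) * eps D = of_real (sqrt (of_int D)) * ee (of_int (1 - D) / 8) * (of_int (kronecker D c) * of_real (sqrt (of_int c)))"
    using qgauss_one[of "D * c"] qgauss_two[OF N0(2) oN(2)] qgauss_one[OF c0 oc] N0 c0 oc oN cm4 by (simp add: eps_def)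
  then have "eps D = ee (of_int (1 - D) / 8) * of_int (kronecker D c)" using N0 c0 by (simp add: real_sqrt_mult)
  then have "ee (of_int (1 - D) / 8) * of_int (kronecker D c) = ee (of_int (1 - D) / 8) * (of_int (kronecker D 2) :: complex)"
    using kronecker_two[OF oN(2)] by (metis mult.commute)
  then have "(of_int (kronecker D c) :: complex) = of_int (kronecker D 2)"
    by (simp add: ee_def)
  moreover have "gauss a 2 = gauss 1 2" by (rule gauss_cong) (use a in \<open>simp_all add: cong_def odd_iff_mod_2_eq_one\<close>)
  ultimately show ?thesis using G2 by simp
qed

text \<open>The Gauss sum modulo 2 is a sum of signs, hence an integer, while its square is 2^n by
  \<open>gauss_two\<close>. The parity of the rank is thus a by-product of the evaluation.\<close>

lemma even_dimension:
  assumes N: "coprime 2 N"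
  shows "even CARD('n)"
proof -
  have "\<exists>k::int. ee (of_real (of_int 1 * quad B r / of_int 2)) = of_int k" if r: "r \<in> coset_reps 2" for r
  proof -
    have "r \<in> L" using transversalD(1)[OF coset_reps(1)[of 2]] r by auto
    then obtain q where q: "quad B r = of_int q" using quad_int by (auto elim: Ints_cases)
    have "ee (of_real (of_int 1 * quad B r / of_int 2)) = (if even q then 1 else -1)"
    proof (cases "even q")
      case True
      then obtain j where "q = 2 * j" by blast
      then show ?thesis using q by simp
    next
      case False
      then obtain j where j: "q = 2 * j + 1" by (rule oddE)
      have "of_int 1 * quad B r / of_int 2 - 1 / 2 = (of_int j :: real)" unfolding q j by (simp add: field_simps)
      then have "ee (of_real (of_int 1 * quad B r / of_int 2)) = ee (of_real (1 / 2))" by (intro ee_cong) simp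
      then show ?thesis using False ee_quarter(3) by simp
    qed
    then show ?thesis by (metis of_int_1 of_int_minus)
  qed
  then obtain h :: "real ^ 'n \<Rightarrow> int" where h: "\<And>r. r \<in> coset_reps 2 \<Longrightarrow> ee (of_real (of_int 1 * quad B r / of_int 2)) = of_int (h r)" by metis
  define s where "s = (\<Sum>r\<in>coset_reps 2. h r)"
  have "gauss 1 2 = of_int s" unfolding gauss_def s_def using h by simp
  then have e: "of_int s = of_int (kronecker D 2) * complex_of_real (sqrt 2 ^ CARD('n))" using gauss_two[OF N, of 1] by simp
  have k: "(kronecker D 2)\<^sup>2 = 1" using kronecker_sq[of 2 D] coprime_disc[OF N] by (simp add: coprime_commute)
  have "complex_of_int (s\<^sup>2) = of_int ((kronecker D 2)\<^sup>2) * complex_of_real ((sqrt 2 ^ CARD('n))\<^sup>2)"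
    using e by (simp add: power_mult_distrib)
  also have "(sqrt 2 ^ CARD('n))\<^sup>2 = (2::real) ^ CARD('n)" 
  proof -
    have "(sqrt 2 ^ CARD('n))\<^sup>2 = ((sqrt 2)\<^sup>2) ^ CARD('n)" by (simp only: power_mult[symmetric] mult.commute)
    then show ?thesis by simp
  qed
  finally have "complex_of_int (s\<^sup>2) = complex_of_int (2 ^ CARD('n))" unfolding k by simp
  then have "s\<^sup>2 = 2 ^ CARD('n)" by (metis of_int_eq_iff)
  then show ?thesis by (rule even_exponent_of_square)
qed

lemma gauss_two_power:
  assumes N: "coprime 2 N" and a: "odd a"
  shows "gauss a (2 ^ k) = of_int (kronecker D (2 ^ k)) * of_real (sqrt (2 ^ k) ^ CARD('n))"
proof (induction k rule: less_induct)
  case (less k)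
  have c: "coprime a 2" using a by simp
  consider "k = 0" | "k = 1" | j where "k = j + 2" by (metis add_2_eq_Suc' not0_implies_Suc One_nat_def)
  then show ?case
  proof cases
    case 1 then show ?thesis by (simp add: gauss_1)
  next
    case 2 then show ?thesis using gauss_two[OF assms] by simp
  next
    case 3
    have k: "(kronecker D 2)\<^sup>2 = 1" using kronecker_sq[of 2 D] coprime_disc[OF N] by (simp add: coprime_commute)
    have "kronecker D (2 ^ k) = kronecker D (2 ^ j)"
      unfolding 3 by (rule kronecker_power_add_2) (use k in simp_all)
    moreover have "sqrt (2 ^ k) = 2 * sqrt (2 ^ j)" unfolding 3 power_add by (simp add: real_sqrt_mult)
    moreover have "gauss a (2 ^ k) = 2 ^ CARD('n) * gauss a (2 ^ j)"
      using gauss_prime_power[OF _ N c, of j] unfolding 3 by simp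
    ultimately show ?thesis using less.IH[of j] 3 by (simp add: power_mult_distrib)
  qed
qed

text \<open>For odd c, a negative a is reduced to |a| by complex conjugation: the symbols are real
  and only the root of unity is inverted, which explains sgn a. For even c the power of 2
  contributes no root of unity, and the even rank makes the n-th powers of symbols equal to
  1.\<close>

theorem gauss_sum:
  assumes c: "c > 0" "c = 2 ^ k * c\<^sub>0" "odd c\<^sub>0" and N: "coprime c N" and a: "a \<noteq> 0" "coprime a c"
  shows "gauss a c = of_real (sqrt (of_int c) ^ CARD('n)) * of_int (kronecker \<bar>a\<bar> c) ^ CARD('n) * of_int (kronecker D c)
     * ee (of_nat CARD('n) * of_int (sgn a) * of_int (1 - c\<^sub>0) / 8)"
proof -
  let ?n = "CARD('n)"
  have c00: "c\<^sub>0 > 0" using c(1,2) by (metis zero_less_mult_pos zero_less_power zero_less_numeral)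
  have cop: "coprime c\<^sub>0 N" "coprime a c\<^sub>0" using N a(2) unfolding c(2) by auto
  have odd_case: "gauss b c\<^sub>0 = of_int (kronecker D c\<^sub>0) * (of_int (kronecker b c\<^sub>0) * of_real (sqrt (of_int c\<^sub>0)) * ee (of_int (1 - c\<^sub>0) / 8)) ^ ?n"
    if "coprime b c\<^sub>0" for b
  proof -
    have "qgauss (b * 2) c\<^sub>0 = of_int (kronecker b c\<^sub>0) * qgauss 2 c\<^sub>0"
      by (rule qgauss_kronecker[OF c00 c(3) that]) (use c(3) in \<open>simp add: coprime_left_2_iff_odd\<close>)
    then have "qgauss (2 * b) c\<^sub>0 = of_int (kronecker b c\<^sub>0) * of_real (sqrt (of_int c\<^sub>0)) * ee (of_int (1 - c\<^sub>0) / 8)"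
      unfolding qgauss_two[OF c00 c(3)] by (simp only: mult.assoc mult.commute[of b 2])
    then show ?thesis unfolding gauss_odd[OF c00 c(3) cop(1) that] by (simp only:)
  qed
  show ?thesis
  proof (cases "k = 0")
    case True
    then have cc: "c = c\<^sub>0" using c(2) by simp
    have pos: "gauss b c = of_real (sqrt (of_int c) ^ ?n) * of_int (kronecker b c) ^ ?n * of_int (kronecker D c) * ee (of_real (of_nat ?n * of_int (1 - c\<^sub>0) / 8))"
      if "coprime b c\<^sub>0" for b
      unfolding cc odd_case[OF that] by (simp add: power_mult_distrib ee_power mult_ac)
    show ?thesis
    proof (cases "a > 0")
      case True
      then show ?thesis using pos[OF cop(2)] by simp
    next
      case False
      then have a0: "a < 0" using a(1) by simp
      have "gauss a c = cnj (gauss \<bar>a\<bar> c)" using gauss_minus[of "\<bar>a\<bar>" c] a0 by simp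
      also have "\<dots> = of_real (sqrt (of_int c) ^ ?n) * of_int (kronecker \<bar>a\<bar> c) ^ ?n * of_int (kronecker D c) * cnj (ee (of_real (of_nat ?n * of_int (1 - c\<^sub>0) / 8)))"
        using pos[of "\<bar>a\<bar>"] cop(2) by simp
      also have "cnj (ee (of_real (of_nat ?n * of_int (1 - c\<^sub>0) / 8))) = ee (of_nat ?n * of_int (sgn a) * of_int (1 - c\<^sub>0) / 8)"
        using a0 by (simp add: ee_def exp_cnj)
      finally show ?thesis .
    qed
  next
    case False
    then have "even c" unfolding c(2) by simp
    then have N2: "coprime 2 N" and oa: "odd a" using N a(2)
      by (auto simp: coprime_left_2_iff_odd dest: coprime_common_divisor[of _ _ 2])
    obtain m where m: "?n = 2 * m" using even_dimension[OF N2] by blast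
    have oc: "odd (a * c\<^sub>0)" using oa c(3) by simp
    have c2: "coprime (2 ^ k) c\<^sub>0" using c(3) by (simp add: coprime_left_2_iff_odd)
    have b: "coprime (a * 2 ^ k) c\<^sub>0" using cop(2) c2 by simp
    \<comment> \<open>With n = 2 m this is the m-th power of the square of a symbol, so the symbols
      of a and of 2^k drop out.\<close>
    have sq1: "of_int (kronecker b c') ^ ?n = (1 :: complex)" if "c' > 0" "coprime b c'" for b c'
    proof -
      have "of_int (kronecker b c') ^ ?n = (of_int ((kronecker b c')\<^sup>2) :: complex) ^ m" unfolding m by (simp add: power_mult)
      then show ?thesis unfolding kronecker_sq[OF that] by simp
    qed
    have "gauss a c = gauss (a * c\<^sub>0) (2 ^ k) * gauss (a * 2 ^ k) c\<^sub>0"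
      unfolding c(2) by (rule gauss_mult) (use c00 c2 in auto)
    also have "\<dots> = of_int (kronecker D (2 ^ k)) * of_real (sqrt (2 ^ k) ^ ?n) * (of_int (kronecker D c\<^sub>0) * (of_int (kronecker (a * 2 ^ k) c\<^sub>0) ^ ?n * of_real (sqrt (of_int c\<^sub>0) ^ ?n) * ee (of_int (1 - c\<^sub>0) / 8) ^ ?n))"
      unfolding gauss_two_power[OF N2 oc] odd_case[OF b] by (simp add: power_mult_distrib)
    also have "\<dots> = of_real ((sqrt (2 ^ k) * sqrt (of_int c\<^sub>0)) ^ ?n) * of_int (kronecker D (2 ^ k) * kronecker D c\<^sub>0) * ee (of_int (1 - c\<^sub>0) / 8) ^ ?n"
      unfolding sq1[OF c00 b] by (simp add: power_mult_distrib mult_ac)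
    also have "sqrt (2 ^ k) * sqrt (of_int c\<^sub>0) = sqrt (of_int c)" unfolding c(2) by (simp add: real_sqrt_mult)
    also have "kronecker D (2 ^ k) * kronecker D c\<^sub>0 = kronecker D c" unfolding c(2) by (rule kronecker_mult[symmetric]) (use c00 in auto)
    also have "ee (of_int (1 - c\<^sub>0) / 8) ^ ?n = ee (of_nat ?n * of_int (sgn a) * of_int (1 - c\<^sub>0) / 8)"
    proof -
      have "even (1 - c\<^sub>0)" using c(3) by simp
      then obtain j where j: "1 - c\<^sub>0 = 2 * j" by (rule dvdE)
      have "ee (of_real (real ?n * of_int (1 - c\<^sub>0) / 8)) = ee (of_real (real ?n * of_int (sgn a) * of_int (1 - c\<^sub>0) / 8))"
      proof (rule ee_cong)
        \<comment> \<open>Changing the sign of a alters the exponent by n (1 -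
          \<open>c\<^sub>0\<close>) / 4, an integer because both n and 1 - \<open>c\<^sub>0\<close>
          are even.\<close>
        have s: "sgn a = 1 \<or> sgn a = - 1" using a(1) by (simp add: sgn_if)
        have "real ?n * of_int (1 - c\<^sub>0) / 8 - real ?n * of_int (sgn a) * of_int (1 - c\<^sub>0) / 8 = of_int (if sgn a = 1 then 0 else int m * j)"
          using s unfolding j m by (elim disjE) simp_all
        then show "real ?n * of_int (1 - c\<^sub>0) / 8 - real ?n * of_int (sgn a) * of_int (1 - c\<^sub>0) / 8 \<in> \<int>" by (simp only: Ints_of_int)
      qed
      then show ?thesis unfolding ee_power by simp
    qed
    also have "of_real (sqrt (of_int c) ^ ?n) * of_int (kronecker D c) * ee (of_nat ?n * of_int (sgn a) * of_int (1 - c\<^sub>0) / 8)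
      = of_real (sqrt (of_int c) ^ ?n) * of_int (kronecker \<bar>a\<bar> c) ^ ?n * of_int (kronecker D c) * ee (of_nat ?n * of_int (sgn a) * of_int (1 - c\<^sub>0) / 8)"
      using sq1[OF c(1), of "\<bar>a\<bar>"] a(2) by simp
    finally show ?thesis .
  qed
qed

end

theorem theorem7p4:
  fixes B :: "real ^ 'n \<Rightarrow> real ^ 'n \<Rightarrow> real"
    and L :: "(real ^ 'n) set"
    and t :: "real ^ 'n"
    and \<tau> :: complex
    and z :: "complex ^ 'n"
    and a b c d c' c\<^sub>0 :: int
    and k :: nat
  assumes "pos_def_inner_product B"
    and "is_lattice L"
    and "even_integral B L"
    and "t \<in> dual_lattice B L"
    and "Im \<tau> > 0"
    and "a * d - b * c = 1"
    and "c > 0"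
    and "coprime c (int (level B L))"
    and "a \<noteq> 0"
    and "c = 2 ^ k * c\<^sub>0" and "odd c\<^sub>0"
    and "[c * c' = 1] (mod (a * int (level B L)))"
  shows
    "let n = CARD('n);
         D = disc B L;
         w = of_int c * \<tau> + of_int d;
         \<gamma> = 1 / of_real (sqrt (real D)) * (- \<i>) powr (of_nat n / 2)
             * of_int (kronecker \<bar>a\<bar> c) ^ n * of_int (kronecker (int D) c)
             * ee (of_nat n * of_int (sgn a) * of_int (1 - c\<^sub>0) / 8);
         C = (\<lambda>v. ee (of_real (of_int (b + c') / of_int a * quad B v
                              - of_int c' * B t v
                              + of_int a * of_int c' * quad B t)))
     in w powr (- (of_nat n / 2)) * ee (- (of_int c / w) * cquad B z)
          * theta B L t ((of_int a * \<tau> + of_int b) / w) (\<chi> i. z $ i / w)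
        = \<gamma> * (\<Sum>\<^sub>\<infinity>v\<in>dual_lattice B L.
                 C v * ee (\<tau> * of_real (quad B v)) * ee (cbilin B (cvec v) z))"
proof -
  interpret int_lattice B L by unfold_locales (use assms(1-3) in auto)
  let ?n = "CARD('n)"
  define w where "w = of_int c * \<tau> + of_int d"
  have "coprime a c"
  proof (rule coprimeI)
    fix x assume "x dvd a" "x dvd c"
    then have "x dvd a * d - b * c" by simp
    then show "is_unit x" using assms(6) by simp
  qed
  note theta_coeff = gauss_sum[OF assms(7,10,11,8,9) this]
  \<comment> \<open>The power of c from Poisson summation cancels the absolute value of the Gauss
    sum.\<close>
  have "of_int c powr (- (real ?n / 2)) * sqrt (of_int c) ^ ?n = (1 :: real)"
  proof -
    have c: "(of_int c :: real) > 0" using assms(7) by simp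
    have "sqrt (of_int c) ^ ?n = (of_int c powr (1 / 2)) powr real ?n" using c by (simp add: powr_half_sqrt powr_realpow)
    also have "\<dots> = of_int c powr (real ?n / 2)" by (simp add: powr_powr)
    finally show ?thesis using c by (simp add: powr_add[symmetric])
  qed
  then have pw: "complex_of_real (of_int c powr (- (real ?n / 2))) * of_real (sqrt (of_int c) ^ ?n) = 1"
    by (metis of_real_1 of_real_mult)
  have const: "(- \<i>) powr (of_nat ?n / 2) * of_real (of_int c powr (- (real ?n / 2))) / of_real (sqrt (disc B L)) * gauss a c
    = 1 / of_real (sqrt (real (disc B L))) * (- \<i>) powr (of_nat ?n / 2)
             * of_int (kronecker \<bar>a\<bar> c) ^ ?n * of_int (kronecker D c)
             * ee (of_nat ?n * of_int (sgn a) * of_int (1 - c\<^sub>0) / 8)"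
  proof -
    have "(- \<i>) powr (of_nat ?n / 2) * of_real (of_int c powr (- (real ?n / 2))) / of_real (sqrt (disc B L)) * gauss a c
      = (of_real (of_int c powr (- (real ?n / 2))) * of_real (sqrt (of_int c) ^ ?n)) * (1 / of_real (sqrt (real (disc B L))) * (- \<i>) powr (of_nat ?n / 2)
             * of_int (kronecker \<bar>a\<bar> c) ^ ?n * of_int (kronecker D c)
             * ee (of_nat ?n * of_int (sgn a) * of_int (1 - c\<^sub>0) / 8))"
      unfolding theta_coeff by (simp only: times_divide_eq_left times_divide_eq_right mult_1 mult_ac)
    then show ?thesis unfolding pw by (simp only: mult_1)
  qed
  show ?thesis
    unfolding Let_def
    using theta_modular_gauss[OF assms(6,7,9,12,4,5) refl, of z] unfolding const .
qed

end
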